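(* Let $w_1,w_2\in\mathcal S(\mathfrak g)$ with $\|w_1\|_{L^2(\mathfrak g)}=\|w_2\|_{L^2(\mathfrak g)}=1$. Let $\|\cdot\|_{\mathcal B_1}$ and $\|\cdot\|_{\mathcal B_2}$ be two norms on $\mathcal S(\Xi)$ and $\|\cdot\|_{\mathfrak B}$ a norm on $\mathcal S(\Xi\times\Xi)$. Suppose that there is a constant $C>0$ such that for every $\Psi\in\mathcal S(\Xi\times\Xi)$ the integral operator $\mathsf{Int}(\Psi)$ is bounded from $\big(\mathcal S(\Xi),\|\cdot\|_{\mathcal B_1}\big)$ to $\big(\mathcal S(\Xi),\|\cdot\|_{\mathcal B_2}\big)$, with operator norm less than or equal to $C\|\Psi\|_{\mathfrak B}$. Then, for every $f\in\mathcal S(\Xi)$, the pseudo-differential operator $\mathsf{Op}(f)$ is bounded from $\big(\mathcal S(\mathfrak g),\|\cdot\|_{\mathsf{co}_{w_1}(\mathcal B_1)}\big)$ to $\big(\mathcal S(\mathfrak g),\|\cdot\|_{\mathsf{co}_{w_2}(\mathcal B_2)}\big)$, with operator norm less than or equal to $C\,\|f\|_{\mathsf{Co}_{\mathcal W_{w_1,w_2}}(\mathfrak B)}$.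
   Context: Setting. $\mathsf G$ is a connected simply connected nilpotent Lie group with (finite-dimensional real) Lie algebra $\mathfrak g$, and $\mathfrak g^\sharp$ is the dual of $\mathfrak g$; $\langle X\mid\xi\rangle:=\xi(X)$. The exponential map is a diffeomorphism with inverse $\log$; $X\bullet Y:=\log[\exp(X)\exp(Y)]$ is the Baker-Campbell-Hausdorff product, a polynomial group law on $\mathfrak g$ with unit $0$ and inverse $X\mapsto -X$. Set $\Xi:=\mathfrak g\times\mathfrak g^\sharp$. $dX$ is a fixed Lebesgue measure on $\mathfrak g$, and $d\xi$ is the Lebesgue measure on $\mathfrak g^\sharp$ for which $(\mathcal Fu)(\xi)=\int_{\mathfrak g}e^{-i\langle X\mid\xi\rangle}u(X)\,dX$ is unitary $L^2(\mathfrak g)\to L^2(\mathfrak g^\sharp)$; $\Xi$ carries the product measure $d\mathcal X=dX\,d\xi$. $\mathcal S$ and $\mathcal S'$ denote Schwartz functions and tempered distributions. Scalar products are linear in the first variable; $\langle\cdot,\cdot\rangle_{(\mathfrak g)}$, $\langle\cdot,\cdot\rangle_{(\Xi)}$ denote both the $L^2$ scalar products and the compatible sesquilinear dualities between $\mathcal S'$ and $\mathcal S$, with $\langle h,F\rangle:=\overline{\langle F,h\rangle}$. Quantization. $[\mathsf{Op}(f)u](X)=\int_{\mathfrak g}\int_{\mathfrak g^\sharp}e^{i\langle X\bullet(-Y)\mid\xi\rangle}f(X,\xi)u(Y)\,dY\,d\xi$, i.e. $\mathsf{Op}(f)$ is the integral operator with kernel $\big[(\mathrm{id}\otimes\mathcal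 F^{-1})f\big](X,X\bullet[-Y])$. It is a linear isomorphism from $L^2(\Xi)$ onto the Hilbert-Schmidt operators on $L^2(\mathfrak g)$, from $\mathcal S(\Xi)$ onto the continuous linear operators $\mathcal S'(\mathfrak g)\to\mathcal S(\mathfrak g)$, and from $\mathcal S'(\Xi)$ onto the continuous linear operators $\mathcal S(\mathfrak g)\to\mathcal S'(\mathfrak g)$. For $f,g\in L^2(\Xi)$, $f\#g$ and $f^\#$ are defined by $\mathsf{Op}(f\#g)=\mathsf{Op}(f)\mathsf{Op}(g)$, $\mathsf{Op}(f^\#)=\mathsf{Op}(f)^*$; $\mathcal S(\Xi)$ is stable under these laws. They are extended by duality: for $F\in\mathcal S'(\Xi)$, $g,h\in\mathcal S(\Xi)$, $\langle F\#g,h\rangle_{(\Xi)}:=\langle F,h\#g^\#\rangle_{(\Xi)}$, $\langle g\#F,h\rangle_{(\Xi)}:=\langle F,g^\#\#h\rangle_{(\Xi)}$, $\langle F^\#,h\rangle_{(\Xi)}:=\langle h^\#,F\rangle_{(\Xi)}$. The Moyal algebra is $\mathcal M(\Xi):=\{F\in\mathcal S'(\Xi)\mid F\#\mathcal S(\Xi)\subset\mathcal S(\Xi),\ \mathcal S(\Xi)\#F\subset\mathcal S(\Xi)\}$, and for $F\in\mathcal S'(\Xi)$, $G\in\mathcal M(\Xi)$, $h\in\mathcal S(\Xi)$ one puts $\langle F\#G,h\rangle_{(\Xi)}:=\langle F,h\#G^\#\rangle_{(\Xi)}$, $\langle G\#F,h\rangle_{(\Xi)}:=\langle F,G^\#\#h\rangle_{(\Xi)}$.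 Weyl system and transforms. For $(Z,\zeta)\in\Xi$, $\varepsilon_{(Z,\zeta)}(X,\xi):=e^{i\langle X\mid\zeta\rangle}e^{-i\langle Z\mid\xi\rangle}$ (an element of $\mathcal M(\Xi)$), and $\mathsf E(Z,\zeta)$ is the unitary operator in $L^2(\mathfrak g)$ given by $[\mathsf E(Z,\zeta)u](X):=e^{i\langle X\mid\zeta\rangle}u([-Z]\bullet X)$. The Fourier-Wigner transform is $\mathcal E_{u,v}(Z,\zeta):=\langle\mathsf E(Z,\zeta)u,v\rangle_{(\mathfrak g)}$, and $\mathcal E_w(u):=\mathcal E_{u,w}$; it maps $\mathcal S(\mathfrak g)$ into $\mathcal S(\Xi)$ when $w\in\mathcal S(\mathfrak g)$. The Wigner transform $\mathcal W_{u,v}\in\mathcal S(\Xi)$ of $u,v\in\mathcal S(\mathfrak g)$ is determined by $\langle\mathsf{Op}(f)u,v\rangle_{(\mathfrak g)}=\langle f,\mathcal W_{u,v}\rangle_{(\Xi)}$ for all $f$. For $h\in\mathcal S(\Xi)$ and $f\in\mathcal S'(\Xi)$, $[\mathfrak E_h(f)](\mathcal Y,\mathcal Z):=\langle\varepsilon_{\mathcal Y}\#f\#\varepsilon_{\mathcal Z}^\#,h\rangle_{(\Xi)}$ for $\mathcal Y,\mathcal Z\in\Xi$; for $f\in\mathcal S(\Xi)$ it belongs to $\mathcal S(\Xi\times\Xi)$. Coorbit norms. For $u\in\mathcal S(\mathfrak g)$, $\|u\|_{\mathsf{co}_{w_j}(\mathcal B_j)}:=\|\mathcal E_{w_j}(u)\|_{\mathcal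 B_j}$ ($j=1,2$). For $f\in\mathcal S(\Xi)$ and a window $h\in\mathcal S(\Xi)$, $\|f\|_{\mathsf{Co}_h(\mathfrak B)}:=\|\mathfrak E_h(f)\|_{\mathfrak B}$. Integral operators. $[\mathsf{Int}(\Psi)g](\mathcal X):=\int_\Xi\Psi(\mathcal X,\mathcal Y)g(\mathcal Y)\,d\mathcal Y$. *)

theory Defs
  imports "HOL-Analysis.Analysis" "HOL-Algebra.Group"
begin

section \<open>Nilpotent Lie algebras and their Lie groups\<close>

primrec lower_central :: "('a \<Rightarrow> 'a \<Rightarrow> 'a::euclidean_space) \<Rightarrow> nat \<Rightarrow> 'a set" where
  "lower_central lie 0 = UNIV"
| "lower_central lie (Suc k) = span {lie X Y | X Y. Y \<in> lower_central lie k}"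

locale nilpotent_lie_algebra =
  fixes lie :: "'a \<Rightarrow> 'a \<Rightarrow> 'a::euclidean_space"
  assumes bilinear: "bilinear lie"
    and alternating: "lie X X = 0"
    and jacobi: "lie X (lie Y Z) + lie Y (lie Z X) + lie Z (lie X Y) = 0"
    and nilpotent: "\<exists>k. lower_central lie k = {0}"

definition nilpotency_class :: "('a \<Rightarrow> 'a \<Rightarrow> 'a::euclidean_space) \<Rightarrow> nat" where
  "nilpotency_class lie = (LEAST k. lower_central lie k = {0})"

fun nested_bracket :: "('a \<Rightarrow> 'a \<Rightarrow> 'a::euclidean_space) \<Rightarrow> 'a list \<Rightarrow> 'a" where
  "nested_bracket lie [] = 0"
| "nested_bracket lie [X] = X"
| "nested_bracket lie (X # Y # Zs) = lie X (nested_bracket lie (Y # Zs))"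

text \<open>
  Dynkin's form of the Baker-Campbell-Hausdorff series
  \<open>\<Sum>\<^sub>k (-1)\<^sup>k\<^sup>-\<^sup>1/k \<Sum> [X\<^sup>r\<^sup>1Y\<^sup>s\<^sup>1\<dots>X\<^sup>r\<^sup>kY\<^sup>s\<^sup>k] / ((\<Sum>\<^sub>i r\<^sub>i + s\<^sub>i) \<Prod>\<^sub>i r\<^sub>i! s\<^sub>i!)\<close>, the inner sum
  being over \<open>r\<^sub>i + s\<^sub>i > 0\<close>.  Right-nested brackets with more entries than the nilpotency class
  vanish, so the series is cut off there.
\<close>

definition dynkin_indices :: "nat \<Rightarrow> (nat \<times> nat) list set" where
  "dynkin_indices N =
     {ps. ps \<noteq> [] \<and> (\<forall>(r, s) \<in> set ps. 0 < r + s) \<and> (\<Sum>(r, s)\<leftarrow>ps. r + s) \<le> N}"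

definition bch :: "('a \<Rightarrow> 'a \<Rightarrow> 'a::euclidean_space) \<Rightarrow> 'a \<Rightarrow> 'a \<Rightarrow> 'a" where
  "bch lie X Y =
     (\<Sum>ps \<in> dynkin_indices (nilpotency_class lie).
        ((-1) ^ (length ps - 1) /
           (real (length ps) * real (\<Sum>(r, s)\<leftarrow>ps. r + s) * (\<Prod>(r, s)\<leftarrow>ps. fact r * fact s)))
        *\<^sub>R nested_bracket lie (concat (map (\<lambda>(r, s). replicate r X @ replicate s Y) ps)))"

text \<open>
  A connected simply connected nilpotent Lie group \<open>G\<close> with Lie algebra \<open>('a, lie)\<close> and
  exponential map \<open>Exp\<close>.  For such a group \<open>Exp\<close> is a diffeomorphism and the
  Baker-Campbell-Hausdorff formula holds globally.  Conversely, a group with such a bijection has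
  exactly one manifold structure making \<open>Exp\<close> a diffeomorphism (a global chart); with it \<open>G\<close> is a
  connected simply connected nilpotent Lie group with Lie algebra \<open>lie\<close> and exponential map \<open>Exp\<close>.
  Hence the manifold structure is not listed as separate data.
\<close>

locale nilpotent_lie_group =
  group G + nilpotent_lie_algebra lie
  for G :: "('g, 'm) monoid_scheme" (structure)
    and lie :: "'a \<Rightarrow> 'a \<Rightarrow> 'a::euclidean_space" +
  fixes Exp :: "'a \<Rightarrow> 'g"
  assumes Exp_bij: "bij_betw Exp UNIV (carrier G)"
    and Exp_mult: "Exp X \<otimes> Exp Y = Exp (bch lie X Y)"

definition log_mult :: "('g, 'm) monoid_scheme \<Rightarrow> ('a \<Rightarrow> 'g) \<Rightarrow> 'a \<Rightarrow> 'a \<Rightarrow> 'a" where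
  "log_mult G Exp X Y = inv_into UNIV Exp (Exp X \<otimes>\<^bsub>G\<^esub> Exp Y)"


section \<open>Schwartz functions and tempered distributions\<close>

definition partial :: "'e::euclidean_space \<Rightarrow> ('e \<Rightarrow> complex) \<Rightarrow> 'e \<Rightarrow> complex" where
  "partial b f x = frechet_derivative f (at x) b"

text \<open>\<open>partials bs f\<close> is the iterated partial derivative of \<open>f\<close> along the list \<open>bs\<close>.\<close>

definition partials :: "'e::euclidean_space list \<Rightarrow> ('e \<Rightarrow> complex) \<Rightarrow> 'e \<Rightarrow> complex" where
  "partials bs f = foldr partial bs f"

definition smooth :: "('e::euclidean_space \<Rightarrow> complex) \<Rightarrow> bool" where
  "smooth f \<longleftrightarrow> (\<forall>bs \<in> lists Basis. partials bs f differentiable_on UNIV)"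

definition schwartz :: "('e::euclidean_space \<Rightarrow> complex) set" where
  "schwartz = {f. smooth f \<and>
     (\<forall>bs \<in> lists Basis. \<forall>k::nat. \<exists>B. \<forall>x. norm x ^ k * norm (partials bs f x) \<le> B)}"

definition schwartz_seminorm :: "nat \<Rightarrow> ('e::euclidean_space \<Rightarrow> complex) \<Rightarrow> real" where
  "schwartz_seminorm N f =
     (SUP x. \<Sum>bs | bs \<in> lists Basis \<and> length bs \<le> N. (1 + norm x) ^ N * norm (partials bs f x))"

text \<open>
  The dualities between tempered distributions and Schwartz functions are linear in the
  distribution and antilinear in the function.  A distribution \<open>F\<close> is represented by the
  functional \<open>h \<mapsto> \<langle>F, h\<rangle>\<close>, which is therefore antilinear; only its values on Schwartz functions
  matter.
\<close>

type_synonym 'e distribution = "('e \<Rightarrow> complex) \<Rightarrow> complex"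

definition tempered :: "'e::euclidean_space distribution set" where
  "tempered = {F.
     (\<forall>h\<in>schwartz. \<forall>k\<in>schwartz. F (\<lambda>x. h x + k x) = F h + F k) \<and>
     (\<forall>c. \<forall>h\<in>schwartz. F (\<lambda>x. c * h x) = cnj c * F h) \<and>
     (\<exists>N C. \<forall>h\<in>schwartz. norm (F h) \<le> C * schwartz_seminorm N h)}"


section \<open>Measures, scalar products, operator norms\<close>

text \<open>
  The dual of \<open>'a\<close> is identified with \<open>'a\<close> through the inner product, so that
  \<open>\<langle>X | \<xi>\<rangle> = X \<bullet> \<xi>\<close>.  The inner product is not part of the data; any Lebesgue measure on a
  finite-dimensional space is \<open>lborel\<close> for a suitable inner product.  The factor \<open>(2\<pi>)\<^sup>-\<^sup>n\<close> in the
  measure on the dual is the one for which \<open>u \<mapsto> (\<lambda>\<xi>. \<integral> e\<^sup>-\<^sup>i\<^sup>\<langle>\<^sup>X\<^sup>|\<^sup>\<xi>\<^sup>\<rangle> u(X) dX)\<close> is unitary.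
\<close>

definition dual_lebesgue :: "'a::euclidean_space measure" where
  "dual_lebesgue = density lborel (\<lambda>_. ennreal (1 / (2 * pi) ^ DIM('a)))"

definition Xi_lebesgue :: "('a::euclidean_space \<times> 'a) measure" where
  "Xi_lebesgue = lborel \<Otimes>\<^sub>M dual_lebesgue"

definition l2_inner :: "'e measure \<Rightarrow> ('e \<Rightarrow> complex) \<Rightarrow> ('e \<Rightarrow> complex) \<Rightarrow> complex" where
  "l2_inner M u v = (LINT x|M. u x * cnj (v x))"

definition l2_norm :: "'e measure \<Rightarrow> ('e \<Rightarrow> complex) \<Rightarrow> real" where
  "l2_norm M u = sqrt (LINT x|M. (norm (u x))\<^sup>2)"

definition norm_on :: "('e \<Rightarrow> complex) set \<Rightarrow> (('e \<Rightarrow> complex) \<Rightarrow> real) \<Rightarrow> bool" where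
  "norm_on V p \<longleftrightarrow>
     (\<forall>u\<in>V. 0 \<le> p u \<and> (p u = 0 \<longleftrightarrow> u = (\<lambda>_. 0))) \<and>
     (\<forall>c. \<forall>u\<in>V. p (\<lambda>x. c * u x) = norm c * p u) \<and>
     (\<forall>u\<in>V. \<forall>v\<in>V. p (\<lambda>x. u x + v x) \<le> p u + p v)"

definition linear_map_on ::
  "('d \<Rightarrow> complex) set \<Rightarrow> ('e \<Rightarrow> complex) set \<Rightarrow> (('d \<Rightarrow> complex) \<Rightarrow> 'e \<Rightarrow> complex) \<Rightarrow> bool" where
  "linear_map_on V W T \<longleftrightarrow>
     (\<forall>u\<in>V. T u \<in> W) \<and>
     (\<forall>u\<in>V. \<forall>v\<in>V. T (\<lambda>x. u x + v x) = (\<lambda>x. T u x + T v x)) \<and>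
     (\<forall>c. \<forall>u\<in>V. T (\<lambda>x. c * u x) = (\<lambda>x. c * T u x))"

definition bounded_operator ::
  "('d \<Rightarrow> complex) set \<Rightarrow> (('d \<Rightarrow> complex) \<Rightarrow> real) \<Rightarrow>
   ('e \<Rightarrow> complex) set \<Rightarrow> (('e \<Rightarrow> complex) \<Rightarrow> real) \<Rightarrow>
   (('d \<Rightarrow> complex) \<Rightarrow> 'e \<Rightarrow> complex) \<Rightarrow> bool" where
  "bounded_operator V p W q T \<longleftrightarrow>
     linear_map_on V W T \<and> (\<exists>B. \<forall>u\<in>V. q (T u) \<le> B * p u)"

definition operator_norm ::
  "('d \<Rightarrow> complex) set \<Rightarrow> (('d \<Rightarrow> complex) \<Rightarrow> real) \<Rightarrow> (('e \<Rightarrow> complex) \<Rightarrow> real) \<Rightarrow>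
   (('d \<Rightarrow> complex) \<Rightarrow> 'e \<Rightarrow> complex) \<Rightarrow> real" where
  "operator_norm V p q T = Inf {B. 0 \<le> B \<and> (\<forall>u\<in>V. q (T u) \<le> B * p u)}"

definition Int_op ::
  "(('a::euclidean_space \<times> 'a) \<times> ('a \<times> 'a) \<Rightarrow> complex) \<Rightarrow>
   ('a \<times> 'a \<Rightarrow> complex) \<Rightarrow> 'a \<times> 'a \<Rightarrow> complex" where
  "Int_op \<Psi> g x = (LINT y|Xi_lebesgue. \<Psi> (x, y) * g y)"


section \<open>Pseudo-differential operators and the symbol algebra\<close>

text \<open>Throughout, \<open>m\<close> is the group law \<open>X \<bullet> Y\<close> on the Lie algebra.\<close>

definition Op ::
  "('a \<Rightarrow> 'a \<Rightarrow> 'a) \<Rightarrow> ('a::euclidean_space \<times> 'a \<Rightarrow> complex) \<Rightarrow> ('a \<Rightarrow> complex) \<Rightarrow> 'a \<Rightarrow> complex" where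
  "Op m f u X =
     (LINT Y|lborel. LINT \<xi>|dual_lebesgue. cis (m X (- Y) \<bullet> \<xi>) * f (X, \<xi>) * u Y)"

text \<open>
  \<open>f # g\<close> and \<open>f\<^sup>#\<close> for Schwartz symbols.  \<open>Op f\<close> is determined by its restriction to the Schwartz
  functions, which are dense and stable under \<open>Op f\<close>.
\<close>

definition sharp ::
  "('a \<Rightarrow> 'a \<Rightarrow> 'a) \<Rightarrow> ('a::euclidean_space \<times> 'a \<Rightarrow> complex) \<Rightarrow> ('a \<times> 'a \<Rightarrow> complex) \<Rightarrow>
   'a \<times> 'a \<Rightarrow> complex" where
  "sharp m f g = (THE k. k \<in> schwartz \<and> (\<forall>u\<in>schwartz. Op m k u = Op m f (Op m g u)))"

definition sharp_adj ::
  "('a \<Rightarrow> 'a \<Rightarrow> 'a) \<Rightarrow> ('a::euclidean_space \<times> 'a \<Rightarrow> complex) \<Rightarrow> 'a \<times> 'a \<Rightarrow> complex" where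
  "sharp_adj m f = (THE k. k \<in> schwartz \<and>
     (\<forall>u\<in>schwartz. \<forall>v\<in>schwartz. l2_inner lborel (Op m k u) v = l2_inner lborel u (Op m f v)))"

definition dist_of :: "('a::euclidean_space \<times> 'a \<Rightarrow> complex) \<Rightarrow> ('a \<times> 'a) distribution" where
  "dist_of f = (\<lambda>h. l2_inner Xi_lebesgue f h)"

definition schwartz_of :: "('a::euclidean_space \<times> 'a) distribution \<Rightarrow> 'a \<times> 'a \<Rightarrow> complex" where
  "schwartz_of F = (THE k. k \<in> schwartz \<and> (\<forall>h\<in>schwartz. F h = dist_of k h))"

text \<open>\<open>F # g\<close>, \<open>g # F\<close> and \<open>F\<^sup>#\<close> for a tempered distribution \<open>F\<close> and a Schwartz function \<open>g\<close>.\<close>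

definition dist_sharp_fun ::
  "('a \<Rightarrow> 'a \<Rightarrow> 'a) \<Rightarrow> ('a::euclidean_space \<times> 'a) distribution \<Rightarrow> ('a \<times> 'a \<Rightarrow> complex) \<Rightarrow>
   ('a \<times> 'a) distribution" where
  "dist_sharp_fun m F g = (\<lambda>h. F (sharp m h (sharp_adj m g)))"

definition fun_sharp_dist ::
  "('a \<Rightarrow> 'a \<Rightarrow> 'a) \<Rightarrow> ('a::euclidean_space \<times> 'a \<Rightarrow> complex) \<Rightarrow> ('a \<times> 'a) distribution \<Rightarrow>
   ('a \<times> 'a) distribution" where
  "fun_sharp_dist m g F = (\<lambda>h. F (sharp m (sharp_adj m g) h))"

definition dist_adj ::
  "('a \<Rightarrow> 'a \<Rightarrow> 'a) \<Rightarrow> ('a::euclidean_space \<times> 'a) distribution \<Rightarrow> ('a \<times> 'a) distribution" where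
  "dist_adj m F = (\<lambda>h. cnj (F (sharp_adj m h)))"

definition moyal_algebra ::
  "('a \<Rightarrow> 'a \<Rightarrow> 'a) \<Rightarrow> ('a::euclidean_space \<times> 'a) distribution set" where
  "moyal_algebra m = {F \<in> tempered. \<forall>g\<in>schwartz.
     (\<exists>k\<in>schwartz. \<forall>h\<in>schwartz. dist_sharp_fun m F g h = dist_of k h) \<and>
     (\<exists>k\<in>schwartz. \<forall>h\<in>schwartz. fun_sharp_dist m g F h = dist_of k h)}"

text \<open>
  \<open>F # G\<close> and \<open>G # F\<close> for \<open>F\<close> tempered and \<open>G\<close> in the Moyal algebra, which is stable under \<open>\<^sup>#\<close>;
  hence \<open>h # G\<^sup>#\<close> and \<open>G\<^sup># # h\<close> are Schwartz functions for every Schwartz function \<open>h\<close>.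
\<close>

definition dist_sharp_moyal ::
  "('a \<Rightarrow> 'a \<Rightarrow> 'a) \<Rightarrow> ('a::euclidean_space \<times> 'a) distribution \<Rightarrow> ('a \<times> 'a) distribution \<Rightarrow>
   ('a \<times> 'a) distribution" where
  "dist_sharp_moyal m F G = (\<lambda>h. F (schwartz_of (fun_sharp_dist m h (dist_adj m G))))"

definition moyal_sharp_dist ::
  "('a \<Rightarrow> 'a \<Rightarrow> 'a) \<Rightarrow> ('a::euclidean_space \<times> 'a) distribution \<Rightarrow> ('a \<times> 'a) distribution \<Rightarrow>
   ('a \<times> 'a) distribution" where
  "moyal_sharp_dist m G F = (\<lambda>h. F (schwartz_of (dist_sharp_fun m (dist_adj m G) h)))"


section \<open>Weyl system, Wigner transforms, coorbit norms\<close>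

definition eps :: "'a::euclidean_space \<times> 'a \<Rightarrow> 'a \<times> 'a \<Rightarrow> complex" where
  "eps = (\<lambda>(Z, \<zeta>) (X, \<xi>). cis (X \<bullet> \<zeta>) * cis (- (Z \<bullet> \<xi>)))"

definition weyl ::
  "('a \<Rightarrow> 'a \<Rightarrow> 'a) \<Rightarrow> 'a::euclidean_space \<times> 'a \<Rightarrow> ('a \<Rightarrow> complex) \<Rightarrow> 'a \<Rightarrow> complex" where
  "weyl m = (\<lambda>(Z, \<zeta>) u X. cis (X \<bullet> \<zeta>) * u (m (- Z) X))"

definition fourier_wigner ::
  "('a \<Rightarrow> 'a \<Rightarrow> 'a) \<Rightarrow> ('a::euclidean_space \<Rightarrow> complex) \<Rightarrow> ('a \<Rightarrow> complex) \<Rightarrow>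
   'a \<times> 'a \<Rightarrow> complex" where
  "fourier_wigner m u v z = l2_inner lborel (weyl m z u) v"

definition wigner ::
  "('a \<Rightarrow> 'a \<Rightarrow> 'a) \<Rightarrow> ('a::euclidean_space \<Rightarrow> complex) \<Rightarrow> ('a \<Rightarrow> complex) \<Rightarrow>
   'a \<times> 'a \<Rightarrow> complex" where
  "wigner m u v = (THE W. W \<in> schwartz \<and>
     (\<forall>f\<in>schwartz. l2_inner lborel (Op m f u) v = l2_inner Xi_lebesgue f W))"

definition frak_E ::
  "('a \<Rightarrow> 'a \<Rightarrow> 'a) \<Rightarrow> ('a::euclidean_space \<times> 'a \<Rightarrow> complex) \<Rightarrow> ('a \<times> 'a) distribution \<Rightarrow>
   ('a \<times> 'a) \<times> ('a \<times> 'a) \<Rightarrow> complex" where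
  "frak_E m h F = (\<lambda>(y, z).
     dist_sharp_moyal m (moyal_sharp_dist m (dist_of (eps y)) F) (dist_adj m (dist_of (eps z))) h)"

definition co_norm ::
  "('a \<Rightarrow> 'a \<Rightarrow> 'a) \<Rightarrow> ('a::euclidean_space \<Rightarrow> complex) \<Rightarrow> (('a \<times> 'a \<Rightarrow> complex) \<Rightarrow> real) \<Rightarrow>
   ('a \<Rightarrow> complex) \<Rightarrow> real" where
  "co_norm m w \<B> u = \<B> (fourier_wigner m u w)"

definition Co_norm ::
  "('a \<Rightarrow> 'a \<Rightarrow> 'a) \<Rightarrow> ('a::euclidean_space \<times> 'a \<Rightarrow> complex) \<Rightarrow>
   ((('a \<times> 'a) \<times> ('a \<times> 'a) \<Rightarrow> complex) \<Rightarrow> real) \<Rightarrow> ('a \<times> 'a \<Rightarrow> complex) \<Rightarrow> real" where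
  "Co_norm m h \<BB> f = \<BB> (frak_E m h (dist_of f))"

end

theory Submission
  imports Defs "HOL-Probability.Characteristic_Functions" "HOL-Probability.Sinc_Integral"
begin

text \<open>
  Every operator is handled through its integral kernel: \<open>f\<close> corresponds to
  \<open>kernel f (X, Y)\<close>, a partial Fourier transform of \<open>f\<close> composed with the polynomial diffeomorphism
  \<open>(X, Y) \<mapsto> (X, X \<bullet> (-Y))\<close>, and this preserves both the Schwartz space and, up to the choice of
  measure, the \<open>L\<^sup>2\<close> product.  The Wigner transform of \<open>(w\<^sub>1, w\<^sub>2)\<close> is the symbol of the rank one
  operator \<open>u \<mapsto> \<langle>u, w\<^sub>1\<rangle> w\<^sub>2\<close>, and products of a rank one operator with arbitrary ones have rank one, so
  that all the dualities in \<open>\<EE>\<close> can be evaluated: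
  \<open>\<EE>(f)(y, z) = \<langle>Op(f) E(z)\<^sup>* w\<^sub>1, E(y)\<^sup>* w\<^sub>2\<rangle>\<close>.  The orthogonality relations of the Fourier-Wigner
  transform resolve the identity as \<open>u = \<integral> \<langle>E(z)u, w\<^sub>1\<rangle> E(z)\<^sup>* w\<^sub>1 dz\<close>; inserting this into
  \<open>\<langle>E(y) Op(f) u, w\<^sub>2\<rangle>\<close> shows that the Fourier-Wigner transforms intertwine \<open>Op(f)\<close> with the integral
  operator of kernel \<open>\<EE>(f)\<close>.
\<close>

text \<open>The obstacle is that products, adjoints, Wigner transforms and the extended dualities
  are definite descriptions, which have a known value only where existence and uniqueness are at
  hand. The window is kept of rank one throughout: every product and adjoint met while unfolding
  \<open>frak_E\<close> is then again an explicit rank one symbol, and uniqueness reduces to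
  injectivity of \<open>kernel\<close>. The group enters through four facts: its law is polynomial
  and associative, has unit 0, and has inverse -X. Polynomial changes of variables with polynomial
  inverses keep Schwartz functions Schwartz, and they make left translations preserve Lebesgue
  measure. New Schwartz functions are obtained by exhibiting a family of bounded differentiable
  functions stable under partial derivatives and multiplication by coordinates, so that iterated
  derivatives are never computed. The constant \<open>(2 * pi) ^ n\<close> of Fourier inversion is
  cancelled by the normalisation of the measure on the dual.\<close>

section \<open>Basic calculus of Schwartz functions\<close>

lemma partial_eq: "(f has_derivative D) (at x) \<Longrightarrow> partial b f x = D b"
  using frechet_derivative_at[of f D x] by (simp add: partial_def)

text \<open>Boundedness suffices for rapid decay, because the family is closed under multiplication by coordinates.\<close>

lemma schwartz_coinduct:
  fixes A :: "('e::euclidean_space \<Rightarrow> complex) set"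
  assumes "f \<in> A"
    and diff: "\<And>f x. f \<in> A \<Longrightarrow> f differentiable (at x)"
    and bdd: "\<And>f. f \<in> A \<Longrightarrow> \<exists>B. \<forall>x. norm (f x) \<le> B"
    and part: "\<And>f b. f \<in> A \<Longrightarrow> b \<in> Basis \<Longrightarrow> partial b f \<in> A"
    and mult: "\<And>f b. f \<in> A \<Longrightarrow> b \<in> Basis \<Longrightarrow> (\<lambda>x. of_real (x \<bullet> b) * f x) \<in> A"
  shows "f \<in> schwartz"
proof -
  have P: "partials bs g \<in> A" if "bs \<in> lists Basis" "g \<in> A" for bs g
    using that by (induction bs) (auto simp: partials_def part)
  have R: "\<exists>B. \<forall>x. norm x ^ k * norm (g x) \<le> B" if "g \<in> A" for g k
    using that
  proof (induction k arbitrary: g)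
    case 0
    then show ?case using bdd by auto
  next
    case (Suc k)
    then have "\<forall>b\<in>Basis. \<exists>B. \<forall>x. norm x ^ k * norm (complex_of_real (x \<bullet> b) * g x) \<le> B"
      using mult by blast
    then obtain B where B: "\<And>b x. b \<in> Basis \<Longrightarrow> norm x ^ k * norm (complex_of_real (x \<bullet> b) * g x) \<le> B b"
      by metis
    have "norm x ^ Suc k * norm (g x) \<le> (\<Sum>b\<in>Basis. B b)" for x
    proof -
      have "norm x ^ Suc k * norm (g x) = (norm x ^ k * norm (g x)) * norm x"
        by simp
      also have "\<dots> \<le> (norm x ^ k * norm (g x)) * (\<Sum>b\<in>Basis. \<bar>x \<bullet> b\<bar>)"
        by (intro mult_left_mono norm_le_l1) auto
      also have "\<dots> = (\<Sum>b\<in>Basis. norm x ^ k * norm (complex_of_real (x \<bullet> b) * g x))"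
        by (simp add: sum_distrib_left norm_mult mult_ac)
      also have "\<dots> \<le> (\<Sum>b\<in>Basis. B b)"
        by (intro sum_mono B)
      finally show ?thesis .
    qed
    then show ?case by blast
  qed
  show ?thesis
    unfolding schwartz_def smooth_def differentiable_on_def
    using P R \<open>f \<in> A\<close> diff by (auto intro!: differentiable_at_withinI)
qed

lemma schwartz_differentiable:
  assumes "f \<in> schwartz" shows "f differentiable (at x)"
proof -
  have "partials [] f differentiable_on UNIV"
    using assms unfolding schwartz_def smooth_def by (blast intro: lists.Nil)
  then show ?thesis
    by (simp add: partials_def differentiable_on_def)
qed

lemma schwartz_partial:
  assumes "f \<in> schwartz" "b \<in> Basis" shows "partial b f \<in> schwartz"
proof -
  have *: "partials bs (partial b f) = partials (bs @ [b]) f" for bs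
    by (simp add: partials_def)
  have "bs @ [b] \<in> lists Basis" if "bs \<in> lists Basis" for bs
    using that assms(2) by simp
  then show ?thesis
    using assms(1) unfolding schwartz_def smooth_def mem_Collect_eq * by blast
qed

text \<open>The weight \<open>1 + norm x\<close> has no zero, unlike the powers of
  \<open>norm x\<close> in the definition, so it can later be divided by; the binomial theorem
  combines the bounds for the pure powers.\<close>

lemma schwartz_decay:
  fixes f :: "'e::euclidean_space \<Rightarrow> complex"
  assumes "f \<in> schwartz"
  obtains B where "0 \<le> B" "\<And>x. (1 + norm x) ^ k * norm (f x) \<le> B"
proof -
  have "\<exists>B. \<forall>x. norm x ^ j * norm (partials [] f x) \<le> B" for j :: nat
    using assms unfolding schwartz_def by (blast intro: lists.Nil)
  then obtain B where B: "norm x ^ j * norm (f x) \<le> B j" for x j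
    unfolding partials_def by simp metis
  have *: "(1 + norm x) ^ k * norm (f x) \<le> (\<Sum>j\<le>k. real (k choose j) * B j)" for x
  proof -
    have "(1 + norm x) ^ k * norm (f x) = (\<Sum>j\<le>k. real (k choose j) * (norm x ^ j * norm (f x)))"
      using binomial_ring[of "norm x" 1 k] by (simp add: sum_distrib_left sum_distrib_right add.commute mult_ac)
    also have "\<dots> \<le> (\<Sum>j\<le>k. real (k choose j) * B j)"
      by (intro sum_mono mult_left_mono B) auto
    finally show ?thesis .
  qed
  moreover have "0 \<le> (\<Sum>j\<le>k. real (k choose j) * B j)"
    by (rule order_trans[OF _ *[of 0]]) simp
  ultimately show ?thesis using that by blast
qed

text \<open>Expanding the derivative in coordinate partials lets closure arguments see only finite
  sums of functions \<open>partial b f\<close>, which are Schwartz again.\<close>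

lemma schwartz_has_derivative:
  fixes f :: "'e::euclidean_space \<Rightarrow> complex"
  assumes "f \<in> schwartz"
  shows "(f has_derivative (\<lambda>h. \<Sum>b\<in>Basis. of_real (h \<bullet> b) * partial b f x)) (at x)"
proof -
  let ?D = "frechet_derivative f (at x)"
  have D: "(f has_derivative ?D) (at x)"
    using schwartz_differentiable[OF assms] frechet_derivative_works by blast
  then interpret D: bounded_linear ?D by (rule has_derivative_bounded_linear)
  have "?D h = (\<Sum>b\<in>Basis. of_real (h \<bullet> b) * partial b f x)" for h
  proof -
    have "?D h = ?D (\<Sum>b\<in>Basis. (h \<bullet> b) *\<^sub>R b)"
      by (simp add: euclidean_representation)
    also have "\<dots> = (\<Sum>b\<in>Basis. of_real (h \<bullet> b) * partial b f x)"
      by (simp add: D.sum D.scaleR partial_def scaleR_conv_of_real)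
    finally show ?thesis .
  qed
  then show ?thesis using D by presburger
qed

lemma schwartz_continuous: "f \<in> schwartz \<Longrightarrow> continuous_on S f"
  by (meson continuous_at_imp_continuous_on differentiable_imp_continuous_within schwartz_differentiable)

lemma schwartz_measurable [measurable_dest]: "f \<in> schwartz \<Longrightarrow> f \<in> borel_measurable borel"
  by (simp add: borel_measurable_continuous_onI schwartz_continuous)

section \<open>Composition with polynomial embeddings\<close>

text \<open>Polynomiality of the derivative is asserted for each fixed direction h, because these
  are the coefficients that the chain rule produces in \<open>poly_pullback\<close>.\<close>

lemma real_polynomial_function_has_derivative:
  assumes "real_polynomial_function p"
  shows "\<exists>D. (\<forall>x. (p has_derivative D x) (at x)) \<and> (\<forall>h. real_polynomial_function (\<lambda>x. D x h))"
  using assms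
proof induction
  case (linear f)
  then show ?case
    by (intro exI[of _ "\<lambda>x. f"]) (auto simp: bounded_linear_imp_has_derivative)
next
  case (const c)
  then show ?case
    by (intro exI[of _ "\<lambda>x h. 0"]) (auto intro: real_polynomial_function.intros(2))
next
  case (add f g)
  then obtain D E where "\<forall>x. (f has_derivative D x) (at x)" "\<forall>h. real_polynomial_function (\<lambda>x. D x h)"
    "\<forall>x. (g has_derivative E x) (at x)" "\<forall>h. real_polynomial_function (\<lambda>x. E x h)" by blast
  then show ?case
    by (intro exI[of _ "\<lambda>x h. D x h + E x h"]) (auto intro!: derivative_intros)
next
  case (mult f g)
  then obtain D E where "\<forall>x. (f has_derivative D x) (at x)" "\<forall>h. real_polynomial_function (\<lambda>x. D x h)"
    "\<forall>x. (g has_derivative E x) (at x)" "\<forall>h. real_polynomial_function (\<lambda>x. E x h)" by blast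
  with mult show ?case
    by (intro exI[of _ "\<lambda>x h. f x * E x h + D x h * g x"]) (auto intro!: has_derivative_mult real_polynomial_function.intros(3,4))
qed

lemma real_polynomial_function_growth:
  assumes "real_polynomial_function p"
  shows "\<exists>C\<ge>0. \<exists>k. \<forall>x. \<bar>p x\<bar> \<le> C * (1 + norm x) ^ k"
  using assms
proof induction
  case (linear f)
  then obtain K where "\<And>x. norm (f x) \<le> norm x * K" "0 \<le> K"
    using bounded_linear.nonneg_bounded by blast
  then have "\<bar>f x\<bar> \<le> K * (1 + norm x) ^ 1" for x
    by (smt (verit) mult.commute mult_left_mono power_one_right real_norm_def)
  then show ?case using \<open>0 \<le> K\<close> by blast
next
  case (const c)
  then show ?case by (intro exI[of _ "\<bar>c\<bar>"] conjI exI[of _ 0]) auto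
next
  case (add f g)
  then obtain C k D l where *: "0 \<le> C" "0 \<le> D" "\<And>x. \<bar>f x\<bar> \<le> C * (1 + norm x) ^ k"
    "\<And>x. \<bar>g x\<bar> \<le> D * (1 + norm x) ^ l" by blast
  have "\<bar>f x + g x\<bar> \<le> (C + D) * (1 + norm x) ^ (k + l)" for x
  proof -
    have "C * (1 + norm x) ^ k \<le> C * (1 + norm x) ^ (k + l)"
      "D * (1 + norm x) ^ l \<le> D * (1 + norm x) ^ (k + l)"
      using * by (auto intro!: mult_left_mono power_increasing)
    then show ?thesis using *(3)[of x] *(4)[of x] by (simp add: distrib_right)
  qed
  then show ?case using * by (intro exI[of _ "C + D"]) auto
next
  case (mult f g)
  then obtain C k D l where *: "0 \<le> C" "0 \<le> D" "\<And>x. \<bar>f x\<bar> \<le> C * (1 + norm x) ^ k"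
    "\<And>x. \<bar>g x\<bar> \<le> D * (1 + norm x) ^ l" by blast
  have "\<bar>f x * g x\<bar> \<le> (C * D) * (1 + norm x) ^ (k + l)" for x
    using mult_mono[OF *(3)[of x] *(4)[of x]] *(1) by (simp add: abs_mult power_add mult_ac)
  then show ?case using * by (intro exI[of _ "C * D"]) auto
qed

text \<open>A family that contains the compositions of Schwartz functions with \<Phi> and survives
  differentiation: the chain rule multiplies by derivatives of the polynomial map \<Phi> and sums
  over the coordinates of the target.\<close>

inductive_set poly_pullback :: "('e::euclidean_space \<Rightarrow> 'f::euclidean_space) \<Rightarrow> ('e \<Rightarrow> complex) set"
  for \<Phi> where
  base: "real_polynomial_function p \<Longrightarrow> f \<in> schwartz \<Longrightarrow> (\<lambda>x. of_real (p x) * f (\<Phi> x)) \<in> poly_pullback \<Phi>"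
| add: "f \<in> poly_pullback \<Phi> \<Longrightarrow> g \<in> poly_pullback \<Phi> \<Longrightarrow> (\<lambda>x. f x + g x) \<in> poly_pullback \<Phi>"

lemma poly_pullback_sum:
  assumes "finite I" "I \<noteq> {}" "\<And>i. i \<in> I \<Longrightarrow> f i \<in> poly_pullback \<Phi>"
  shows "(\<lambda>x. \<Sum>i\<in>I. f i x) \<in> poly_pullback \<Phi>"
  using assms by (induction rule: finite_ne_induct) (auto intro: poly_pullback.add)

lemma polynomial_function_component:
  "polynomial_function p \<Longrightarrow> real_polynomial_function (\<lambda>x. p x \<bullet> b)"
  unfolding polynomial_function_def
  using bounded_linear_inner_left[of b] by (auto simp: o_def dest!: spec[of _ "\<lambda>x. x \<bullet> b"])

text \<open>The left inverse \<Theta> turns p x into p (\<Theta> (\<Phi> x)), which grows at most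
  polynomially in \<Phi> x and is absorbed by the decay of f there. Surjectivity of \<Phi> is not
  asked for, so that slices and diagonals are covered.\<close>

lemma poly_pullback_subset_schwartz:
  fixes \<Phi> :: "'e::euclidean_space \<Rightarrow> 'f::euclidean_space"
  assumes \<Phi>: "polynomial_function \<Phi>" and \<Theta>: "polynomial_function \<Theta>" and inv: "\<And>x. \<Theta> (\<Phi> x) = x"
  shows "poly_pullback \<Phi> \<subseteq> schwartz"
proof
  have "\<forall>c. \<exists>D. (\<forall>x. ((\<lambda>x. \<Phi> x \<bullet> c) has_derivative D x) (at x)) \<and> (\<forall>h. real_polynomial_function (\<lambda>x. D x h))"
    using real_polynomial_function_has_derivative polynomial_function_component[OF \<Phi>] by blast
  then obtain E where E: "\<And>c x. ((\<lambda>x. \<Phi> x \<bullet> c) has_derivative E c x) (at x)"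
    and Ep: "\<And>c h. real_polynomial_function (\<lambda>x. E c x h)" by metis
  have \<Phi>D: "(\<Phi> has_derivative (\<lambda>h. \<Sum>c\<in>Basis. E c x h *\<^sub>R c)) (at x)" for x
    by (subst has_derivative_componentwise_within)
       (auto simp: inner_sum_left_Basis E)
  have D: "\<exists>D. (\<forall>x. (g has_derivative D x) (at x)) \<and> (\<forall>b. (\<lambda>x. D x b) \<in> poly_pullback \<Phi>)"
    if "g \<in> poly_pullback \<Phi>" for g
    using that
  proof induction
    case (base p f)
    obtain P where P: "\<And>x. (p has_derivative P x) (at x)" "\<And>h. real_polynomial_function (\<lambda>x. P x h)"
      using real_polynomial_function_has_derivative[OF base(1)] by blast
    let ?D = "\<lambda>x h. complex_of_real (P x h) * f (\<Phi> x)
      + (\<Sum>c\<in>Basis. complex_of_real (p x * E c x h) * partial c f (\<Phi> x))"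
    have "((\<lambda>x. complex_of_real (p x) * f (\<Phi> x)) has_derivative ?D x) (at x)" for x
    proof -
      have 1: "((\<lambda>x. complex_of_real (p x)) has_derivative (\<lambda>h. complex_of_real (P x h))) (at x)"
        by (intro has_derivative_of_real P)
      have 2: "((\<lambda>x. f (\<Phi> x)) has_derivative
          (\<lambda>h. \<Sum>b\<in>Basis. of_real ((\<Sum>c\<in>Basis. E c x h *\<^sub>R c) \<bullet> b) * partial b f (\<Phi> x))) (at x)"
        by (rule has_derivative_compose[OF \<Phi>D schwartz_has_derivative[OF base(2)]])
      show ?thesis
        by (rule has_derivative_eq_rhs[OF has_derivative_mult[OF 1 2]])
           (simp add: inner_sum_left_Basis sum_distrib_left mult_ac add_ac)
    qed
    moreover have "(\<lambda>x. ?D x b) \<in> poly_pullback \<Phi>" for b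
      using base P Ep
      by (intro poly_pullback.add poly_pullback_sum poly_pullback.base real_polynomial_function.intros(4))
         (auto intro: schwartz_partial)
    ultimately show ?case by (intro exI[of _ ?D]) auto
  next
    case (add f g)
    then obtain D D' where "\<And>x. (f has_derivative D x) (at x)" "\<And>b. (\<lambda>x. D x b) \<in> poly_pullback \<Phi>"
      "\<And>x. (g has_derivative D' x) (at x)" "\<And>b. (\<lambda>x. D' x b) \<in> poly_pullback \<Phi>" by metis
    then show ?case
      by (intro exI[of _ "\<lambda>x h. D x h + D' x h"]) (auto intro!: has_derivative_add poly_pullback.add)
  qed
  fix g assume "g \<in> poly_pullback \<Phi>"
  then show "g \<in> schwartz"
  proof (rule schwartz_coinduct)
    fix f assume f: "f \<in> poly_pullback \<Phi>"
    obtain D where D': "\<And>x. (f has_derivative D x) (at x)" "\<And>b. (\<lambda>x. D x b) \<in> poly_pullback \<Phi>"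
      using D[OF f] by blast
    show "f differentiable (at x)" for x
      using D' by (auto simp: differentiable_def)
    show "partial b f \<in> poly_pullback \<Phi>" for b
      using D'(2)[of b] partial_eq[OF D'(1)] by (metis ext)
    show "\<exists>B. \<forall>x. norm (f x) \<le> B"
      using f
    proof induction
      case (base p f)
      have "real_polynomial_function (p \<circ> \<Theta>)"
        by (rule real_polynomial_function_compose[OF \<Theta> base(1)])
      then obtain C k where C: "0 \<le> C" "\<And>x. \<bar>(p \<circ> \<Theta>) x\<bar> \<le> C * (1 + norm x) ^ k"
        using real_polynomial_function_growth by blast
      obtain B where B: "0 \<le> B" "\<And>x. (1 + norm x) ^ k * norm (f x) \<le> B"
        using schwartz_decay[OF base(2)] by blast
      have "norm (complex_of_real (p x) * f (\<Phi> x)) \<le> C * B" for x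
      proof -
        have "norm (complex_of_real (p x) * f (\<Phi> x)) = \<bar>(p \<circ> \<Theta>) (\<Phi> x)\<bar> * norm (f (\<Phi> x))"
          by (simp add: norm_mult inv)
        also have "\<dots> \<le> C * (1 + norm (\<Phi> x)) ^ k * norm (f (\<Phi> x))"
          by (intro mult_right_mono C) auto
        also have "\<dots> \<le> C * B"
          using mult_left_mono[OF B(2) C(1)] by (simp add: mult_ac)
        finally show ?thesis .
      qed
      then show ?case by blast
    next
      case (add f g)
      then show ?case by (metis norm_triangle_mono)
    qed
    show "(\<lambda>x. of_real (x \<bullet> b) * f x) \<in> poly_pullback \<Phi>" for b
      using f
    proof induction
      case (base p f)
      have "real_polynomial_function (\<lambda>x. x \<bullet> b * p x)"
        by (intro real_polynomial_function.intros(4) base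
            real_polynomial_function.intros(1)[OF bounded_linear_inner_left])
      from poly_pullback.base[OF this base(2)] show ?case
        by (simp add: mult_ac)
    next
      case (add f g)
      then show ?case using poly_pullback.add by (fastforce simp: distrib_left)
    qed
  qed
qed

lemma schwartz_comp:
  assumes "f \<in> schwartz" "polynomial_function \<Phi>" "polynomial_function \<Theta>" "\<And>x. \<Theta> (\<Phi> x) = x"
  shows "(\<lambda>x. f (\<Phi> x)) \<in> schwartz"
  using subsetD[OF poly_pullback_subset_schwartz[OF assms(2-4)]
      poly_pullback.base[OF real_polynomial_function.intros(2)[of 1] assms(1)]] by simp

section \<open>Algebraic closure properties of the Schwartz space\<close>

lemma schwartz_mult_poly:
  assumes "f \<in> schwartz" "real_polynomial_function p"
  shows "(\<lambda>x. of_real (p x) * f x) \<in> schwartz"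
  by (rule subsetD[OF poly_pullback_subset_schwartz[OF polynomial_function_id polynomial_function_id refl]
      poly_pullback.base[OF assms(2,1)]])

lemma schwartz_add:
  assumes "f \<in> schwartz" "g \<in> schwartz"
  shows "(\<lambda>x. f x + g x) \<in> schwartz"
  using subsetD[OF poly_pullback_subset_schwartz[OF polynomial_function_id polynomial_function_id refl]
      poly_pullback.add[OF poly_pullback.base[OF real_polynomial_function.intros(2)[of 1] assms(1)]
      poly_pullback.base[OF real_polynomial_function.intros(2)[of 1] assms(2)]]] by simp

text \<open>A complex constant is not among the real polynomial factors of
  \<open>poly_pullback\<close>, hence a separate stable family.\<close>

lemma schwartz_mult_const:
  assumes "f \<in> schwartz" shows "(\<lambda>x. c * f x) \<in> schwartz"
proof (rule schwartz_coinduct[where A="{\<lambda>x. c * f x | f. f \<in> schwartz}"])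
  fix g b assume "g \<in> {\<lambda>x. c * f x | f. f \<in> schwartz}"
  then obtain f where g: "g = (\<lambda>x. c * f x)" and f: "f \<in> schwartz" by blast
  have D: "(g has_derivative (\<lambda>h. c * (\<Sum>b\<in>Basis. of_real (h \<bullet> b) * partial b f x))) (at x)" for x
    unfolding g by (intro has_derivative_mult_right schwartz_has_derivative f)
  then show "g differentiable (at x)" for x
    by (auto simp: differentiable_def)
  obtain B where "0 \<le> B" "\<And>x. (1 + norm x) ^ 0 * norm (f x) \<le> B"
    using schwartz_decay[OF f] by blast
  then show "\<exists>B. \<forall>x. norm (g x) \<le> B"
    unfolding g norm_mult by (intro exI[of _ "norm c * B"]) (auto intro: mult_left_mono)
  show "(\<lambda>x. of_real (x \<bullet> b) * g x) \<in> {\<lambda>x. c * f x | f. f \<in> schwartz}"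
    using schwartz_mult_poly[OF f real_polynomial_function.intros(1)[OF bounded_linear_inner_left[of b]]]
    unfolding g by (auto simp: mult_ac)
  assume "b \<in> Basis"
  have "partial b g x = c * partial b f x" for x
    unfolding partial_eq[OF D] partial_eq[OF schwartz_has_derivative[OF f], of b x, symmetric] ..
  then have "partial b g = (\<lambda>x. c * partial b f x)" ..
  then show "partial b g \<in> {\<lambda>x. c * f x | f. f \<in> schwartz}"
    using schwartz_partial[OF f \<open>b \<in> Basis\<close>] by blast
qed (use assms in blast)

lemma schwartz_cnj:
  assumes "f \<in> schwartz" shows "(\<lambda>x. cnj (f x)) \<in> schwartz"
proof (rule schwartz_coinduct[where A="{\<lambda>x. cnj (f x) | f. f \<in> schwartz}"])
  fix g b assume "g \<in> {\<lambda>x. cnj (f x) | f. f \<in> schwartz}"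
  then obtain f where g: "g = (\<lambda>x. cnj (f x))" and f: "f \<in> schwartz" by blast
  have D: "(g has_derivative (\<lambda>h. cnj (\<Sum>b\<in>Basis. of_real (h \<bullet> b) * partial b f x))) (at x)" for x
    unfolding g by (intro has_derivative_cnj schwartz_has_derivative f)
  then show "g differentiable (at x)" for x
    by (auto simp: differentiable_def)
  obtain B where "0 \<le> B" "\<And>x. (1 + norm x) ^ 0 * norm (f x) \<le> B"
    using schwartz_decay[OF f] by blast
  then show "\<exists>B. \<forall>x. norm (g x) \<le> B"
    unfolding g by auto
  show "(\<lambda>x. of_real (x \<bullet> b) * g x) \<in> {\<lambda>x. cnj (f x) | f. f \<in> schwartz}"
    using schwartz_mult_poly[OF f real_polynomial_function.intros(1)[OF bounded_linear_inner_left[of b]]]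
    unfolding g by (intro CollectI exI conjI) (auto simp: fun_eq_iff)
  assume "b \<in> Basis"
  have "partial b g x = cnj (partial b f x)" for x
    unfolding partial_eq[OF D] partial_eq[OF schwartz_has_derivative[OF f], of b x, symmetric] ..
  then have "partial b g = (\<lambda>x. cnj (partial b f x))" ..
  then show "partial b g \<in> {\<lambda>x. cnj (f x) | f. f \<in> schwartz}"
    using schwartz_partial[OF f \<open>b \<in> Basis\<close>] by blast
qed (use assms in blast)

text \<open>Each basis vector of a product space lies in one factor, so a partial derivative or a
  coordinate factor changes only one of u and v; pure tensors are stable without taking
  sums.\<close>

lemma schwartz_tensor:
  fixes u :: "'e::euclidean_space \<Rightarrow> complex" and v :: "'f::euclidean_space \<Rightarrow> complex"
  assumes "u \<in> schwartz" "v \<in> schwartz"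
  shows "(\<lambda>z. u (fst z) * v (snd z)) \<in> schwartz"
proof -
  define A where "A = {\<lambda>z. u (fst z) * v (snd z) | (u :: 'e \<Rightarrow> complex) (v :: 'f \<Rightarrow> complex).
    u \<in> schwartz \<and> v \<in> schwartz}"
  have AI: "(\<lambda>z. u (fst z) * v (snd z)) \<in> A" if "u \<in> schwartz" "v \<in> schwartz" for u v
    using that unfolding A_def by blast
  show ?thesis
  proof (rule schwartz_coinduct[where A=A])
    fix g and b :: "'e \<times> 'f" assume "g \<in> A"
    then obtain u v where g: "g = (\<lambda>z. u (fst z) * v (snd z))" and u: "u \<in> schwartz" and v: "v \<in> schwartz"
      unfolding A_def by blast
    have D: "(g has_derivative (\<lambda>h. u (fst z) * (\<Sum>b\<in>Basis. of_real (snd h \<bullet> b) * partial b v (snd z))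
        + (\<Sum>b\<in>Basis. of_real (fst h \<bullet> b) * partial b u (fst z)) * v (snd z))) (at z)" for z
      unfolding g
      by (intro has_derivative_mult has_derivative_compose[OF has_derivative_fst[OF has_derivative_ident]]
            has_derivative_compose[OF has_derivative_snd[OF has_derivative_ident]] schwartz_has_derivative u v)
    then show "g differentiable (at x)" for x
      by (rule differentiableI)
    obtain B where B: "0 \<le> B" "\<And>x. (1 + norm x) ^ 0 * norm (u x) \<le> B"
      using schwartz_decay[OF u] by blast
    obtain B' where B': "0 \<le> B'" "\<And>x. (1 + norm x) ^ 0 * norm (v x) \<le> B'"
      using schwartz_decay[OF v] by blast
    show "\<exists>B. \<forall>x. norm (g x) \<le> B"
      unfolding g norm_mult using B B' by (intro exI[of _ "B * B'"]) (auto intro: mult_mono)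
    assume b: "b \<in> Basis"
    then consider (l) c where "b = (c, 0)" "c \<in> Basis" | (r) c where "b = (0, c)" "c \<in> Basis"
      by (auto simp: Basis_prod_def)
    then have "(\<lambda>x. of_real (x \<bullet> b) * g x) \<in> A \<and> partial b g \<in> A"
    proof cases
      case l
      have "(\<lambda>x. of_real (x \<bullet> b) * g x) = (\<lambda>z. (of_real (fst z \<bullet> c) * u (fst z)) * v (snd z))"
        by (auto simp: g l inner_prod_def)
      also have "\<dots> \<in> A"
        using AI[OF schwartz_mult_poly[OF u real_polynomial_function.intros(1)[OF bounded_linear_inner_left[of c]]] v]
        by simp
      finally have 1: "(\<lambda>x. of_real (x \<bullet> b) * g x) \<in> A" .
      have "partial b g z = partial c u (fst z) * v (snd z)" for z
        unfolding partial_eq[OF D] partial_eq[OF schwartz_has_derivative[OF u], of c "fst z", symmetric] l(1) fst_conv snd_conv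
        by simp
      then have "partial b g = (\<lambda>z. partial c u (fst z) * v (snd z))" ..
      then show ?thesis using 1 AI[OF schwartz_partial[OF u l(2)] v] by simp
    next
      case r
      have "(\<lambda>x. of_real (x \<bullet> b) * g x) = (\<lambda>z. u (fst z) * (of_real (snd z \<bullet> c) * v (snd z)))"
        by (auto simp: g r inner_prod_def)
      also have "\<dots> \<in> A"
        using AI[OF u schwartz_mult_poly[OF v real_polynomial_function.intros(1)[OF bounded_linear_inner_left[of c]]]]
        by simp
      finally have 1: "(\<lambda>x. of_real (x \<bullet> b) * g x) \<in> A" .
      have "partial b g z = u (fst z) * partial c v (snd z)" for z
        unfolding partial_eq[OF D] partial_eq[OF schwartz_has_derivative[OF v], of c "snd z", symmetric] r(1) fst_conv snd_conv
        by simp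
      then have "partial b g = (\<lambda>z. u (fst z) * partial c v (snd z))" ..
      then show ?thesis using 1 AI[OF u schwartz_partial[OF v r(2)]] by simp
    qed
    then show "(\<lambda>x. of_real (x \<bullet> b) * g x) \<in> A" "partial b g \<in> A" by auto
  qed (rule AI[OF assms])
qed

section \<open>Integrability\<close>

text \<open>The exponent is twice the dimension because \<open>(1 + norm y)\<^sup>2\<close>
  dominates each \<open>1 + (y \<bullet> b)\<^sup>2\<close>, and the reciprocals of the latter
  multiply to an integrable function.\<close>

definition decay_weight :: "'e::euclidean_space \<Rightarrow> real" where
  "decay_weight y = inverse ((1 + norm y) ^ (2 * DIM('e)))"

lemma decay_weight_pos: "0 < decay_weight y"
  by (simp add: decay_weight_def add_pos_nonneg)

lemma integrable_decay_weight: "integrable lborel (decay_weight :: 'e::euclidean_space \<Rightarrow> real)"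
proof (rule integrableI_nonneg)
  show "(decay_weight :: 'e \<Rightarrow> real) \<in> borel_measurable lborel"
    unfolding decay_weight_def by measurable
  show "AE y in lborel. 0 \<le> (decay_weight :: 'e \<Rightarrow> real) y"
    by (simp add: decay_weight_pos less_imp_le)
  have 1: "integrable lborel (\<lambda>x::real. inverse (1 + x\<^sup>2))"
    using integrable_inverse_1_plus_square by (simp add: set_integrable_def)
  have le: "(\<Prod>b\<in>Basis. 1 + (y \<bullet> b)\<^sup>2) \<le> (1 + norm y) ^ (2 * DIM('e))" for y :: 'e
  proof -
    have "(\<Prod>b\<in>Basis. 1 + (y \<bullet> b)\<^sup>2) \<le> (\<Prod>b\<in>(Basis::'e set). (1 + norm y)\<^sup>2)"
    proof (rule prod_mono, safe)
      fix b :: 'e assume "b \<in> Basis"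
      then have "(y \<bullet> b)\<^sup>2 \<le> (norm y)\<^sup>2"
        using Basis_le_norm[of b y] by (metis abs_norm_cancel power2_abs power_mono abs_ge_zero)
      then show "1 + (y \<bullet> b)\<^sup>2 \<le> (1 + norm y)\<^sup>2"
        by (simp add: power2_sum add_increasing2)
    qed auto
    then show ?thesis by (simp add: power_mult)
  qed
  have "(\<integral>\<^sup>+y. ennreal (decay_weight (y::'e)) \<partial>lborel) \<le>
      (\<integral>\<^sup>+y. (\<Prod>b\<in>(Basis::'e set). ennreal (inverse (1 + (y \<bullet> b)\<^sup>2))) \<partial>lborel)"
  proof (rule nn_integral_mono)
    fix y :: 'e
    have "decay_weight y \<le> inverse (\<Prod>b\<in>Basis. 1 + (y \<bullet> b)\<^sup>2)"
      unfolding decay_weight_def by (intro le_imp_inverse_le le prod_pos) (auto intro: add_pos_nonneg)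
    then show "ennreal (decay_weight y) \<le> (\<Prod>b\<in>Basis. ennreal (inverse (1 + (y \<bullet> b)\<^sup>2)))"
      by (simp add: prod_ennreal prod_inversef[symmetric] ennreal_leI)
  qed
  also have "\<dots> = (\<Prod>b\<in>(Basis::'e set). \<integral>\<^sup>+x. ennreal (inverse (1 + x\<^sup>2)) \<partial>lborel)"
    by (subst nn_integral_lborel_prod) auto
  also have "\<dots> < \<infinity>"
    using 1 by (auto simp: integrable_iff_bounded prod_constant power_less_top_ennreal)
  finally show "(\<integral>\<^sup>+y. ennreal (decay_weight (y::'e)) \<partial>lborel) < \<infinity>" .
qed

text \<open>Here y is typically one component of x. The bound then depends on y alone and serves as
  a dominating function, uniformly in the other component.\<close>

lemma schwartz_decay_weight:
  fixes f :: "'e::euclidean_space \<Rightarrow> complex"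
  assumes "f \<in> schwartz"
  obtains B where "0 \<le> B"
    "\<And>x (y::'f::euclidean_space). norm y \<le> norm x \<Longrightarrow> (1 + norm y) ^ k * norm (f x) \<le> B * decay_weight y"
proof -
  obtain B where B: "0 \<le> B" "\<And>x. (1 + norm x) ^ (k + 2 * DIM('f)) * norm (f x) \<le> B"
    using schwartz_decay[OF assms] by blast
  have "(1 + norm y) ^ k * norm (f x) \<le> B * decay_weight y" if "norm y \<le> norm x" for x and y :: 'f
  proof -
    have "(1 + norm y) ^ (k + 2 * DIM('f)) * norm (f x) \<le> (1 + norm x) ^ (k + 2 * DIM('f)) * norm (f x)"
      using that by (intro mult_right_mono power_mono) auto
    also have "\<dots> \<le> B" by (rule B)
    finally have "(1 + norm y) ^ k * norm (f x) * (1 + norm y) ^ (2 * DIM('f)) \<le> B"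
      by (simp add: power_add mult_ac)
    moreover have "0 < (1 + norm y) ^ (2 * DIM('f))"
      by (simp add: add_pos_nonneg)
    ultimately show ?thesis
      unfolding decay_weight_def by (simp only: divide_inverse[symmetric] pos_le_divide_eq)
  qed
  then show ?thesis using B(1) that by blast
qed

lemma schwartz_integrable:
  fixes f :: "'e::euclidean_space \<Rightarrow> complex"
  assumes "f \<in> schwartz" shows "integrable lborel f"
proof -
  obtain B where "0 \<le> B" and B: "\<And>x (y::'e). norm y \<le> norm x \<Longrightarrow> (1 + norm y) ^ 0 * norm (f x) \<le> B * decay_weight y"
    using schwartz_decay_weight[OF assms] by blast
  show ?thesis
  proof (rule Bochner_Integration.integrable_bound)
    show "integrable lborel (\<lambda>y::'e. B * decay_weight y)"
      by (intro integrable_mult_right integrable_decay_weight)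
    show "f \<in> borel_measurable lborel" using assms by measurable
    show "AE x in lborel. norm (f x) \<le> norm (B * decay_weight x)"
      using B[of x x for x] \<open>0 \<le> B\<close> by (auto simp: abs_mult less_imp_le[OF decay_weight_pos])
  qed
qed

section \<open>Differentiation of parametric integrals\<close>

text \<open>The mean value inequality bounds the difference quotients uniformly near p0 by a
  multiple of B, so dominated convergence applies along every sequence of increments tending to
  0.\<close>

lemma has_derivative_parametric_integral:
  fixes F :: "'p::{real_normed_vector,perfect_space} \<Rightarrow> 'y \<Rightarrow> complex"
  assumes "0 < r"
    and der: "\<And>p y. p \<in> ball p0 r \<Longrightarrow> ((\<lambda>p. F p y) has_derivative D p y) (at p)"
    and bound: "\<And>p y h. p \<in> ball p0 r \<Longrightarrow> norm (D p y h) \<le> B y * norm h"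
    and B: "integrable M B"
    and F: "\<And>p. p \<in> ball p0 r \<Longrightarrow> integrable M (F p)"
    and D: "\<And>h. (\<lambda>y. D p0 y h) \<in> borel_measurable M"
  shows "((\<lambda>p. LINT y|M. F p y) has_derivative (\<lambda>h. LINT y|M. D p0 y h)) (at p0)"
proof -
  have p0: "p0 \<in> ball p0 r" using \<open>0 < r\<close> by simp
  \<comment> \<open>A nonzero direction is needed to read off that B y is nonnegative from the bound
    on the derivative; a perfect space supplies one.\<close>
  obtain h0 :: 'p where "h0 \<noteq> 0"
    using perfect_choose_dist[of 1 0] by auto
  then have B0: "0 \<le> B y" for y
    using order_trans[OF norm_ge_zero bound[OF p0, of y h0]] by (simp add: zero_le_mult_iff)
  have int_D: "integrable M (\<lambda>y. D p0 y h)" for h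
    by (rule Bochner_Integration.integrable_bound[of _ "\<lambda>y. B y * norm h"])
       (use B D in \<open>auto intro!: AE_I2 order_trans[OF bound[OF p0] abs_ge_self]\<close>)
  have linD: "bounded_linear (D p0 y)" for y
    using der[OF p0] has_derivative_bounded_linear by blast
  have bl: "bounded_linear (\<lambda>h. LINT y|M. D p0 y h)"
  proof (rule bounded_linear_intro[where K="LINT y|M. B y"])
    show "(LINT y|M. D p0 y (x + z)) = (LINT y|M. D p0 y x) + (LINT y|M. D p0 y z)" for x z
      by (simp add: linear_add[OF bounded_linear.linear[OF linD]] int_D)
    show "(LINT y|M. D p0 y (c *\<^sub>R x)) = c *\<^sub>R (LINT y|M. D p0 y x)" for c x
      by (simp add: linear_scale[OF bounded_linear.linear[OF linD]])
    show "norm (LINT y|M. D p0 y x) \<le> norm x * (LINT y|M. B y)" for x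
    proof -
      have "norm (LINT y|M. D p0 y x) \<le> (LINT y|M. norm (D p0 y x))"
        by (rule integral_norm_bound)
      also have "\<dots> \<le> (LINT y|M. B y * norm x)"
        by (intro integral_mono integrable_norm int_D integrable_mult_left B bound p0)
      finally show ?thesis by (simp add: mult.commute)
    qed
  qed
  let ?R = "\<lambda>h y. (F (p0 + h) y - F p0 y - D p0 y h) /\<^sub>R norm h"
  \<comment> \<open>One B y comes from the increment, by the mean value inequality, the other from
    the linear term.\<close>
  have R_le: "norm (?R h y) \<le> 2 * B y" if "norm h < r" for h y
  proof -
    have "norm (F (p0 + h) y - F p0 y) \<le> B y * norm (p0 + h - p0)"
    proof (rule differentiable_bound[OF convex_ball[of p0 r]])
      show "((\<lambda>p. F p y) has_derivative D p y) (at p within ball p0 r)" if "p \<in> ball p0 r" for p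
        using der[OF that] has_derivative_at_withinI by blast
      show "onorm (D p y) \<le> B y" if "p \<in> ball p0 r" for p
        by (rule onorm_le) (rule bound[OF that])
    qed (use that p0 in \<open>auto simp: dist_norm\<close>)
    then have "norm (F (p0 + h) y - F p0 y - D p0 y h) \<le> 2 * B y * norm h"
      using bound[OF p0, of y h] norm_triangle_ineq4[of "F (p0 + h) y - F p0 y" "D p0 y h"] by simp
    moreover have "norm (?R h y) = norm (F (p0 + h) y - F p0 y - D p0 y h) / norm h"
      by (simp only: norm_scaleR) (simp add: divide_inverse mult.commute)
    ultimately show ?thesis
      using B0[of y] by (cases "h = 0") (auto simp: divide_le_eq)
  qed
  have lim: "(\<lambda>h. norm ((LINT y|M. F (p0 + h) y) - (LINT y|M. F p0 y) - (LINT y|M. D p0 y h)) / norm h) \<midarrow>0\<rightarrow> 0"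
    unfolding tendsto_at_iff_sequentially
  proof (intro allI impI)
    fix X :: "nat \<Rightarrow> 'p" assume X: "\<forall>i. X i \<in> UNIV - {0}" "X \<longlonglongrightarrow> 0"
    \<comment> \<open>The domination holds only inside the ball, so the finitely many terms outside
      it are replaced by 0.\<close>
    let ?S = "\<lambda>i y. if norm (X i) < r then ?R (X i) y else 0"
    have ev: "\<forall>\<^sub>F i in sequentially. norm (X i) < r"
      using tendstoD[OF X(2) \<open>0 < r\<close>] by (simp add: dist_norm)
    have "(\<lambda>i. LINT y|M. ?S i y) \<longlonglongrightarrow> (LINT y|M. 0)"
    proof (rule integral_dominated_convergence[where w="\<lambda>y. 2 * B y"])
      show "?S i \<in> borel_measurable M" for i
      proof (cases "norm (X i) < r")
        case True
        then have [measurable]: "F (p0 + X i) \<in> borel_measurable M" "F p0 \<in> borel_measurable M"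
          using F[of "p0 + X i"] F[OF p0] by (auto simp: dist_norm)
        show ?thesis using D[of "X i"] True by simp
      qed simp
      show "AE y in M. (\<lambda>i. ?S i y) \<longlonglongrightarrow> 0"
      proof (rule AE_I2)
        fix y
        have "(\<lambda>h. norm (F (p0 + h) y - F p0 y - D p0 y h) / norm h) \<midarrow>0\<rightarrow> 0"
          using der[OF p0, of y] unfolding has_derivative_at by simp
        then have "(\<lambda>i. norm (F (p0 + X i) y - F p0 y - D p0 y (X i)) / norm (X i)) \<longlonglongrightarrow> 0"
          unfolding tendsto_at_iff_sequentially using X by (auto simp: o_def)
        then have "(\<lambda>i. norm (?R (X i) y)) \<longlonglongrightarrow> 0"
          by (simp add: divide_inverse mult.commute)
        then have "(\<lambda>i. ?R (X i) y) \<longlonglongrightarrow> 0"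
          by (rule tendsto_norm_zero_cancel)
        then show "(\<lambda>i. ?S i y) \<longlonglongrightarrow> 0"
          by (rule Lim_transform_eventually) (use ev in \<open>auto elim: eventually_mono\<close>)
      qed
      show "AE y in M. norm (?S i y) \<le> 2 * B y" for i
        using R_le B0 by auto
    qed (use B in auto)
    then have "(\<lambda>i. norm (LINT y|M. ?S i y)) \<longlonglongrightarrow> 0"
      by (intro tendsto_norm_zero) simp
    then have "(\<lambda>i. norm ((LINT y|M. F (p0 + X i) y) - (LINT y|M. F p0 y) - (LINT y|M. D p0 y (X i))) / norm (X i)) \<longlonglongrightarrow> 0"
    proof (rule Lim_transform_eventually)
      show "\<forall>\<^sub>F i in sequentially. norm (LINT y|M. ?S i y) =
          norm ((LINT y|M. F (p0 + X i) y) - (LINT y|M. F p0 y) - (LINT y|M. D p0 y (X i))) / norm (X i)"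
        using ev
      proof eventually_elim
        case (elim i)
        then have "integrable M (F (p0 + X i))" "integrable M (F p0)"
          using F[of "p0 + X i"] F[OF p0] by (auto simp: dist_norm)
        then have "(LINT y|M. ?S i y) =
          ((LINT y|M. F (p0 + X i) y) - (LINT y|M. F p0 y) - (LINT y|M. D p0 y (X i))) /\<^sub>R norm (X i)"
          using elim int_D[of "X i"] by simp
        then show ?case by (simp add: divide_inverse mult.commute)
      qed
    qed
    then show "((\<lambda>h. norm ((LINT y|M. F (p0 + h) y) - (LINT y|M. F p0 y) - (LINT y|M. D p0 y h)) / norm h) \<circ> X) \<longlonglongrightarrow> 0"
      by (simp add: o_def)
  qed
  then show ?thesis unfolding has_derivative_at using bl by blast
qed

lemma lborel_integral_translation:
  fixes f :: "'e::euclidean_space \<Rightarrow> complex"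
  assumes "f \<in> borel_measurable borel"
  shows "(LINT y|lborel. f (a + y)) = (LINT y|lborel. f y)"
proof -
  have "(LINT y|lborel. f y) = (LINT y|distr lborel borel ((+) a). f y)"
    by (simp add: lborel_distr_plus)
  also have "\<dots> = (LINT y|lborel. f (a + y))"
    using assms by (subst integral_distr) auto
  finally show ?thesis ..
qed

text \<open>The integral of a translate does not depend on the shift, so its derivative at shift 0
  vanishes, and differentiation under the integral identifies that derivative. This is the form in
  which integration by parts is used.\<close>

lemma integral_partial_schwartz:
  fixes g :: "'e::euclidean_space \<Rightarrow> complex"
  assumes g: "g \<in> schwartz" and b: "b \<in> Basis"
  shows "(LINT y|lborel. partial b g y) = 0"
proof -
  have pg: "partial b g \<in> schwartz" by (rule schwartz_partial[OF g b])
  obtain B where B: "0 \<le> B"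
    "\<And>x. (1 + norm x) ^ (2 * DIM('e)) * norm (partial b g x) \<le> B"
    using schwartz_decay[OF pg] by blast
  let ?F = "\<lambda>t::real. LINT y|lborel. g (t *\<^sub>R b + y)"
  have "(?F has_derivative (\<lambda>h. LINT y|lborel. of_real h * partial b g (0 *\<^sub>R b + y))) (at 0)"
  \<comment> \<open>The power of 2 pays for the shift: for |t| < 1, \<open>1 + norm y\<close> is at
    most twice \<open>1 + norm (t *\<^sub>R b + y)\<close>.\<close>
  proof (rule has_derivative_parametric_integral[where r=1 and B="\<lambda>y. (2 ^ (2 * DIM('e)) * B) * decay_weight y"])
    fix t :: real and y :: 'e
    have "((\<lambda>t. g (t *\<^sub>R b + y)) has_derivative
        (\<lambda>h. \<Sum>c\<in>Basis. of_real ((h *\<^sub>R b) \<bullet> c) * partial c g (t *\<^sub>R b + y))) (at t)"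
      by (rule has_derivative_compose[OF _ schwartz_has_derivative[OF g]]) (auto intro!: derivative_eq_intros)
    moreover have "(\<Sum>c\<in>Basis. of_real ((h *\<^sub>R b) \<bullet> c) * partial c g z) = of_real h * partial b g z" for h z
    proof -
      have "(\<Sum>c\<in>Basis. of_real ((h *\<^sub>R b) \<bullet> c) * partial c g z) =
          (\<Sum>c\<in>Basis. if c = b then of_real h * partial c g z else 0)"
        using b by (intro sum.cong) (auto simp: inner_Basis)
      then show ?thesis using b by simp
    qed
    ultimately show "((\<lambda>t. g (t *\<^sub>R b + y)) has_derivative (\<lambda>h. of_real h * partial b g (t *\<^sub>R b + y))) (at t)"
      by simp
  next
    fix t :: real and y :: 'e and h :: real
    assume "t \<in> ball 0 1"
    then have t: "\<bar>t\<bar> < 1" by simp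
    let ?z = "t *\<^sub>R b + y"
    have "norm y = norm (?z - t *\<^sub>R b)" by simp
    also have "\<dots> \<le> norm ?z + norm (t *\<^sub>R b)" by (rule norm_triangle_ineq4)
    also have "norm (t *\<^sub>R b) \<le> 1" using t b by simp
    finally have "1 + norm y \<le> 2 * (1 + norm ?z)" by (smt (verit) norm_ge_zero)
    then have "(1 + norm y) ^ (2 * DIM('e)) \<le> (2 * (1 + norm ?z)) ^ (2 * DIM('e))"
      by (intro power_mono) auto
    also have "\<dots> = 2 ^ (2 * DIM('e)) * (1 + norm ?z) ^ (2 * DIM('e))"
      by (rule power_mult_distrib)
    finally have "(1 + norm y) ^ (2 * DIM('e)) * norm (partial b g ?z) \<le>
      2 ^ (2 * DIM('e)) * (1 + norm ?z) ^ (2 * DIM('e)) * norm (partial b g ?z)"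
      by (rule mult_right_mono) simp
    also have "\<dots> \<le> 2 ^ (2 * DIM('e)) * B"
      using mult_left_mono[OF B(2)[of ?z], of "2 ^ (2 * DIM('e))"] by (simp only: mult.assoc) simp
    finally have "norm (partial b g ?z) \<le> (2 ^ (2 * DIM('e)) * B) * decay_weight y"
      unfolding decay_weight_def divide_inverse[symmetric]
      by (subst pos_le_divide_eq) (simp_all add: add_pos_nonneg mult.commute)
    then show "norm (of_real h * partial b g ?z) \<le> (2 ^ (2 * DIM('e)) * B) * decay_weight y * norm h"
      unfolding norm_mult norm_of_real real_norm_def
      by (subst mult.commute) (rule mult_right_mono, simp_all)
  next
    show "integrable lborel (\<lambda>y. g (t *\<^sub>R b + y))" for t
      by (intro schwartz_integrable schwartz_comp[OF g, of _ "\<lambda>y. y - t *\<^sub>R b"]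
          polynomial_function_add polynomial_function_diff polynomial_function_const polynomial_function_id) simp
    show "(\<lambda>y. of_real h * partial b g (0 *\<^sub>R b + y)) \<in> borel_measurable lborel" for h
      using schwartz_measurable[OF pg] by simp
  qed (auto intro!: integrable_mult_right integrable_decay_weight)
  moreover have "?F = (\<lambda>t. LINT y|lborel. g y)"
    using schwartz_measurable[OF g] by (simp add: lborel_integral_translation)
  ultimately have "((\<lambda>t::real. LINT y|lborel. g y) has_derivative (\<lambda>h. of_real h * (LINT y|lborel. partial b g y))) (at 0)"
    by simp
  from has_derivative_unique[OF this has_derivative_const]
  show ?thesis by (metis mult_1 of_real_1)
qed

lemma schwartz_cis_mult:
  fixes f :: "'e::euclidean_space \<Rightarrow> complex"
  assumes "f \<in> schwartz" shows "(\<lambda>x. cis (x \<bullet> z) * f x) \<in> schwartz"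
proof (rule schwartz_coinduct[where A="{\<lambda>x. cis (x \<bullet> z) * f x | f. f \<in> schwartz}"])
  fix g b assume "g \<in> {\<lambda>x. cis (x \<bullet> z) * f x | f. f \<in> schwartz}"
  then obtain f where g: "g = (\<lambda>x. cis (x \<bullet> z) * f x)" and f: "f \<in> schwartz" by blast
  have D: "(g has_derivative (\<lambda>h. cis (x \<bullet> z) * (\<Sum>b\<in>Basis. of_real (h \<bullet> b) * partial b f x)
      + (h \<bullet> z) *\<^sub>R (\<i> * cis (x \<bullet> z)) * f x)) (at x)" for x
    unfolding g by (intro has_derivative_mult has_derivative_cis has_derivative_inner_left
        has_derivative_ident schwartz_has_derivative f)
  then show "g differentiable (at x)" for x
    by (rule differentiableI)
  obtain B where "0 \<le> B" "\<And>x. (1 + norm x) ^ 0 * norm (f x) \<le> B"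
    using schwartz_decay[OF f] by blast
  then show "\<exists>B. \<forall>x. norm (g x) \<le> B"
    unfolding g norm_mult by auto
  show "(\<lambda>x. of_real (x \<bullet> b) * g x) \<in> {\<lambda>x. cis (x \<bullet> z) * f x | f. f \<in> schwartz}"
    using schwartz_mult_poly[OF f real_polynomial_function.intros(1)[OF bounded_linear_inner_left[of b]]]
    unfolding g by (intro CollectI exI conjI) (auto simp: fun_eq_iff mult_ac)
  assume b: "b \<in> Basis"
  have "partial b g x = cis (x \<bullet> z) * (partial b f x + (\<i> * of_real (b \<bullet> z)) * f x)" for x
    unfolding partial_eq[OF D] partial_eq[OF schwartz_has_derivative[OF f], of b x, symmetric]
    by (simp add: scaleR_conv_of_real algebra_simps)
  then have "partial b g = (\<lambda>x. cis (x \<bullet> z) * (partial b f x + (\<i> * of_real (b \<bullet> z)) * f x))" ..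
  moreover have "(\<lambda>x. partial b f x + (\<i> * of_real (b \<bullet> z)) * f x) \<in> schwartz"
    by (intro schwartz_add schwartz_partial schwartz_mult_const f b)
  ultimately show "partial b g \<in> {\<lambda>x. cis (x \<bullet> z) * f x | f. f \<in> schwartz}"
    by (intro CollectI exI conjI)
qed (use assms in blast)

section \<open>Polynomial maps\<close>

named_theorems poly_intros

lemma polynomial_function_linear_comp:
  assumes "bounded_linear L" "polynomial_function f"
  shows "polynomial_function (\<lambda>x. L (f x))"
  using polynomial_function_compose[OF assms(2) polynomial_function_bounded_linear[OF assms(1)]]
  by (simp add: o_def)

lemma polynomial_function_Pair [poly_intros]:
  assumes "polynomial_function f" "polynomial_function g"
  shows "polynomial_function (\<lambda>x. (f x, g x))"
proof -
  have "polynomial_function (\<lambda>x. (f x, 0) + (0, g x))"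
    using assms
    by (intro polynomial_function_add polynomial_function_linear_comp[of "\<lambda>y. (y, 0)"]
        polynomial_function_linear_comp[of "\<lambda>y. (0, y)"] bounded_linear_Pair
        bounded_linear_ident bounded_linear_zero)
  then show ?thesis by simp
qed

lemmas [poly_intros] =
  polynomial_function_bounded_linear[OF bounded_linear_fst]
  polynomial_function_bounded_linear[OF bounded_linear_snd]
  polynomial_function_const polynomial_function_id polynomial_function_minus
  polynomial_function_linear_comp[OF bounded_linear_fst]
  polynomial_function_linear_comp[OF bounded_linear_snd]

lemma schwartz_slice:
  assumes "f \<in> schwartz" shows "(\<lambda>y. f (x, y)) \<in> schwartz"
  by (rule schwartz_comp[OF assms, of _ snd]) (auto intro!: poly_intros)

text \<open>The product is the tensor product restricted to the diagonal, which is a polynomial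
  embedding with left inverse \<open>fst\<close>.\<close>

lemma schwartz_mult:
  assumes "f \<in> schwartz" "g \<in> schwartz" shows "(\<lambda>x. f x * g x) \<in> schwartz"
proof -
  have "(\<lambda>x. (\<lambda>z. f (fst z) * g (snd z)) (x, x)) \<in> schwartz"
    by (rule schwartz_comp[OF schwartz_tensor[OF assms], of _ fst]) (auto intro!: poly_intros)
  then show ?thesis by simp
qed

section \<open>The partial Fourier transform\<close>

text \<open>The sign is that of the phase in \<open>Op\<close>, hence that of an inverse Fourier
  transform, and no constant is included; \<open>dual_factor\<close> supplies it where
  needed.\<close>

definition partial_fourier :: "('e::euclidean_space \<times> 'f::euclidean_space \<Rightarrow> complex) \<Rightarrow> 'e \<times> 'f \<Rightarrow> complex" where
  "partial_fourier f = (\<lambda>z. LINT y|lborel. cis (snd z \<bullet> y) * f (fst z, y))"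

lemma schwartz_slice_cis:
  assumes "f \<in> schwartz" shows "(\<lambda>y. cis (\<eta> \<bullet> y) * f (x, y)) \<in> schwartz"
  using schwartz_cis_mult[OF schwartz_slice[OF assms], of \<eta>] by (simp add: inner_commute)

lemma partial_fourier_has_derivative:
  fixes f :: "'e::euclidean_space \<times> 'f::euclidean_space \<Rightarrow> complex"
  assumes f: "f \<in> schwartz"
  shows "(partial_fourier f has_derivative (\<lambda>h. LINT y|lborel.
      (snd h \<bullet> y) *\<^sub>R (\<i> * cis (snd p0 \<bullet> y)) * f (fst p0, y) +
      cis (snd p0 \<bullet> y) * (\<Sum>b\<in>Basis. of_real ((fst h, 0) \<bullet> b) * partial b f (fst p0, y)))) (at p0)"
proof -
  \<comment> \<open>Differentiating the phase brings down a factor linear in y, so one extra power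
    of \<open>1 + norm y\<close> is demanded here; \<open>B2\<close> dominates the terms in which f
    is differentiated.\<close>
  obtain B1 where B1: "0 \<le> B1"
    "\<And>x (y::'f). norm y \<le> norm x \<Longrightarrow> (1 + norm y) ^ 1 * norm (f x) \<le> B1 * decay_weight y"
    using schwartz_decay_weight[OF f] by blast
  have "\<forall>b\<in>Basis. \<exists>B. \<forall>x (y::'f). norm y \<le> norm x \<longrightarrow> norm (partial b f x) \<le> B * decay_weight y"
    using schwartz_decay_weight[OF schwartz_partial[OF f], where k=0] by (metis mult_1 power_0)
  then obtain B2 where B2: "\<And>b x (y::'f). b \<in> Basis \<Longrightarrow> norm y \<le> norm x \<Longrightarrow> norm (partial b f x) \<le> B2 b * decay_weight y"
    by metis
  let ?B = "\<lambda>y::'f. (B1 + (\<Sum>b\<in>Basis. B2 b)) * decay_weight y"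
  have ny: "norm (y::'f) \<le> norm (x::'e, y)" for x y
    by (rule norm_snd_le)
  show ?thesis
    unfolding partial_fourier_def
  proof (rule has_derivative_parametric_integral[where r=1 and B="?B"])
    fix p :: "'e \<times> 'f" and y
    have 1: "((\<lambda>p. f (fst p, y)) has_derivative
        (\<lambda>h. \<Sum>b\<in>Basis. of_real ((fst h, 0) \<bullet> b) * partial b f (fst p, y))) (at p)"
      by (rule has_derivative_compose[OF _ schwartz_has_derivative[OF f]])
         (auto intro!: derivative_eq_intros)
    have 2: "((\<lambda>p. cis (snd p \<bullet> y)) has_derivative (\<lambda>h. (snd h \<bullet> y) *\<^sub>R (\<i> * cis (snd p \<bullet> y)))) (at p)"
      by (intro has_derivative_cis has_derivative_inner_left has_derivative_snd has_derivative_ident)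
    show "((\<lambda>p. cis (snd p \<bullet> y) * f (fst p, y)) has_derivative (\<lambda>h.
      (snd h \<bullet> y) *\<^sub>R (\<i> * cis (snd p \<bullet> y)) * f (fst p, y) +
      cis (snd p \<bullet> y) * (\<Sum>b\<in>Basis. of_real ((fst h, 0) \<bullet> b) * partial b f (fst p, y)))) (at p)"
      by (rule has_derivative_eq_rhs[OF has_derivative_mult[OF 2 1]]) (simp add: add.commute)
  next
    fix p h :: "'e \<times> 'f" and y :: 'f
    have "norm ((snd h \<bullet> y) *\<^sub>R (\<i> * cis (snd p \<bullet> y)) * f (fst p, y)) \<le> B1 * decay_weight y * norm h"
    proof -
      have "norm ((snd h \<bullet> y) *\<^sub>R (\<i> * cis (snd p \<bullet> y)) * f (fst p, y)) = \<bar>snd h \<bullet> y\<bar> * norm (f (fst p, y))"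
        by (simp add: norm_mult)
      also have "\<dots> \<le> (norm h * (1 + norm y)) * norm (f (fst p, y))"
      proof (rule mult_right_mono)
        have "\<bar>snd h \<bullet> y\<bar> \<le> norm (snd h) * norm y" by (rule Cauchy_Schwarz_ineq2)
        also have "\<dots> \<le> norm h * (1 + norm y)" using norm_snd_le[of "snd h" "fst h"] by (intro mult_mono) auto
        finally show "\<bar>snd h \<bullet> y\<bar> \<le> norm h * (1 + norm y)" .
      qed simp
      also have "\<dots> = norm h * ((1 + norm y) ^ 1 * norm (f (fst p, y)))" by simp
      also have "\<dots> \<le> norm h * (B1 * decay_weight y)"
        by (intro mult_left_mono B1 ny) auto
      finally show ?thesis by (simp add: mult_ac)
    qed
    moreover have "norm (cis (snd p \<bullet> y) * (\<Sum>b\<in>Basis. of_real ((fst h, 0) \<bullet> b) * partial b f (fst p, y)))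
      \<le> (\<Sum>b\<in>Basis. B2 b) * decay_weight y * norm h"
    proof -
      have "norm (cis (snd p \<bullet> y) * (\<Sum>b\<in>Basis. of_real ((fst h, 0) \<bullet> b) * partial b f (fst p, y)))
        \<le> (\<Sum>b\<in>Basis. norm (of_real ((fst h, 0) \<bullet> b) * partial b f (fst p, y)))"
        by (simp only: norm_mult[of "cis _"] norm_cis mult_1 norm_sum)
      also have "\<dots> \<le> (\<Sum>b\<in>Basis. norm h * (B2 b * decay_weight y))"
      proof (rule sum_mono)
        fix b :: "'e \<times> 'f" assume b: "b \<in> Basis"
        have "\<bar>(fst h, 0) \<bullet> b\<bar> \<le> norm (fst h, 0::'f)" by (rule Basis_le_norm[OF b])
        also have "\<dots> \<le> norm h" using norm_fst_le[of "fst h" "snd h"] by simp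
        finally show "norm (of_real ((fst h, 0) \<bullet> b) * partial b f (fst p, y)) \<le> norm h * (B2 b * decay_weight y)"
          unfolding norm_mult norm_of_real by (intro mult_mono B2 b ny) auto
      qed
      finally show ?thesis by (simp add: sum_distrib_left sum_distrib_right mult_ac)
    qed
    ultimately show "norm ((snd h \<bullet> y) *\<^sub>R (\<i> * cis (snd p \<bullet> y)) * f (fst p, y) +
      cis (snd p \<bullet> y) * (\<Sum>b\<in>Basis. of_real ((fst h, 0) \<bullet> b) * partial b f (fst p, y))) \<le> ?B y * norm h"
      by (rule norm_triangle_le[OF order_trans[OF add_mono]]) (simp add: algebra_simps)
  next
    show "integrable lborel (\<lambda>y. cis (snd p \<bullet> y) * f (fst p, y))" for p
      by (intro schwartz_integrable schwartz_slice_cis f)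
  next
    fix h :: "'e \<times> 'f"
    have [measurable]: "(\<lambda>y. f (fst p0, y)) \<in> borel_measurable borel"
      by (intro schwartz_measurable schwartz_slice f)
    have [measurable]: "b \<in> Basis \<Longrightarrow> (\<lambda>y. partial b f (fst p0, y)) \<in> borel_measurable borel" for b
      by (intro schwartz_measurable schwartz_slice schwartz_partial f)
    have [measurable]: "(\<lambda>y. cis (snd p0 \<bullet> y)) \<in> borel_measurable borel"
      by (intro borel_measurable_continuous_onI continuous_intros)
    show "(\<lambda>y. (snd h \<bullet> y) *\<^sub>R (\<i> * cis (snd p0 \<bullet> y)) * f (fst p0, y) +
      cis (snd p0 \<bullet> y) * (\<Sum>b\<in>Basis. of_real ((fst h, 0) \<bullet> b) * partial b f (fst p0, y))) \<in> borel_measurable lborel"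
      by measurable
  qed (auto intro!: integrable_mult_right integrable_decay_weight)
qed

lemma partial_sum_Basis:
  assumes "f \<in> schwartz" shows "(\<Sum>b\<in>Basis. of_real (c \<bullet> b) * partial b f x) = partial c f x"
  by (rule partial_eq[OF schwartz_has_derivative[OF assms], symmetric])

text \<open>The partial transforms of all Schwartz functions form a stable family: in the
  transformed variable, derivatives and coordinate factors are exchanged, while in the other
  variable both commute with the integral.\<close>

lemma partial_fourier_schwartz:
  fixes f :: "'e::euclidean_space \<times> 'f::euclidean_space \<Rightarrow> complex"
  assumes "f \<in> schwartz" shows "partial_fourier f \<in> schwartz"
proof -
  define A where "A = {partial_fourier f | f :: 'e \<times> 'f \<Rightarrow> complex. f \<in> schwartz}"
  have AI: "partial_fourier f \<in> A" if "f \<in> schwartz" for f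
    using that unfolding A_def by blast
  show ?thesis
  proof (rule schwartz_coinduct[where A=A])
    fix g and b :: "'e \<times> 'f" assume "g \<in> A"
    then obtain f where g: "g = partial_fourier f" and f: "f \<in> schwartz"
      unfolding A_def by blast
    show "g differentiable (at x)" for x
      unfolding g by (rule differentiableI[OF partial_fourier_has_derivative[OF f]])
    obtain B where B: "0 \<le> B"
      "\<And>x (y::'f). norm y \<le> norm x \<Longrightarrow> (1 + norm y) ^ 0 * norm (f x) \<le> B * decay_weight y"
      using schwartz_decay_weight[OF f] by blast
    have "norm (g z) \<le> (LINT y|lborel. B * decay_weight (y::'f))" for z
    proof -
      have "norm (g z) \<le> (LINT y|lborel. norm (cis (snd z \<bullet> y) * f (fst z, y)))"
        unfolding g partial_fourier_def by (rule integral_norm_bound)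
      also have "\<dots> \<le> (LINT y|lborel. B * decay_weight (y::'f))"
      proof (rule integral_mono)
        fix y :: 'f
        show "norm (cis (snd z \<bullet> y) * f (fst z, y)) \<le> B * decay_weight y"
          using B(2)[of y "(fst z, y)"] norm_snd_le[of y "fst z"] by (simp add: norm_mult)
      qed (auto intro!: integrable_norm schwartz_integrable schwartz_slice_cis f integrable_mult_right
          integrable_decay_weight)
      finally show ?thesis .
    qed
    then show "\<exists>B. \<forall>x. norm (g x) \<le> B" by blast
    assume b: "b \<in> Basis"
    then consider (l) c where "b = (c, 0)" "c \<in> Basis" | (r) c where "b = (0, c)" "c \<in> Basis"
      by (auto simp: Basis_prod_def)
    then have "(\<lambda>x. of_real (x \<bullet> b) * g x) \<in> A \<and> partial b g \<in> A"
    proof cases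
      case l
      have "(\<lambda>x. of_real (x \<bullet> b) * g x) = partial_fourier (\<lambda>z. of_real (z \<bullet> b) * f z)"
        by (simp add: g l partial_fourier_def fun_eq_iff inner_prod_def mult_ac flip: integral_mult_right_zero)
      moreover have "partial b g z = partial_fourier (partial b f) z" for z
        unfolding g partial_eq[OF partial_fourier_has_derivative[OF f]] l(1) fst_conv snd_conv partial_sum_Basis[OF f]
        by (simp add: partial_fourier_def)
      then have "partial b g = partial_fourier (partial b f)" ..
      ultimately show ?thesis
        using AI[OF schwartz_partial[OF f b]]
          AI[OF schwartz_mult_poly[OF f real_polynomial_function.intros(1)[OF bounded_linear_inner_left[of b]]]] by simp
    next
      case r
      have "of_real (z \<bullet> b) * g z = partial_fourier (\<lambda>x. \<i> * partial b f x) z" for z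
      proof -
        let ?s = "\<lambda>y. cis (snd z \<bullet> y) * f (fst z, y)"
        have s: "?s \<in> schwartz" by (rule schwartz_slice_cis[OF f])
        have D: "(?s has_derivative (\<lambda>h. cis (snd z \<bullet> y) * (\<Sum>b\<in>Basis. of_real ((0, h) \<bullet> b) * partial b f (fst z, y))
            + (snd z \<bullet> h) *\<^sub>R (\<i> * cis (snd z \<bullet> y)) * f (fst z, y))) (at y)" for y
          by (intro has_derivative_mult has_derivative_cis has_derivative_inner_right has_derivative_ident
              has_derivative_compose[OF _ schwartz_has_derivative[OF f]]) (auto intro!: derivative_eq_intros)
        have p: "partial c ?s y = cis (snd z \<bullet> y) * partial b f (fst z, y) + (\<i> * of_real (z \<bullet> b)) * ?s y" for y
          unfolding partial_eq[OF D] partial_sum_Basis[OF f] r(1)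
          by (simp add: scaleR_conv_of_real inner_prod_def)
        define k where "k = \<i> * complex_of_real (z \<bullet> b)"
        have i: "integrable lborel (\<lambda>y. cis (snd z \<bullet> y) * partial b f (fst z, y))"
          by (rule schwartz_integrable[OF schwartz_slice_cis[OF schwartz_partial[OF f b]]])
        have j: "integrable lborel (\<lambda>y. k * ?s y)"
          by (rule schwartz_integrable[OF schwartz_mult_const[OF s]])
        \<comment> \<open>Integration by parts: the product rule splits this vanishing integral and
          trades the factor \<open>z \<bullet> b\<close> for a derivative of f.\<close>
        have "0 = (LINT y|lborel. partial c ?s y)"
          by (rule integral_partial_schwartz[OF s r(2), symmetric])
        also have "\<dots> = (LINT y|lborel. cis (snd z \<bullet> y) * partial b f (fst z, y) + k * ?s y)"
          unfolding p k_def ..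
        also have "\<dots> = (LINT y|lborel. cis (snd z \<bullet> y) * partial b f (fst z, y)) + (LINT y|lborel. k * ?s y)"
          by (rule Bochner_Integration.integral_add[OF i j])
        also have "(LINT y|lborel. k * ?s y) = k * (LINT y|lborel. ?s y)"
          by (rule integral_mult_right_zero)
        finally have "(LINT y|lborel. cis (snd z \<bullet> y) * partial b f (fst z, y)) = - (k * (LINT y|lborel. ?s y))"
          by (simp only: eq_neg_iff_add_eq_0)
        then have "of_real (z \<bullet> b) * (LINT y|lborel. ?s y) =
            \<i> * (LINT y|lborel. cis (snd z \<bullet> y) * partial b f (fst z, y))"
          by (simp add: k_def mult.assoc[symmetric])
        then show ?thesis
          unfolding g partial_fourier_def by (simp add: mult.left_commute)
      qed
      then have "(\<lambda>z. of_real (z \<bullet> b) * g z) = partial_fourier (\<lambda>x. \<i> * partial b f x)" ..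
      moreover have "partial b g z = partial_fourier (\<lambda>z. of_real (z \<bullet> b) * (\<i> * f z)) z" for z
        unfolding g partial_eq[OF partial_fourier_has_derivative[OF f]] r(1)
        by (simp add: partial_fourier_def inner_prod_def scaleR_conv_of_real mult_ac inner_commute zero_prod_def[symmetric])
      then have "partial b g = partial_fourier (\<lambda>z. of_real (z \<bullet> b) * (\<i> * f z))" ..
      ultimately show ?thesis
        using AI[OF schwartz_mult_const[OF schwartz_partial[OF f b]]]
          AI[OF schwartz_mult_poly[OF schwartz_mult_const[OF f] real_polynomial_function.intros(1)[OF bounded_linear_inner_left[of b]]]]
        by simp
    qed
    then show "(\<lambda>x. of_real (x \<bullet> b) * g x) \<in> A" "partial b g \<in> A" by auto
  qed (rule AI[OF assms])
qed

text \<open>Integrating out a variable is the partial Fourier transform at frequency 0.\<close>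

lemma schwartz_integral:
  fixes f :: "'e::euclidean_space \<times> 'f::euclidean_space \<Rightarrow> complex"
  assumes "f \<in> schwartz" shows "(\<lambda>x. LINT y|lborel. f (x, y)) \<in> schwartz"
proof -
  have "(\<lambda>x. partial_fourier f (x, 0)) \<in> schwartz"
    by (rule schwartz_comp[OF partial_fourier_schwartz[OF assms], of _ fst]) (auto intro!: poly_intros)
  then show ?thesis by (simp add: partial_fourier_def)
qed

section \<open>Iterated integrals\<close>

lemma lborel_integral_fst:
  fixes f :: "'e::euclidean_space \<times> 'f::euclidean_space \<Rightarrow> complex"
  assumes "integrable lborel f"
  shows "(LINT x|lborel. LINT y|lborel. f (x, y)) = integral\<^sup>L lborel f"
  using lborel_pair.integral_fst'[of f] assms by (simp add: lborel_prod)

lemma lborel_integral_snd: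
  fixes f :: "'e::euclidean_space \<times> 'f::euclidean_space \<Rightarrow> complex"
  assumes "integrable lborel f"
  shows "(LINT y|lborel. LINT x|lborel. f (x, y)) = integral\<^sup>L lborel f"
  using lborel_pair.integral_snd[of "\<lambda>x y. f (x, y)"] assms by (simp add: lborel_prod)

lemma lborel_integral_swap:
  fixes f :: "'e::euclidean_space \<Rightarrow> 'f::euclidean_space \<Rightarrow> complex"
  assumes "integrable lborel (\<lambda>z. f (fst z) (snd z))"
  shows "(LINT x|lborel. LINT y|lborel. f x y) = (LINT y|lborel. LINT x|lborel. f x y)"
  using lborel_integral_fst[OF assms] lborel_integral_snd[OF assms] by simp

lemma integrable_tensor:
  fixes u :: "'e::euclidean_space \<Rightarrow> complex" and v :: "'f::euclidean_space \<Rightarrow> complex"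
  assumes u: "integrable lborel u" and v: "integrable lborel v"
  shows "integrable lborel (\<lambda>z. u (fst z) * v (snd z))"
proof -
  have [measurable]: "u \<in> borel_measurable borel" "v \<in> borel_measurable borel"
    using assms by auto
  have "integrable (lborel \<Otimes>\<^sub>M lborel) (\<lambda>z. u (fst z) * v (snd z))"
    by (rule lborel_pair.Fubini_integrable)
       (use assms in \<open>auto simp: norm_mult intro!: integrable_mult_left integrable_mult_right\<close>)
  then show ?thesis by (simp add: lborel_prod)
qed

lemma lborel_integral_scale:
  fixes f :: "'e::euclidean_space \<Rightarrow> complex"
  assumes "f \<in> borel_measurable borel" "0 < c"
  shows "(LINT y|lborel. f y) = of_real (c ^ DIM('e)) * (LINT y|lborel. f (c *\<^sub>R y))"
proof -
  have "(LINT y|lborel. f y) = (LINT y|density (distr lborel borel (\<lambda>x. 0 + c *\<^sub>R x)) (\<lambda>_. ennreal (\<bar>c\<bar>^DIM('e))). f y)"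
    using lborel_affine[of c "0::'e"] assms(2) by simp
  also have "\<dots> = of_real (c ^ DIM('e)) * (LINT y|lborel. f (c *\<^sub>R y))"
    using assms by (subst integral_density) (auto simp: integral_distr scaleR_conv_of_real)
  finally show ?thesis .
qed

lemma fst_measurable_borel [measurable]:
  "(fst :: 'e::euclidean_space \<times> 'f::euclidean_space \<Rightarrow> 'e) \<in> borel \<rightarrow>\<^sub>M borel"
  by (intro borel_measurable_continuous_onI continuous_intros)

lemma snd_measurable_borel [measurable]:
  "(snd :: 'e::euclidean_space \<times> 'f::euclidean_space \<Rightarrow> 'f) \<in> borel \<rightarrow>\<^sub>M borel"
  by (intro borel_measurable_continuous_onI continuous_intros)

lemma cnj_measurable [measurable]: "cnj \<in> borel_measurable borel"
  by (intro borel_measurable_continuous_onI continuous_intros)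

lemma cis_measurable [measurable]: "cis \<in> borel_measurable borel"
  by (intro borel_measurable_continuous_onI continuous_intros)

section \<open>Fourier inversion\<close>

definition gauss :: "'e::euclidean_space \<Rightarrow> real" where
  "gauss y = (\<Prod>b\<in>Basis. std_normal_density (y \<bullet> b))"

text \<open>The Gaussian is a product over coordinates, so its transform is a product of
  characteristic functions of the standard normal distribution and reproduces the Gaussian up to a
  constant.\<close>

lemma gauss_fourier:
  fixes \<eta> :: "'e::euclidean_space"
  shows "integrable lborel (\<lambda>y::'e. complex_of_real (gauss y))"
    and "(LINT y|lborel. cis (\<eta> \<bullet> y) * of_real (gauss y)) = of_real (sqrt (2 * pi) ^ DIM('e) * gauss \<eta>)"
proof -
  interpret P: product_sigma_finite "\<lambda>_::'e. lborel :: real measure"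
    by standard
  have 1: "integrable lborel (\<lambda>t. cis (s * t) * complex_of_real (std_normal_density t))" for s
  proof (rule Bochner_Integration.integrable_bound)
    show "integrable lborel std_normal_density" by simp
  qed (auto simp: norm_mult)
  have 2: "(LINT t|lborel. cis (s * t) * complex_of_real (std_normal_density t)) = of_real (exp (- (s\<^sup>2) / 2))" for s
  proof -
    have "(LINT t|lborel. cis (s * t) * complex_of_real (std_normal_density t)) = char std_normal_distribution s"
      unfolding char_def by (subst integral_density) (auto simp: cis_conv_exp scaleR_conv_of_real mult_ac)
    then show ?thesis by (simp add: char_std_normal_distribution)
  qed
  have cis_sum: "cis (\<Sum>b\<in>I. g b) = (\<Prod>b\<in>I. cis (g b))" if "finite I" for I and g :: "'e \<Rightarrow> real"
    using that by induction (auto simp flip: cis_mult)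
  have eq: "cis (\<eta> \<bullet> y) * of_real (gauss y) = (\<Prod>b\<in>Basis. cis ((\<eta> \<bullet> b) * (y \<bullet> b)) * complex_of_real (std_normal_density (y \<bullet> b)))" for \<eta> y :: 'e
    by (subst euclidean_inner) (simp add: gauss_def cis_sum prod.distrib)
  have meas: "(\<lambda>f. \<Sum>b\<in>Basis. f b *\<^sub>R b) \<in> (\<Pi>\<^sub>M b\<in>(Basis::'e set). lborel) \<rightarrow>\<^sub>M borel"
    by measurable
  have mg: "(\<lambda>y::'e. cis (\<eta> \<bullet> y) * complex_of_real (gauss y)) \<in> borel_measurable borel" for \<eta>
    unfolding gauss_def by measurable
  have i: "integrable lborel (\<lambda>y::'e. cis (\<eta> \<bullet> y) * complex_of_real (gauss y))" for \<eta>
  proof -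
    have "integrable (\<Pi>\<^sub>M b\<in>(Basis::'e set). lborel)
        (\<lambda>x. \<Prod>b\<in>Basis. cis ((\<eta> \<bullet> b) * x b) * complex_of_real (std_normal_density (x b)))"
      by (rule P.product_integrable_prod) (auto intro: 1)
    then show ?thesis
      by (subst lborel_eq, subst integrable_distr_eq[OF meas mg]) (simp add: eq cong: prod.cong)
  qed
  show "integrable lborel (\<lambda>y::'e. complex_of_real (gauss y))"
    using i[of 0] by simp
  have "(LINT y|lborel. cis (\<eta> \<bullet> y) * of_real (gauss y)) =
      (\<integral>x. (\<Prod>b\<in>Basis. cis ((\<eta> \<bullet> b) * x b) * complex_of_real (std_normal_density (x b))) \<partial>(\<Pi>\<^sub>M b\<in>(Basis::'e set). lborel))"
    by (subst lborel_eq, subst integral_distr[OF meas mg]) (simp add: eq cong: prod.cong)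
  also have "\<dots> = (\<Prod>b\<in>(Basis::'e set). complex_of_real (exp (- ((\<eta> \<bullet> b)\<^sup>2) / 2)))"
    by (subst P.product_integral_prod) (auto intro: 1 simp: 2)
  also have "\<dots> = of_real (sqrt (2 * pi) ^ DIM('e) * gauss \<eta>)"
    by (simp add: gauss_def std_normal_density_def prod_dividef field_simps)
  finally show "(LINT y|lborel. cis (\<eta> \<bullet> y) * of_real (gauss y)) = of_real (sqrt (2 * pi) ^ DIM('e) * gauss \<eta>)" .
qed

definition fourier :: "('e::euclidean_space \<Rightarrow> complex) \<Rightarrow> 'e \<Rightarrow> complex" where
  "fourier u \<eta> = (LINT y|lborel. cis (\<eta> \<bullet> y) * u y)"

text \<open>For u x nonzero, \<open>fourier u\<close> is a slice of the partial transform of the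
  tensor square of u, divided by u x; the result for \<open>partial_fourier\<close> is thereby
  reused.\<close>

lemma fourier_schwartz:
  fixes u :: "'e::euclidean_space \<Rightarrow> complex"
  assumes u: "u \<in> schwartz" shows "fourier u \<in> schwartz"
proof (cases "\<exists>x. u x \<noteq> 0")
  case True
  then obtain x where x: "u x \<noteq> 0" by blast
  have "(\<lambda>\<eta>. inverse (u x) * partial_fourier (\<lambda>z. u (fst z) * u (snd z)) (x, \<eta>)) \<in> schwartz"
    by (intro schwartz_mult_const schwartz_slice partial_fourier_schwartz schwartz_tensor u)
  moreover have "inverse (u x) * partial_fourier (\<lambda>z. u (fst z) * u (snd z)) (x, \<eta>) = fourier u \<eta>" for \<eta>
  proof -
    have "partial_fourier (\<lambda>z. u (fst z) * u (snd z)) (x, \<eta>) = u x * fourier u \<eta>"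
      unfolding partial_fourier_def fourier_def by (simp add: mult.left_commute)
    then show ?thesis using x by simp
  qed
  ultimately show ?thesis by simp
next
  case False
  then have "fourier u = (\<lambda>x. 0 * u x)" by (auto simp: fourier_def)
  then show ?thesis using schwartz_mult_const[OF u, of 0] by simp
qed

lemma partial_fourier_slice: "partial_fourier f (x, \<eta>) = fourier (\<lambda>y. f (x, y)) \<eta>"
  by (simp add: partial_fourier_def fourier_def)

lemma gauss_bounded:
  fixes y :: "'e::euclidean_space" shows "0 \<le> gauss y" "gauss y \<le> gauss (0::'e)"
proof -
  show "0 \<le> gauss y" unfolding gauss_def by (intro prod_nonneg) auto
  show "gauss y \<le> gauss (0::'e)"
    unfolding gauss_def by (rule prod_mono) (auto simp: std_normal_density_def divide_right_mono)
qed

lemma isCont_gauss: "isCont (gauss :: 'e::euclidean_space \<Rightarrow> real) y"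
  unfolding gauss_def std_normal_density_def by (intro continuous_intros) auto

lemma gauss_measurable [measurable]: "(gauss :: 'e::euclidean_space \<Rightarrow> real) \<in> borel_measurable borel"
  unfolding gauss_def by measurable

lemma gauss_0: "gauss (0::'e::euclidean_space) = inverse (sqrt (2 * pi) ^ DIM('e))"
  by (simp add: gauss_def std_normal_density_def power_one_over inverse_eq_divide)

text \<open>Mollifying with a Gaussian moves the transform to the other factor; then let its width go to infinity.\<close>

lemma integral_fourier:
  fixes u :: "'e::euclidean_space \<Rightarrow> complex"
  assumes u: "u \<in> schwartz"
  shows "(LINT \<eta>|lborel. fourier u \<eta>) = of_real ((2 * pi) ^ DIM('e)) * u 0"
proof -
  let ?c = "\<lambda>n. inverse (real (Suc n))"
  let ?k = "sqrt (2 * pi) ^ DIM('e)"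
  have [measurable]: "u \<in> borel_measurable borel" "fourier u \<in> borel_measurable borel"
    by (intro schwartz_measurable fourier_schwartz u)+
  obtain B where B: "0 \<le> B" "\<And>x. (1 + norm x) ^ 0 * norm (u x) \<le> B"
    using schwartz_decay[OF u] by blast
  have c0: "?c \<longlonglongrightarrow> 0" by (rule LIMSEQ_inverse_real_of_nat)
  have isc: "isCont u x" for x
    using schwartz_continuous[OF u, of UNIV] by (simp add: continuous_on_eq_continuous_at)
  have key: "(LINT \<eta>|lborel. fourier u \<eta> * of_real (gauss (c *\<^sub>R \<eta>))) =
      of_real ?k * (LINT y|lborel. u (c *\<^sub>R y) * of_real (gauss y))" if "0 < c" for c
  proof -
    have gc: "integrable lborel (\<lambda>\<eta>::'e. complex_of_real (gauss (c *\<^sub>R \<eta>)))"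
    proof -
      have "integrable (density (distr lborel borel (\<lambda>x::'e. 0 + inverse c *\<^sub>R x)) (\<lambda>_. ennreal (\<bar>inverse c\<bar>^DIM('e))))
          (\<lambda>\<eta>::'e. complex_of_real (gauss (c *\<^sub>R \<eta>)))"
        using gauss_fourier(1) that
        by (subst integrable_density) (auto simp: integrable_distr_eq)
      then show ?thesis using lborel_affine[of "inverse c" "0::'e"] that by simp
    qed
    have "(LINT \<eta>|lborel. fourier u \<eta> * of_real (gauss (c *\<^sub>R \<eta>))) =
        (LINT \<eta>|lborel. LINT y|lborel. cis (\<eta> \<bullet> y) * u y * of_real (gauss (c *\<^sub>R \<eta>)))"
      by (simp add: fourier_def)
    also have "\<dots> = (LINT y|lborel. LINT \<eta>|lborel. cis (\<eta> \<bullet> y) * u y * of_real (gauss (c *\<^sub>R \<eta>)))"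
    proof (rule lborel_integral_swap)
      show "integrable lborel (\<lambda>z. cis (fst z \<bullet> snd z) * u (snd z) * of_real (gauss (c *\<^sub>R fst z)))"
        by (rule Bochner_Integration.integrable_bound[OF integrable_tensor[OF gc schwartz_integrable[OF u]]])
           (auto simp: norm_mult mult_ac)
    qed
    also have "\<dots> = (LINT y|lborel. u y * (LINT \<eta>|lborel. cis (\<eta> \<bullet> y) * of_real (gauss (c *\<^sub>R \<eta>))))"
      by (simp add: mult_ac flip: integral_mult_right_zero)
    also have "\<dots> = of_real (c ^ DIM('e)) *
        (LINT y|lborel. u (c *\<^sub>R y) * (LINT \<eta>|lborel. cis (\<eta> \<bullet> (c *\<^sub>R y)) * of_real (gauss (c *\<^sub>R \<eta>))))"
      by (subst lborel_integral_scale[OF _ that]) measurable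
    also have "\<dots> = (LINT y|lborel. u (c *\<^sub>R y) *
        (of_real (c ^ DIM('e)) * (LINT \<eta>|lborel. cis ((c *\<^sub>R \<eta>) \<bullet> y) * of_real (gauss (c *\<^sub>R \<eta>)))))"
      by (simp add: mult_ac flip: integral_mult_right_zero)
    also have "\<dots> = (LINT y|lborel. u (c *\<^sub>R y) * (LINT \<eta>|lborel. cis (\<eta> \<bullet> y) * of_real (gauss \<eta>)))"
    proof -
      have "(LINT \<eta>|lborel. cis (\<eta> \<bullet> y) * of_real (gauss \<eta>)) =
        of_real (c ^ DIM('e)) * (LINT \<eta>|lborel. cis ((c *\<^sub>R \<eta>) \<bullet> y) * of_real (gauss (c *\<^sub>R \<eta>)))" for y :: 'e
        by (rule lborel_integral_scale[OF _ that]) measurable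
      then show ?thesis by simp
    qed
    also have "\<dots> = (LINT y|lborel. u (c *\<^sub>R y) * (of_real ?k * of_real (gauss y)))"
    proof -
      have "(LINT \<eta>|lborel. cis (\<eta> \<bullet> y) * of_real (gauss \<eta>)) = of_real ?k * complex_of_real (gauss y)" for y :: 'e
        using gauss_fourier(2)[of y] by (simp add: inner_commute)
      then show ?thesis by simp
    qed
    also have "\<dots> = of_real ?k * (LINT y|lborel. u (c *\<^sub>R y) * of_real (gauss y))"
      by (simp add: mult.left_commute flip: integral_mult_right_zero)
    finally show ?thesis .
  qed
  have l1: "(\<lambda>n. LINT \<eta>|lborel. fourier u \<eta> * of_real (gauss (?c n *\<^sub>R \<eta>))) \<longlonglongrightarrow>
      (LINT \<eta>|lborel. fourier u \<eta> * of_real (gauss (0::'e)))"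
  proof (rule integral_dominated_convergence[where w="\<lambda>\<eta>. norm (fourier u \<eta>) * gauss (0::'e)"])
    show "AE \<eta> in lborel. (\<lambda>n. fourier u \<eta> * of_real (gauss (?c n *\<^sub>R \<eta>))) \<longlonglongrightarrow> fourier u \<eta> * of_real (gauss (0::'e))"
    proof (rule AE_I2)
      fix \<eta> :: 'e
      have "(\<lambda>n. ?c n *\<^sub>R \<eta>) \<longlonglongrightarrow> 0"
        using tendsto_scaleR[OF c0 tendsto_const[of \<eta>]] by simp
      then show "(\<lambda>n. fourier u \<eta> * of_real (gauss (?c n *\<^sub>R \<eta>))) \<longlonglongrightarrow> fourier u \<eta> * of_real (gauss (0::'e))"
        by (intro tendsto_intros isCont_tendsto_compose[OF isCont_gauss])
    qed
    show "integrable lborel (\<lambda>\<eta>. norm (fourier u \<eta>) * gauss (0::'e))"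
      by (intro integrable_mult_left integrable_norm schwartz_integrable fourier_schwartz u)
    show "AE \<eta> in lborel. norm (fourier u \<eta> * of_real (gauss (?c n *\<^sub>R \<eta>))) \<le> norm (fourier u \<eta>) * gauss (0::'e)" for n
      by (auto simp: norm_mult gauss_bounded intro!: mult_left_mono)
  qed measurable
  have l2: "(\<lambda>n. LINT y|lborel. u (?c n *\<^sub>R y) * of_real (gauss y)) \<longlonglongrightarrow>
      (LINT y|lborel. u 0 * of_real (gauss (y::'e)))"
  proof (rule integral_dominated_convergence[where w="\<lambda>y. B * norm (complex_of_real (gauss y))"])
    show "AE y in lborel. (\<lambda>n. u (?c n *\<^sub>R y) * of_real (gauss y)) \<longlonglongrightarrow> u 0 * of_real (gauss y)"
    proof (rule AE_I2)
      fix y :: 'e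
      have "(\<lambda>n. ?c n *\<^sub>R y) \<longlonglongrightarrow> 0"
        using tendsto_scaleR[OF c0 tendsto_const[of y]] by simp
      then show "(\<lambda>n. u (?c n *\<^sub>R y) * of_real (gauss y)) \<longlonglongrightarrow> u 0 * of_real (gauss y)"
        by (intro tendsto_intros isCont_tendsto_compose[OF isc])
    qed
    show "integrable lborel (\<lambda>y::'e. B * norm (complex_of_real (gauss y)))"
      by (intro integrable_mult_right integrable_norm gauss_fourier)
    show "AE y in lborel. norm (u (?c n *\<^sub>R y) * of_real (gauss y)) \<le> B * norm (complex_of_real (gauss y))" for n
      using B by (auto simp: norm_mult intro!: mult_right_mono)
  qed measurable
  have "(LINT \<eta>|lborel. fourier u \<eta> * of_real (gauss (0::'e))) =
      of_real ?k * (LINT y|lborel. u 0 * of_real (gauss (y::'e)))"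
  proof (rule LIMSEQ_unique[OF l1])
    have "0 < ?c n" for n by simp
    from key[OF this] show "(\<lambda>n. LINT \<eta>|lborel. fourier u \<eta> * of_real (gauss (?c n *\<^sub>R \<eta>))) \<longlonglongrightarrow>
        of_real ?k * (LINT y|lborel. u 0 * of_real (gauss (y::'e)))"
      using tendsto_mult[OF tendsto_const l2, of "of_real ?k"] by (simp only:)
  qed
  moreover have "(LINT y|lborel. complex_of_real (gauss (y::'e))) = 1"
    using gauss_fourier(2)[of "0::'e"] by (simp add: gauss_0)
  \<comment> \<open>The constant \<open>?k\<close> occurs twice, once as the reciprocal of
    \<open>gauss 0\<close> and once in the transform of the Gaussian; its square is the constant of
    the inversion formula.\<close>
  ultimately have "(LINT \<eta>|lborel. fourier u \<eta>) * of_real (inverse ?k) = of_real ?k * u 0"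
    by (simp add: gauss_0)
  then have "(LINT \<eta>|lborel. fourier u \<eta>) * of_real (inverse ?k) * of_real ?k = of_real (?k * ?k) * u 0"
    by (simp only: of_real_mult mult_ac)
  moreover have "complex_of_real (inverse ?k) * of_real ?k = 1"
    by (simp flip: of_real_mult)
  ultimately have "(LINT \<eta>|lborel. fourier u \<eta>) = of_real (?k * ?k) * u 0"
    by (simp only: mult.assoc mult_1_right)
  also have "?k * ?k = (2 * pi) ^ DIM('e)"
    by (simp only: power_mult_distrib[symmetric] real_sqrt_mult_self) simp
  finally show ?thesis .
qed

text \<open>Translating u by x multiplies its transform by a phase, which reduces the claim to the
  value at 0.\<close>

lemma fourier_inversion:
  fixes u :: "'e::euclidean_space \<Rightarrow> complex"
  assumes u: "u \<in> schwartz"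
  shows "(LINT \<eta>|lborel. cis (- (\<eta> \<bullet> x)) * fourier u \<eta>) = of_real ((2 * pi) ^ DIM('e)) * u x"
proof -
  have ux: "(\<lambda>y. u (x + y)) \<in> schwartz"
    by (rule schwartz_comp[OF u, of _ "\<lambda>y. y - x"])
       (auto intro!: poly_intros polynomial_function_add polynomial_function_diff)
  have [measurable]: "u \<in> borel_measurable borel" by (rule schwartz_measurable[OF u])
  have "fourier (\<lambda>y. u (x + y)) \<eta> = cis (- (\<eta> \<bullet> x)) * fourier u \<eta>" for \<eta>
  proof -
    have "fourier u \<eta> = (LINT y|lborel. cis (\<eta> \<bullet> (x + y)) * u (x + y))"
      unfolding fourier_def by (rule lborel_integral_translation[symmetric]) measurable
    also have "\<dots> = cis (\<eta> \<bullet> x) * fourier (\<lambda>y. u (x + y)) \<eta>"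
      unfolding fourier_def by (simp add: inner_add_right cis_mult[symmetric] mult.assoc)
    finally show ?thesis by (simp add: cis_mult flip: mult.assoc)
  qed
  then show ?thesis using integral_fourier[OF ux] by simp
qed

text \<open>Inversion with the two signs exchanged, as \<open>kernel_symbol\<close> requires;
  conjugation reduces it to the other form.\<close>

lemma fourier_inversion':
  fixes u :: "'e::euclidean_space \<Rightarrow> complex"
  assumes u: "u \<in> schwartz"
  shows "(LINT \<eta>|lborel. cis (\<eta> \<bullet> x) * (LINT y|lborel. cis (- (\<eta> \<bullet> y)) * u y)) = of_real ((2 * pi) ^ DIM('e)) * u x"
proof -
  have "(\<lambda>y. cnj (u y)) \<in> schwartz" by (rule schwartz_cnj[OF u])
  from fourier_inversion[OF this, of x]
  have "cnj (LINT \<eta>|lborel. cis (- (\<eta> \<bullet> x)) * fourier (\<lambda>y. cnj (u y)) \<eta>) = of_real ((2 * pi) ^ DIM('e)) * u x"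
    by simp
  then show ?thesis
    by (simp add: fourier_def cis_cnj flip: Bochner_Integration.integral_cnj)
qed

text \<open>Fubini moves the transform of v onto \<open>fourier u\<close>, where inversion applies;
  the phase has modulus 1, so the tensor product of \<open>fourier u\<close> and v dominates the
  integrand.\<close>

lemma parseval:
  fixes u v :: "'e::euclidean_space \<Rightarrow> complex"
  assumes u: "u \<in> schwartz" and v: "v \<in> schwartz"
  shows "(LINT \<eta>|lborel. fourier u \<eta> * cnj (fourier v \<eta>)) = of_real ((2 * pi) ^ DIM('e)) * (LINT x|lborel. u x * cnj (v x))"
proof -
  have [measurable]: "v \<in> borel_measurable borel" "fourier u \<in> borel_measurable borel"
    by (intro schwartz_measurable fourier_schwartz u v)+
  have "(LINT \<eta>|lborel. fourier u \<eta> * cnj (fourier v \<eta>)) =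
      (LINT \<eta>|lborel. LINT x|lborel. fourier u \<eta> * cnj (cis (\<eta> \<bullet> x) * v x))"
    by (simp only: fourier_def[of v] Bochner_Integration.integral_cnj[symmetric] integral_mult_right_zero)
  also have "\<dots> = (LINT x|lborel. LINT \<eta>|lborel. fourier u \<eta> * cnj (cis (\<eta> \<bullet> x) * v x))"
  proof (rule lborel_integral_swap)
    show "integrable lborel (\<lambda>z. fourier u (fst z) * cnj (cis (fst z \<bullet> snd z) * v (snd z)))"
      by (rule Bochner_Integration.integrable_bound[OF integrable_tensor[OF
            schwartz_integrable[OF fourier_schwartz[OF u]] schwartz_integrable[OF v]]])
         (auto simp: norm_mult)
  qed
  also have "\<dots> = (LINT x|lborel. (LINT \<eta>|lborel. cis (- (\<eta> \<bullet> x)) * fourier u \<eta>) * cnj (v x))"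
    by (simp add: cis_cnj mult_ac flip: integral_mult_left_zero)
  also have "\<dots> = of_real ((2 * pi) ^ DIM('e)) * (LINT x|lborel. u x * cnj (v x))"
    by (simp add: fourier_inversion[OF u] mult.assoc)
  finally show ?thesis .
qed

section \<open>Cartesian coordinates on a Euclidean space\<close>

text \<open>The library's change of variables formula is for \<open>real ^ 'n\<close> with a well-ordered index type.\<close>

typedef (overloaded) 'a basis_index = "Basis :: 'a::euclidean_space set"
  morphisms basis_vector basis_index
  using nonempty_Basis by blast

instance basis_index :: (euclidean_space) finite
proof
  have "UNIV = basis_index ` (Basis :: 'a set)"
    by (rule type_definition.Abs_image[OF type_definition_basis_index, symmetric])
  then show "finite (UNIV :: 'a basis_index set)" by (metis finite_Basis finite_imageI)
qed

instantiation basis_index :: (euclidean_space) wellorder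
begin

definition less_eq_basis_index_def:
  "(x :: 'a basis_index) \<le> y \<longleftrightarrow> to_nat_on UNIV x \<le> to_nat_on UNIV y"

definition less_basis_index_def:
  "(x :: 'a basis_index) < y \<longleftrightarrow> to_nat_on UNIV x < to_nat_on UNIV y"

instance
proof
  fix x y :: "'a::euclidean_space basis_index"
  show "x \<le> y \<Longrightarrow> y \<le> x \<Longrightarrow> x = y"
    using inj_on_to_nat_on[OF countable_finite[of "UNIV :: 'a basis_index set"]]
    by (auto simp: less_eq_basis_index_def inj_on_def)
  show "P a" if "\<And>x. (\<And>y. y < x \<Longrightarrow> P y) \<Longrightarrow> P x" for P and a :: "'a basis_index"
    by (induction a rule: measure_induct_rule[where f="to_nat_on UNIV"])
       (auto intro: that simp: less_basis_index_def)
qed (auto simp: less_eq_basis_index_def less_basis_index_def)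

end

definition from_coords :: "real ^ 'a basis_index \<Rightarrow> 'a::euclidean_space" where
  "from_coords v = (\<Sum>i\<in>UNIV. v $ i *\<^sub>R basis_vector i)"

definition to_coords :: "'a::euclidean_space \<Rightarrow> real ^ 'a basis_index" where
  "to_coords x = (\<chi> i. x \<bullet> basis_vector i)"

lemma basis_vector_Basis: "basis_vector i \<in> Basis"
  using basis_vector by blast

lemma bij_basis_vector: "bij_betw basis_vector UNIV (Basis :: 'a::euclidean_space set)"
  using type_definition.Rep_range[OF type_definition_basis_index]
  by (auto simp: bij_betw_def inj_on_def basis_vector_inject)

lemma from_coords_inner [simp]: "from_coords v \<bullet> basis_vector i = v $ i"
proof -
  have "from_coords v \<bullet> basis_vector i = (\<Sum>j\<in>UNIV. if j = i then v $ j else 0)"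
    unfolding from_coords_def inner_sum_left
    by (intro sum.cong) (auto simp: inner_Basis basis_vector_Basis basis_vector_inject)
  then show ?thesis by simp
qed

lemma to_from_coords [simp]: "to_coords (from_coords v) = v"
  by (simp add: to_coords_def vec_eq_iff)

lemma from_to_coords [simp]: "from_coords (to_coords x) = x"
proof -
  have "(\<Sum>i\<in>UNIV. (x \<bullet> basis_vector i) *\<^sub>R basis_vector i) = (\<Sum>b\<in>Basis. (x \<bullet> b) *\<^sub>R b)"
    by (rule sum.reindex_bij_betw[OF bij_basis_vector])
  then show ?thesis by (simp add: from_coords_def to_coords_def euclidean_representation)
qed

lemma bounded_linear_from_coords: "bounded_linear from_coords"
  unfolding from_coords_def
  by (intro bounded_linear_sum bounded_linear_scaleR_left[THEN bounded_linear_compose] bounded_linear_vec_nth)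

lemma bounded_linear_to_coords: "bounded_linear to_coords"
  unfolding linear_conv_bounded_linear[symmetric]
  by (rule linearI) (auto simp: to_coords_def vec_eq_iff inner_add_left)

lemma from_coords_box: "from_coords -` box l u = box (to_coords l) (to_coords u)"
proof -
  have "from_coords v \<in> box l u \<longleftrightarrow> v \<in> box (to_coords l) (to_coords u)" for v
  proof -
    have "from_coords v \<in> box l u \<longleftrightarrow>
        (\<forall>i. l \<bullet> basis_vector i < from_coords v \<bullet> basis_vector i \<and> from_coords v \<bullet> basis_vector i < u \<bullet> basis_vector i)"
      unfolding mem_box bij_betw_imp_surj_on[OF bij_basis_vector, symmetric] by simp
    then show ?thesis by (simp add: mem_box_cart to_coords_def)
  qed
  then show ?thesis by auto
qed

lemma from_coords_measurable [measurable]: "from_coords \<in> borel_measurable borel"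
  by (intro borel_measurable_continuous_onI linear_continuous_on bounded_linear_from_coords)

text \<open>Lebesgue measure is determined by its values on boxes, and orthonormal coordinates carry
  boxes to boxes with the same side lengths.\<close>

lemma lborel_distr_from_coords:
  "distr lborel borel from_coords = (lborel :: 'a::euclidean_space measure)"
proof (rule lborel_eqI[symmetric])
  fix l u :: 'a assume le: "\<And>b. b \<in> Basis \<Longrightarrow> l \<bullet> b \<le> u \<bullet> b"
  have le': "to_coords l $ i \<le> to_coords u $ i" for i
    using le[OF basis_vector_Basis] by (simp add: to_coords_def)
  have "emeasure (distr lborel borel from_coords) (box l u) = emeasure lborel (box (to_coords l) (to_coords u))"
    by (subst emeasure_distr) (auto simp: from_coords_box)
  also have "\<dots> = emeasure lborel (cbox (to_coords l) (to_coords u))"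
    by (simp add: emeasure_lborel_box_eq emeasure_lborel_cbox_eq)
  also have "\<dots> = ennreal (measure lborel (cbox (to_coords l) (to_coords u)))"
    by (rule emeasure_eq_ennreal_measure) (auto simp: emeasure_lborel_cbox_eq)
  also have "measure lborel (cbox (to_coords l) (to_coords u)) = (\<Prod>i\<in>UNIV. (u - l) \<bullet> basis_vector i)"
    using le' by (subst content_cbox_cart) (auto simp: interval_eq_empty_cart not_less to_coords_def inner_diff_left)
  also have "\<dots> = (\<Prod>b\<in>Basis. (u - l) \<bullet> b)"
    by (rule prod.reindex_bij_betw[OF bij_basis_vector])
  finally show "emeasure (distr lborel borel from_coords) (box l u) = (\<Prod>b\<in>Basis. (u - l) \<bullet> b)" .
qed simp

text \<open>The conclusion concerns g although the Jacobian is that of f: the preimage of a box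
  under g is its image under f, and the change of variables formula measures images.\<close>

lemma lborel_distr_unimodular:
  fixes f g :: "'a::euclidean_space \<Rightarrow> 'a"
  assumes f: "\<And>x. (f has_derivative f' x) (at x)"
    and det: "\<And>x. \<bar>det (matrix (\<lambda>v. to_coords (f' x (from_coords v))))\<bar> = 1"
    and gf: "\<And>x. g (f x) = x" and fg: "\<And>x. f (g x) = x"
    and g: "continuous_on UNIV g"
  shows "distr lborel borel g = lborel"
proof (rule lborel_eqI[symmetric])
  have [measurable]: "g \<in> borel_measurable borel"
    by (rule borel_measurable_continuous_onI[OF g])
  fix l u :: 'a assume le: "\<And>b. b \<in> Basis \<Longrightarrow> l \<bullet> b \<le> u \<bullet> b"
  let ?F = "\<lambda>v. to_coords (f (from_coords v))" and ?B = "box (to_coords l) (to_coords u)"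
  have F: "(?F has_derivative (\<lambda>v. to_coords (f' (from_coords x) (from_coords v)))) (at x)" for x
    by (rule bounded_linear.has_derivative[OF bounded_linear_to_coords])
       (rule has_derivative_compose[OF bounded_linear_imp_has_derivative[OF bounded_linear_from_coords] f])
  have inj: "inj_on ?F ?B"
    by (rule inj_on_inverseI[where g="\<lambda>v. to_coords (g (from_coords v))"]) (simp add: gf)
  have image: "?F ` ?B = from_coords -` g -` box l u"
  proof
    show "?F ` ?B \<subseteq> from_coords -` g -` box l u"
      by (auto simp: gf simp flip: from_coords_box)
    show "from_coords -` g -` box l u \<subseteq> ?F ` ?B"
    proof
      fix v assume "v \<in> from_coords -` g -` box l u"
      then have "to_coords (g (from_coords v)) \<in> ?B" "v = ?F (to_coords (g (from_coords v)))"
        by (auto simp: fg simp flip: from_coords_box)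
      then show "v \<in> ?F ` ?B" by blast
    qed
  qed
  have [measurable]: "from_coords -` g -` box l u \<in> sets borel"
    using measurable_sets[of "\<lambda>v. g (from_coords v)" borel borel "box l u"] by (simp add: vimage_def)
  have "((\<lambda>x. \<bar>det (matrix (\<lambda>v. to_coords (f' (from_coords x) (from_coords v))))\<bar>) has_integral measure lborel ?B) ?B"
    unfolding det by (rule has_integral_measure_lborel) (auto simp: emeasure_lborel_box_eq)
  then have *: "?F ` ?B \<in> lmeasurable \<and> measure lebesgue (?F ` ?B) = measure lborel ?B"
    by (subst has_measure_differentiable_image[OF _ has_derivative_at_withinI[OF F] inj]) auto
  have "emeasure (distr lborel borel g) (box l u) = emeasure (distr (distr lborel borel from_coords) borel g) (box l u)"
    by (simp add: lborel_distr_from_coords)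
  also have "\<dots> = emeasure lborel (from_coords -` g -` box l u)"
    by (simp add: distr_distr emeasure_distr vimage_comp o_def)
  also have "\<dots> = emeasure lebesgue (?F ` ?B)"
    by (simp add: image)
  also have "\<dots> = ennreal (measure lborel ?B)"
    using * by (simp add: emeasure_eq_measure2 fmeasurableD2 emeasure_eq_ennreal_measure)
  also have "\<dots> = emeasure lborel ?B"
    by (rule emeasure_eq_ennreal_measure[symmetric]) (auto simp: emeasure_lborel_box_eq)
  also have "\<dots> = emeasure (distr lborel borel from_coords) (box l u)"
    by (subst emeasure_distr) (auto simp: from_coords_box)
  also have "\<dots> = (\<Prod>b\<in>Basis. (u - l) \<bullet> b)"
    using le by (simp add: lborel_distr_from_coords emeasure_lborel_box)
  finally show "emeasure (distr lborel borel g) (box l u) = (\<Prod>b\<in>Basis. (u - l) \<bullet> b)" .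
qed simp

lemma lborel_distr_uminus_euclidean: "distr lborel borel uminus = (lborel :: 'a::euclidean_space measure)"
  using lborel_affine[of "-1" "0::'a"] by (simp add: density_1 fun_eq_iff)

section \<open>Polynomial groups are unimodular\<close>

text \<open>In the polynomial ring over the reals only the nonzero constants are invertible.\<close>

lemma real_polynomial_function_unit:
  fixes p q :: "real \<Rightarrow> real"
  assumes "real_polynomial_function p" "real_polynomial_function q" and pq: "\<And>t. p t * q t = 1"
  shows "p s = p t"
proof -
  have *: "\<exists>P. \<forall>t. r t = poly P t" if r: "real_polynomial_function r" for r :: "real \<Rightarrow> real"
  proof -
    obtain a n where "r = (\<lambda>x. \<Sum>i\<le>n. a i * x ^ i)"
      using real_polynomial_function_imp_sum[OF r] by (elim exE)
    then have "r t = poly (\<Sum>i\<le>n. monom (a i) i) t" for t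
      by (simp add: poly_sum poly_monom)
    then show ?thesis by blast
  qed
  obtain P Q where P: "\<And>t. p t = poly P t" and Q: "\<And>t. q t = poly Q t"
    using * assms(1,2) by metis
  have "P * Q = 1"
    by (rule poly_eq_poly_eq_iff[THEN iffD1]) (auto simp: fun_eq_iff pq simp flip: P Q)
  then have "degree P = 0"
    by (metis dvdI is_unit_iff_degree mult_zero_left zero_neq_one)
  then obtain c where "P = [:c:]" by (rule degree_eq_zeroE)
  then show ?thesis using P by simp
qed

text \<open>The properties of the Baker-Campbell-Hausdorff product on which the analysis rests. The
  right-hand laws follow from the left-hand ones because inversion is the involution X ->
  -X.\<close>

locale polynomial_group =
  fixes m :: "'a::euclidean_space \<Rightarrow> 'a \<Rightarrow> 'a"
  assumes polynomial: "polynomial_function (\<lambda>p. m (fst p) (snd p))"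
    and assoc: "m (m X Y) Z = m X (m Y Z)"
    and left_zero [simp]: "m 0 X = X"
    and left_inverse [simp]: "m (- X) X = 0"
begin

lemma right_inverse [simp]: "m X (- X) = 0"
  using left_inverse[of "- X"] by simp

lemma right_zero [simp]: "m X 0 = X"
  using assoc[of X "- X" X] by simp

lemma cancel_left [simp]: "m (- X) (m X Y) = Y" "m X (m (- X) Y) = Y"
  by (simp_all flip: assoc)

lemma cancel_right [simp]: "m (m X (- Y)) Y = X" "m (m X Y) (- Y) = X"
  by (simp_all add: assoc)

lemma inverse_unique: "m X Y = 0 \<Longrightarrow> Y = - X"
  using cancel_left(1)[of X Y] by simp

lemma inverse_mult: "- (m X Y) = m (- Y) (- X)"
  by (rule inverse_unique[symmetric]) (simp add: assoc)

lemma polynomial_mult [poly_intros]: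
  assumes "polynomial_function f" "polynomial_function g"
  shows "polynomial_function (\<lambda>x. m (f x) (g x))"
  using polynomial_function_compose[OF polynomial_function_Pair[OF assms] polynomial]
  by (simp add: o_def)

lemma continuous_mult: "continuous_on UNIV (m X)"
  by (intro continuous_on_polymonial_function poly_intros)

lemma mult_measurable [measurable]: "m X \<in> borel_measurable borel"
  by (intro borel_measurable_continuous_onI continuous_mult)

text \<open>The Jacobian of a left translation is a polynomial with polynomial inverse along every line
  through the unit, hence constant.\<close>

lemma lborel_distr_mult: "distr lborel borel (m X) = lborel"
proof -
  have "\<forall>b. \<exists>D. (\<forall>p. ((\<lambda>p. m (fst p) (snd p) \<bullet> b) has_derivative D p) (at p)) \<and>
      (\<forall>h. real_polynomial_function (\<lambda>p. D p h))"
    using real_polynomial_function_has_derivative polynomial_function_component[OF polynomial] by blast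
  then obtain E where E: "\<And>b p. ((\<lambda>p. m (fst p) (snd p) \<bullet> b) has_derivative E b p) (at p)"
    and Ep: "\<And>b h. real_polynomial_function (\<lambda>p. E b p h)" by metis
  define D where "D X Y h = (\<Sum>b\<in>Basis. E b (X, Y) (0, h) *\<^sub>R b)" for X Y h
  have D: "(m X has_derivative D X Y) (at Y)" for X Y
  proof -
    have "((\<lambda>Y. m X Y \<bullet> b) has_derivative (\<lambda>h. E b (X, Y) (0, h))) (at Y)" for b
      by (rule has_derivative_compose[of "\<lambda>Y. (X, Y)" "\<lambda>h. (0, h)", OF _ E, simplified])
         (auto intro!: derivative_eq_intros)
    then show ?thesis
      by (subst has_derivative_componentwise_within) (simp add: D_def inner_sum_left_Basis)
  qed
  define J where "J X Y = det (matrix (\<lambda>v. to_coords (D X Y (from_coords v))))" for X Y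
  \<comment> \<open>Left translation by -X undoes that by X. By the chain rule the reciprocal
    Jacobian is thus the Jacobian of another left translation, which is again polynomial.\<close>
  have J1: "J (- X) (m X Y) * J X Y = 1" for X Y
  proof -
    let ?l = "\<lambda>X Y v. to_coords (D X Y (from_coords v))"
    have lin: "linear (?l X Y)" for X Y
      using bounded_linear_compose[OF bounded_linear_to_coords
          bounded_linear_compose[OF has_derivative_bounded_linear[OF D[of X Y]] bounded_linear_from_coords]]
      by (rule bounded_linear.linear)
    have "((\<lambda>Y. m (- X) (m X Y)) has_derivative (\<lambda>h. D (- X) (m X Y) (D X Y h))) (at Y)"
      by (rule has_derivative_compose[OF D D])
    then have "((\<lambda>Y. Y) has_derivative (\<lambda>h. D (- X) (m X Y) (D X Y h))) (at Y)"
      by simp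
    then have "(\<lambda>h. D (- X) (m X Y) (D X Y h)) = (\<lambda>h. h)"
      by (rule has_derivative_unique[OF _ has_derivative_ident])
    then have "?l (- X) (m X Y) \<circ> ?l X Y = id"
      by (auto simp: fun_eq_iff dest: fun_cong)
    then have "matrix (?l (- X) (m X Y)) ** matrix (?l X Y) = mat 1"
      using matrix_compose[OF lin lin, of "- X" "m X Y" X Y] by (simp add: matrix_id_mat_1)
    then show ?thesis
      unfolding J_def by (metis det_I det_mul)
  qed
  have entry: "matrix (\<lambda>v. to_coords (D X Y (from_coords v))) $ i $ j =
      E (basis_vector i) (X, Y) (0, from_coords (axis j 1))" for X Y i j
  proof -
    have "D X Y h \<bullet> basis_vector i = E (basis_vector i) (X, Y) (0, h)" for h
      by (simp add: D_def basis_vector_Basis)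
    then show ?thesis by (simp add: matrix_def to_coords_def)
  qed
  have Jp: "real_polynomial_function (\<lambda>t. J (f t) (g t))"
    if "polynomial_function f" "polynomial_function g" for f g :: "real \<Rightarrow> 'a"
  proof -
    have "real_polynomial_function (\<lambda>t. E b (f t, g t) h)" for b h
      using real_polynomial_function_compose[OF polynomial_function_Pair[OF that] Ep] by (simp add: o_def)
    then show ?thesis
      unfolding J_def det_def entry
      by (intro real_polynomial_function_sum real_polynomial_function.intros(2,4) real_polynomial_function_prod)
         (auto intro: finite_permutations)
  qed
  have "J X Y = 1" for X Y
  proof -
    have s: "polynomial_function (\<lambda>t::real. t *\<^sub>R Z)" for Z :: 'a
      by (intro polynomial_function_bounded_linear bounded_linear_scaleR_left)
    have "J (1 *\<^sub>R X) Y = J (0 *\<^sub>R X) Y"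
    proof (rule real_polynomial_function_unit[where p="\<lambda>t. J (t *\<^sub>R X) Y" and q="\<lambda>t. J (- (t *\<^sub>R X)) (m (t *\<^sub>R X) Y)"])
      show "J (t *\<^sub>R X) Y * J (- (t *\<^sub>R X)) (m (t *\<^sub>R X) Y) = 1" for t
        using J1[of "t *\<^sub>R X" Y] by (simp add: mult.commute)
    qed (intro Jp poly_intros s)+
    moreover have "J 0 Y = 1"
    proof -
      have "m 0 = (\<lambda>Y. Y)" by auto
      then have "((\<lambda>Y. Y) has_derivative D 0 Y) (at Y)"
        using D[of 0 Y] by simp
      then have "D 0 Y = (\<lambda>h. h)"
        by (rule has_derivative_unique[OF _ has_derivative_ident])
      then show ?thesis by (simp add: J_def matrix_id_mat_1[unfolded id_def])
    qed
    ultimately show ?thesis by simp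
  qed
  \<comment> \<open>The change of variables lemma yields the image measure under the inverse of the
    differentiated map, so it is applied with the translation by -X.\<close>
  then show ?thesis
    by (intro lborel_distr_unimodular[where f="m (- X)" and f'="D (- X)"] D continuous_mult) (auto simp: J_def)
qed

lemma integral_left_mult:
  fixes f :: "'a \<Rightarrow> complex"
  assumes [measurable]: "f \<in> borel_measurable borel"
  shows "(LINT Y|lborel. f (m X Y)) = (LINT Y|lborel. f Y)"
  by (subst (2) lborel_distr_mult[of X, symmetric]) (simp add: integral_distr)

text \<open>\<open>m (- Y) X\<close> is the negative of \<open>m (- X) Y\<close>, so the
  substitution is a left translation followed by a reflection, and both preserve Lebesgue
  measure.\<close>

lemma integral_uminus_mult:
  fixes f :: "'a \<Rightarrow> complex"
  assumes [measurable]: "f \<in> borel_measurable borel"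
  shows "(LINT Y|lborel. f (m (- Y) X)) = (LINT Y|lborel. f Y)"
proof -
  have "(LINT Y|lborel. f Y) = (LINT Y|lborel. f (- Y))"
    by (subst (1) lborel_distr_uminus_euclidean[symmetric]) (simp add: integral_distr)
  also have "\<dots> = (LINT Y|lborel. f (- m (- X) Y))"
    by (rule integral_left_mult[symmetric]) measurable
  finally show ?thesis by (simp add: inverse_mult)
qed

lemma integral_mult_uminus:
  fixes f :: "'a \<Rightarrow> complex"
  assumes [measurable]: "f \<in> borel_measurable borel"
  shows "(LINT Y|lborel. f (m X (- Y))) = (LINT Y|lborel. f Y)"
proof -
  have "(LINT Y|lborel. f (m X (- Y))) = (LINT Y|distr lborel borel uminus. f (m X Y))"
    by (simp add: integral_distr)
  then show ?thesis
    by (simp add: lborel_distr_uminus_euclidean integral_left_mult)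
qed

end

section \<open>The Baker-Campbell-Hausdorff product\<close>

context nilpotent_lie_algebra
begin

lemma polynomial_lie:
  assumes "polynomial_function f" "polynomial_function g"
  shows "polynomial_function (\<lambda>p. lie (f p) (g p))"
proof -
  have "lie x y = (\<Sum>(b, c)\<in>Basis \<times> Basis. ((x \<bullet> b) * (y \<bullet> c)) *\<^sub>R lie b c)" for x y
  proof -
    have "lie x y = lie (\<Sum>b\<in>Basis. (x \<bullet> b) *\<^sub>R b) (\<Sum>c\<in>Basis. (y \<bullet> c) *\<^sub>R c)"
      by (simp add: euclidean_representation)
    also have "\<dots> = (\<Sum>(b, c)\<in>Basis \<times> Basis. lie ((x \<bullet> b) *\<^sub>R b) ((y \<bullet> c) *\<^sub>R c))"
      by (rule bilinear_sum[OF bilinear])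
    finally show ?thesis
      by (simp add: bilinear_lmul[OF bilinear] bilinear_rmul[OF bilinear] split_def mult_ac)
  qed
  then have eq: "(\<lambda>p. lie (f p) (g p)) = (\<lambda>p. \<Sum>(b, c)\<in>Basis \<times> Basis. ((f p \<bullet> b) * (g p \<bullet> c)) *\<^sub>R lie b c)"
    by (intro ext)
  have "polynomial_function (\<lambda>p. (f p \<bullet> b) * (g p \<bullet> c))" for b c
    unfolding real_polynomial_function_eq[symmetric]
    by (intro real_polynomial_function.intros(4) polynomial_function_component assms)
  then show ?thesis
    unfolding eq split_def
    by (intro polynomial_function_sum polynomial_function_mult polynomial_function_const finite_cartesian_product
        finite_Basis)
qed

lemma polynomial_nested_bracket:
  assumes "\<forall>f\<in>set fs. polynomial_function f"
  shows "polynomial_function (\<lambda>p. nested_bracket lie (map (\<lambda>f. f p) fs))"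
  using assms by (induction fs rule: induct_list012) (auto intro: polynomial_lie)

lemma polynomial_bch: "polynomial_function (\<lambda>p. bch lie (fst p) (snd p))"
proof -
  \<comment> \<open>The entries of each bracket become projections evaluated at p, so that the
    induction over a list of polynomial functions applies.\<close>
  have *: "concat (map (\<lambda>(r, s). replicate r (fst p) @ replicate s (snd p)) ps) =
      map (\<lambda>f. f p) (concat (map (\<lambda>(r, s). replicate r fst @ replicate s snd) ps))"
    for p :: "'a \<times> 'a" and ps
    by (induction ps) auto
  have "polynomial_function (\<lambda>p :: 'a \<times> 'a. nested_bracket lie
      (concat (map (\<lambda>(r, s). replicate r (fst p) @ replicate s (snd p)) ps)))" for ps
    unfolding * by (rule polynomial_nested_bracket) (auto intro: poly_intros)
  then show ?thesis
    unfolding bch_def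
    \<comment> \<open>A sum over an infinite index set is 0 by convention and so polynomial as
      well.\<close>
    by (cases "finite (dynkin_indices (nilpotency_class lie))")
       (auto intro!: polynomial_function_sum polynomial_function_cmul)
qed

lemma nested_bracket_multiples:
  assumes "set Ys \<subseteq> {X, - X}" "2 \<le> length Ys"
  shows "nested_bracket lie Ys = 0"
proof -
  \<comment> \<open>The induction must also carry along that the tail is a multiple of X: this is
    why bracketing it with one more entry gives 0.\<close>
  have "(\<exists>c. nested_bracket lie Ys = c *\<^sub>R X) \<and> (2 \<le> length Ys \<longrightarrow> nested_bracket lie Ys = 0)"
    using assms(1)
  proof (induction Ys rule: induct_list012)
    case 1
    then show ?case by (auto intro: exI[of _ 0])
  next
    case (2 Y)
    then show ?case by (auto intro: exI[of _ 1] exI[of _ "-1"])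
  next
    case (3 A B Zs)
    then obtain c where c: "nested_bracket lie (B # Zs) = c *\<^sub>R X" by auto
    have "lie A (c *\<^sub>R X) = 0"
      using 3(3) by (auto simp: bilinear_rmul[OF bilinear] bilinear_lneg[OF bilinear] alternating)
    then show ?case using c by (auto intro: exI[of _ 0])
  qed
  then show ?thesis using assms(2) by blast
qed

lemma dynkin_index_sum_1:
  assumes "ps \<in> dynkin_indices N" "(\<Sum>(r, s)\<leftarrow>ps. r + s) = 1"
  shows "ps = [(1, 0)] \<or> ps = [(0, 1)]"
proof -
  obtain r s qs where ps: "ps = (r, s) # qs" "0 < r + s"
    using assms(1) by (cases ps) (auto simp: dynkin_indices_def)
  have "qs = []"
  proof (rule ccontr)
    assume "qs \<noteq> []"
    then obtain r' s' qs' where "qs = (r', s') # qs'" by (metis list.exhaust prod.exhaust)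
    then show False using ps assms by (auto simp: dynkin_indices_def)
  qed
  then show ?thesis using ps assms(2) by auto
qed

text \<open>All entries of the brackets are X or -X, so brackets with at least two entries vanish;
  only the two linear terms remain, and they cancel.\<close>

lemma bch_minus: "bch lie X (- X) = 0"
proof -
  let ?N = "nilpotency_class lie"
  let ?f = "\<lambda>ps. ((-1) ^ (length ps - 1) /
           (real (length ps) * real (\<Sum>(r, s)\<leftarrow>ps. r + s) * (\<Prod>(r, s)\<leftarrow>ps. fact r * fact s)))
        *\<^sub>R nested_bracket lie (concat (map (\<lambda>(r, s). replicate r X @ replicate s (- X)) ps))"
  let ?S = "dynkin_indices ?N \<inter> {[(1, 0)], [(0, 1)]}"
  have zero: "?f ps = 0" if "ps \<in> dynkin_indices ?N - ?S" for ps
  proof -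
    have len: "length (concat (map (\<lambda>(r, s). replicate r X @ replicate s (- X)) qs)) = (\<Sum>(r, s)\<leftarrow>qs. r + s)" for qs
      by (induction qs) auto
    have "set (concat (map (\<lambda>(r, s). replicate r X @ replicate s (- X)) ps)) \<subseteq> {X, - X}"
      by auto
    moreover have "(\<Sum>(r, s)\<leftarrow>ps. r + s) \<noteq> 0"
      using that by (cases ps) (auto simp: dynkin_indices_def)
    moreover have "(\<Sum>(r, s)\<leftarrow>ps. r + s) \<noteq> 1"
      using that dynkin_index_sum_1[of ps ?N] by auto
    ultimately have "nested_bracket lie (concat (map (\<lambda>(r, s). replicate r X @ replicate s (- X)) ps)) = 0"
      using nested_bracket_multiples[of "concat (map (\<lambda>(r, s). replicate r X @ replicate s (- X)) ps)" X]
      unfolding len by linarith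
    then show ?thesis by (simp only: scaleR_zero_right)
  qed
  show ?thesis
  proof (cases "finite (dynkin_indices ?N)")
    case True
    have "bch lie X (- X) = (\<Sum>ps\<in>?S. ?f ps)"
      unfolding bch_def using True zero by (intro sum.mono_neutral_right) auto
    \<comment> \<open>For class 0 the cutoff removes the linear terms as well, and the sum is
      empty.\<close>
    also have "?S = (if 1 \<le> ?N then {[(1, 0)], [(0, 1)]} else {})"
      by (auto simp: dynkin_indices_def)
    also have "(\<Sum>ps\<in>\<dots>. ?f ps) = 0"
      by auto
    finally show ?thesis .
  next
    case False
    then show ?thesis by (simp add: bch_def)
  qed
qed

end

lemma (in nilpotent_lie_group) log_mult_eq_bch: "log_mult G Exp = bch lie"
proof (intro ext)
  fix X Y
  have "inj Exp" using Exp_bij by (rule bij_betw_imp_inj_on)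
  then show "log_mult G Exp X Y = bch lie X Y"
    by (simp add: log_mult_def Exp_mult)
qed

text \<open>Associativity and the unit law are not read off the series but pulled back from the
  group through the injection \<open>Exp\<close>; \<open>Exp 0\<close> is the unit because it is
  idempotent.\<close>

lemma (in nilpotent_lie_group) polynomial_group_log_mult: "polynomial_group (log_mult G Exp)"
proof -
  have inj: "Exp X = Exp Y \<Longrightarrow> X = Y" for X Y
    using bij_betw_imp_inj_on[OF Exp_bij] by (auto dest: injD)
  have car: "Exp X \<in> carrier G" for X
    using bij_betwE[OF Exp_bij] by auto
  have "Exp 0 \<otimes> Exp 0 = Exp 0"
    using bch_minus[of 0] by (simp add: Exp_mult)
  then have E0: "Exp 0 = \<one>"
    using car[of 0] l_cancel_one by blast
  show ?thesis
    unfolding log_mult_eq_bch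
  proof
    show "polynomial_function (\<lambda>p. bch lie (fst p) (snd p))" by (rule polynomial_bch)
    show "bch lie (bch lie X Y) Z = bch lie X (bch lie Y Z)" for X Y Z
      by (rule inj) (simp add: m_assoc car flip: Exp_mult)
    show "bch lie 0 X = X" for X
      by (rule inj) (simp add: E0 car flip: Exp_mult)
    show "bch lie (- X) X = 0" for X
      using bch_minus[of "- X"] by simp
  qed
qed

section \<open>The scalar products\<close>

text \<open>The graph map x -> (x, \<Phi> x) has the left inverse \<open>fst\<close> for every
  polynomial map \<Phi>; the factor f provides the decay that the composition of u with \<Phi> may
  lack.\<close>

lemma schwartz_mult_comp:
  assumes "f \<in> schwartz" "u \<in> schwartz" "polynomial_function \<Phi>"
  shows "(\<lambda>x. f x * u (\<Phi> x)) \<in> schwartz"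
proof -
  have "(\<lambda>x. (\<lambda>z. f (fst z) * u (snd z)) (x, \<Phi> x)) \<in> schwartz"
    by (rule schwartz_comp[OF schwartz_tensor[OF assms(1,2)], of _ fst]) (auto intro!: poly_intros assms(3))
  then show ?thesis by simp
qed

lemma schwartz_diff:
  assumes "f \<in> schwartz" "g \<in> schwartz" shows "(\<lambda>x. f x - g x) \<in> schwartz"
  using schwartz_add[OF assms(1) schwartz_mult_const[OF assms(2), of "-1"]] by simp

lemma l2_inner_commute: "l2_inner M v u = cnj (l2_inner M u v)"
  unfolding l2_inner_def Bochner_Integration.integral_cnj[symmetric] by (simp add: mult.commute)

lemma l2_inner_mult_left: "l2_inner M (\<lambda>x. c * u x) v = c * l2_inner M u v"
  by (simp add: l2_inner_def mult.assoc)

lemma l2_inner_mult_right: "l2_inner M u (\<lambda>x. c * v x) = cnj c * l2_inner M u v"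
  by (simp add: l2_inner_def mult.left_commute)

lemma schwartz_inner_integrable:
  assumes "u \<in> schwartz" "v \<in> schwartz" shows "integrable lborel (\<lambda>x. u x * cnj (v x))"
  by (intro schwartz_integrable schwartz_mult schwartz_cnj assms)

text \<open>Testing against u - v shows that the difference has square integral 0. It vanishes
  almost everywhere, and then everywhere because its zero set is closed.\<close>

lemma schwartz_eqI:
  fixes u v :: "'e::euclidean_space \<Rightarrow> complex"
  assumes u: "u \<in> schwartz" and v: "v \<in> schwartz"
    and eq: "\<And>w. w \<in> schwartz \<Longrightarrow> l2_inner lborel u w = l2_inner lborel v w"
  shows "u = v"
proof -
  let ?d = "\<lambda>x. u x - v x"
  have d: "?d \<in> schwartz" by (rule schwartz_diff[OF u v])
  have "(LINT x|lborel. u x * cnj (?d x) - v x * cnj (?d x)) = 0"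
    using eq[OF d] unfolding l2_inner_def
    by (subst Bochner_Integration.integral_diff[OF schwartz_inner_integrable[OF u d] schwartz_inner_integrable[OF v d]]) simp
  moreover have "u x * cnj (?d x) - v x * cnj (?d x) = of_real ((norm (?d x))\<^sup>2)" for x
    by (metis complex_norm_square left_diff_distrib of_real_power)
  ultimately have "(LINT x|lborel. complex_of_real ((norm (?d x))\<^sup>2)) = 0"
    by simp
  then have 0: "(LINT x|lborel. (norm (?d x))\<^sup>2) = 0"
    by (simp only: integral_complex_of_real of_real_eq_0_iff)
  have "complex_integrable lborel (\<lambda>x. of_real ((norm (?d x))\<^sup>2))"
    using schwartz_inner_integrable[OF d d] by (simp only: complex_norm_square)
  then have "integrable lborel (\<lambda>x. (norm (?d x))\<^sup>2)"
    by (simp only: complex_of_real_integrable_eq)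
  then have "AE x in lborel. (norm (?d x))\<^sup>2 = 0"
    using 0 by (subst (asm) integral_nonneg_eq_0_iff_AE) auto
  then have "AE x in lebesgue. x \<in> {x. ?d x = 0}"
    by (auto intro: AE_completion)
  moreover have "closed {x. ?d x = 0}"
    by (intro closed_Collect_eq schwartz_continuous d continuous_on_const)
  ultimately have "?d x = 0" for x
    using mem_closed_if_AE_lebesgue[of "{x. ?d x = 0}" x] by blast
  then show ?thesis by auto
qed

text \<open>The normalising constant of the dual measure as a complex number; it depends on the
  space only through its dimension, hence the type argument.\<close>

definition dual_factor :: "'a::euclidean_space itself \<Rightarrow> complex" where
  "dual_factor _ = of_real (1 / (2 * pi) ^ DIM('a))"

lemma dual_factor_inverse: "dual_factor TYPE('a::euclidean_space) * of_real ((2 * pi) ^ DIM('a)) = 1"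
  unfolding dual_factor_def of_real_mult[symmetric] by simp

lemma cnj_dual_factor [simp]: "cnj (dual_factor T) = dual_factor T"
  by (simp add: dual_factor_def)

lemma integral_dual_lebesgue:
  fixes f :: "'a::euclidean_space \<Rightarrow> complex"
  assumes "f \<in> borel_measurable borel"
  shows "(LINT \<xi>|dual_lebesgue. f \<xi>) = dual_factor TYPE('a) * (LINT \<xi>|lborel. f \<xi>)"
  unfolding dual_lebesgue_def dual_factor_def
  using assms by (subst integral_density) (auto simp: scaleR_conv_of_real)

lemma Xi_lebesgue_eq:
  "(Xi_lebesgue :: ('a::euclidean_space \<times> 'a) measure) = density lborel (\<lambda>_. ennreal (1 / (2 * pi) ^ DIM('a)))"
proof -
  let ?c = "ennreal (1 / (2 * pi) ^ DIM('a))"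
  have "sigma_finite_measure (density lborel (\<lambda>_::'a. ?c))"
    by (subst sigma_finite_measure.sigma_finite_iff_density_finite'[OF sigma_finite_lborel]) auto
  then have "density (lborel :: 'a measure) (\<lambda>_. 1) \<Otimes>\<^sub>M density (lborel :: 'a measure) (\<lambda>_. ?c) =
      density (lborel \<Otimes>\<^sub>M lborel) (\<lambda>(x, y). 1 * ?c)"
    by (intro pair_measure_density lborel.sigma_finite_measure_axioms) auto
  then show ?thesis
    by (simp add: Xi_lebesgue_def dual_lebesgue_def density_1 lborel_prod split_def)
qed

lemma integral_Xi_lebesgue:
  fixes f :: "'a::euclidean_space \<times> 'a \<Rightarrow> complex"
  assumes "f \<in> borel_measurable borel"
  shows "(LINT z|Xi_lebesgue. f z) = dual_factor TYPE('a) * (LINT z|lborel. f z)"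
  unfolding Xi_lebesgue_eq dual_factor_def
  using assms by (subst integral_density) (auto simp: scaleR_conv_of_real)

section \<open>Kernels and symbols\<close>

context polynomial_group
begin

definition kernel :: "('a \<times> 'a \<Rightarrow> complex) \<Rightarrow> 'a \<times> 'a \<Rightarrow> complex" where
  "kernel f = (\<lambda>p. dual_factor TYPE('a) * partial_fourier f (fst p, m (fst p) (- snd p)))"

text \<open>Inverse of \<open>kernel\<close>: solving \<open>W = m X (- Y)\<close> for Y gives
  \<open>m (- W) X\<close>, and the sign of the frequency turns \<open>partial_fourier\<close> into
  the direct transform.\<close>

definition symbol :: "('a \<times> 'a \<Rightarrow> complex) \<Rightarrow> 'a \<times> 'a \<Rightarrow> complex" where
  "symbol K = (\<lambda>p. partial_fourier (\<lambda>q. K (fst q, m (- snd q) (fst q))) (fst p, - snd p))"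

lemma kernel_schwartz:
  assumes "f \<in> schwartz" shows "kernel f \<in> schwartz"
  unfolding kernel_def
  by (intro schwartz_mult_const
      schwartz_comp[OF partial_fourier_schwartz[OF assms], of _ "\<lambda>q. (fst q, m (- snd q) (fst q))"])
     (auto intro!: poly_intros simp: inverse_mult)

lemma twist_schwartz:
  assumes "K \<in> schwartz" shows "(\<lambda>q. K (fst q, m (- snd q) (fst q))) \<in> schwartz"
  by (rule schwartz_comp[OF assms, of _ "\<lambda>p. (fst p, m (fst p) (- snd p))"])
     (auto intro!: poly_intros simp: inverse_mult)

lemma symbol_schwartz:
  assumes "K \<in> schwartz" shows "symbol K \<in> schwartz"
  unfolding symbol_def
  by (rule schwartz_comp[OF partial_fourier_schwartz[OF twist_schwartz[OF assms]], of _ "\<lambda>p. (fst p, - snd p)"])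
     (auto intro!: poly_intros)

lemma kernel_symbol:
  assumes "K \<in> schwartz" shows "kernel (symbol K) = K"
proof (rule ext, safe)
  fix X Y
  let ?V = "m X (- Y)"
  have s: "(\<lambda>W. K (X, m (- W) X)) \<in> schwartz"
    using schwartz_slice[OF twist_schwartz[OF assms], of X] by simp
  have "kernel (symbol K) (X, Y) = dual_factor TYPE('a) *
      (LINT \<xi>|lborel. cis (\<xi> \<bullet> ?V) * (LINT W|lborel. cis (- (\<xi> \<bullet> W)) * K (X, m (- W) X)))"
    by (simp add: kernel_def symbol_def partial_fourier_def inner_commute)
  also have "\<dots> = dual_factor TYPE('a) * (of_real ((2 * pi) ^ DIM('a)) * K (X, m (- ?V) X))"
    by (simp only: fourier_inversion'[OF s])
  also have "\<dots> = K (X, Y)"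
    unfolding mult.assoc[symmetric] dual_factor_inverse by (simp add: inverse_mult)
  finally show "kernel (symbol K) (X, Y) = K (X, Y)" .
qed

lemma kernel_inject:
  assumes f: "f \<in> schwartz" and g: "g \<in> schwartz" and eq: "kernel f = kernel g"
  shows "f = g"
proof (rule ext, safe)
  fix X \<xi>
  have "partial_fourier f (X, W) = partial_fourier g (X, W)" for W
  proof -
    have "dual_factor TYPE('a) \<noteq> 0"
      using dual_factor_inverse[where 'a='a] by auto
    then show ?thesis
      using fun_cong[OF eq, of "(X, m (- W) X)"] by (simp add: kernel_def inverse_mult)
  qed
  then have "fourier (\<lambda>y. f (X, y)) = fourier (\<lambda>y. g (X, y))"
    by (simp add: partial_fourier_slice fun_eq_iff)
  then have "of_real ((2 * pi) ^ DIM('a)) * f (X, \<xi>) = of_real ((2 * pi) ^ DIM('a)) * g (X, \<xi>)"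
    using fourier_inversion[OF schwartz_slice[OF f, of X], of \<xi>] fourier_inversion[OF schwartz_slice[OF g, of X], of \<xi>]
    by simp
  then show "f (X, \<xi>) = g (X, \<xi>)" by simp
qed

lemma Op_eq_kernel:
  assumes f: "f \<in> schwartz"
  shows "Op m f u X = (LINT Y|lborel. kernel f (X, Y) * u Y)"
proof -
  have eq: "(LINT \<xi>|dual_lebesgue. cis (m X (- Y) \<bullet> \<xi>) * f (X, \<xi>) * u Y) = kernel f (X, Y) * u Y" for Y
    using schwartz_measurable[OF schwartz_slice_cis[OF f, of "m X (- Y)" X]]
    by (simp add: integral_dual_lebesgue kernel_def partial_fourier_def)
  show ?thesis unfolding Op_def eq ..
qed

text \<open>The adjoint of \<open>Op m f\<close>, given by the conjugate transposed kernel so that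
  it acts on functions without passing through an adjoint symbol.\<close>

definition adj_op :: "('a \<times> 'a \<Rightarrow> complex) \<Rightarrow> ('a \<Rightarrow> complex) \<Rightarrow> 'a \<Rightarrow> complex" where
  "adj_op f v Y = (LINT X|lborel. cnj (kernel f (X, Y)) * v X)"

lemma kernel_mult_schwartz:
  assumes "f \<in> schwartz" "u \<in> schwartz" "polynomial_function \<Phi>"
  shows "(\<lambda>p. kernel f p * u (\<Phi> p)) \<in> schwartz"
  by (rule schwartz_mult_comp[OF kernel_schwartz[OF assms(1)] assms(2,3)])

lemma Op_schwartz:
  assumes "f \<in> schwartz" "u \<in> schwartz" shows "Op m f u \<in> schwartz"
proof -
  have "(\<lambda>p. kernel f p * u (snd p)) \<in> schwartz"
    by (intro kernel_mult_schwartz assms poly_intros)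
  from schwartz_integral[OF this] have "(\<lambda>X. LINT Y|lborel. kernel f (X, Y) * u Y) \<in> schwartz"
    by simp
  moreover have "Op m f u = (\<lambda>X. LINT Y|lborel. kernel f (X, Y) * u Y)"
    by (rule ext) (rule Op_eq_kernel[OF assms(1)])
  ultimately show ?thesis by simp
qed

lemma adj_op_schwartz:
  assumes "f \<in> schwartz" "v \<in> schwartz" shows "adj_op f v \<in> schwartz"
proof -
  have "(\<lambda>p. cnj (kernel f p)) \<in> schwartz"
    by (intro schwartz_cnj kernel_schwartz assms)
  then have "(\<lambda>p. cnj (kernel f (snd p, fst p))) \<in> schwartz"
    by (rule schwartz_comp[of _ _ "\<lambda>p. (snd p, fst p)"]) (auto intro!: poly_intros)
  then have "(\<lambda>p. cnj (kernel f (snd p, fst p)) * v (snd p)) \<in> schwartz"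
    by (intro schwartz_mult_comp assms poly_intros)
  from schwartz_integral[OF this] show ?thesis
    by (simp add: adj_op_def[abs_def])
qed

text \<open>Two evaluations of one absolutely convergent double integral: over pairs it is a pairing
  of kernels, in the reversed order it exhibits the adjoint.\<close>

lemma Op_inner_kernel:
  assumes f: "f \<in> schwartz" and u: "u \<in> schwartz" and v: "v \<in> schwartz"
  shows "l2_inner lborel (Op m f u) v = l2_inner lborel (kernel f) (\<lambda>p. v (fst p) * cnj (u (snd p)))"
    and "l2_inner lborel (Op m f u) v = l2_inner lborel u (adj_op f v)"
proof -
  have "(\<lambda>p. kernel f p * u (snd p) * (\<lambda>x. cnj (v x)) (fst p)) \<in> schwartz"
    by (intro schwartz_mult_comp kernel_schwartz schwartz_cnj f u v poly_intros)
  then have i: "integrable lborel (\<lambda>p. kernel f p * u (snd p) * cnj (v (fst p)))"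
    by (rule schwartz_integrable)
  have 1: "l2_inner lborel (Op m f u) v = (LINT X|lborel. LINT Y|lborel. kernel f (X, Y) * u Y * cnj (v X))"
    by (simp add: l2_inner_def Op_eq_kernel[OF f])
  then show "l2_inner lborel (Op m f u) v = l2_inner lborel (kernel f) (\<lambda>p. v (fst p) * cnj (u (snd p)))"
    using lborel_integral_fst[OF i] by (simp add: l2_inner_def mult_ac)
  have "(LINT X|lborel. LINT Y|lborel. kernel f (X, Y) * u Y * cnj (v X)) =
      (LINT Y|lborel. LINT X|lborel. kernel f (X, Y) * u Y * cnj (v X))"
    using lborel_integral_fst[OF i] lborel_integral_snd[OF i] by simp
  also have "\<dots> = l2_inner lborel u (adj_op f v)"
    unfolding l2_inner_def adj_op_def Bochner_Integration.integral_cnj[symmetric]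
    by (simp add: mult_ac flip: integral_mult_right_zero)
  finally show "l2_inner lborel (Op m f u) v = l2_inner lborel u (adj_op f v)"
    using 1 by simp
qed

text \<open>Parseval in the frequency variable, then the measure preserving substitution
  \<open>W = m X (- Y)\<close>. The factor from \<open>Xi_lebesgue\<close> and the one from Parseval
  are exactly those of the two kernels.\<close>

lemma kernel_isometry:
  assumes f: "f \<in> schwartz" and g: "g \<in> schwartz"
  shows "l2_inner Xi_lebesgue f g = l2_inner lborel (kernel f) (kernel g)"
proof -
  let ?c = "dual_factor TYPE('a)"
  have fg: "(\<lambda>z. f z * cnj (g z)) \<in> schwartz"
    by (intro schwartz_mult schwartz_cnj f g)
  have kfg: "(\<lambda>z. kernel f z * cnj (kernel g z)) \<in> schwartz"
    by (intro schwartz_mult schwartz_cnj kernel_schwartz f g)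
  have inner: "(LINT \<xi>|lborel. f (X, \<xi>) * cnj (g (X, \<xi>))) =
      ?c * (LINT Y|lborel. partial_fourier f (X, m X (- Y)) * cnj (partial_fourier g (X, m X (- Y))))" for X
  proof -
    have [measurable]: "(\<lambda>W. partial_fourier f (X, W)) \<in> borel_measurable borel"
      "(\<lambda>W. partial_fourier g (X, W)) \<in> borel_measurable borel"
      by (intro schwartz_measurable schwartz_slice partial_fourier_schwartz f g)+
    have "(LINT Y|lborel. partial_fourier f (X, m X (- Y)) * cnj (partial_fourier g (X, m X (- Y)))) =
        (LINT W|lborel. partial_fourier f (X, W) * cnj (partial_fourier g (X, W)))"
      by (rule integral_mult_uminus) measurable
    also have "\<dots> = of_real ((2 * pi) ^ DIM('a)) * (LINT \<xi>|lborel. f (X, \<xi>) * cnj (g (X, \<xi>)))"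
      unfolding partial_fourier_slice by (rule parseval[OF schwartz_slice[OF f] schwartz_slice[OF g]])
    finally show ?thesis
      by (simp only: mult.assoc[symmetric] dual_factor_inverse mult_1)
  qed
  have "l2_inner Xi_lebesgue f g = ?c * (LINT z|lborel. f z * cnj (g z))"
    unfolding l2_inner_def by (rule integral_Xi_lebesgue[OF schwartz_measurable[OF fg]])
  also have "\<dots> = ?c * (LINT X|lborel. LINT \<xi>|lborel. f (X, \<xi>) * cnj (g (X, \<xi>)))"
    by (simp only: lborel_integral_fst[OF schwartz_integrable[OF fg]])
  also have "\<dots> = (LINT X|lborel. LINT Y|lborel. kernel f (X, Y) * cnj (kernel g (X, Y)))"
    unfolding inner by (simp add: kernel_def mult_ac flip: integral_mult_right_zero)
  also have "\<dots> = l2_inner lborel (kernel f) (kernel g)"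
    unfolding l2_inner_def by (rule lborel_integral_fst[OF schwartz_integrable[OF kfg]])
  finally show ?thesis .
qed

end

section \<open>Rank one symbols\<close>

context polynomial_group
begin

definition rank_one :: "('a \<Rightarrow> complex) \<Rightarrow> ('a \<Rightarrow> complex) \<Rightarrow> 'a \<times> 'a \<Rightarrow> complex" where
  "rank_one u v = symbol (\<lambda>p. v (fst p) * cnj (u (snd p)))"

lemma rank_one_schwartz:
  assumes "u \<in> schwartz" "v \<in> schwartz" shows "rank_one u v \<in> schwartz"
  unfolding rank_one_def by (intro symbol_schwartz schwartz_tensor schwartz_cnj assms)

lemma kernel_rank_one:
  assumes "u \<in> schwartz" "v \<in> schwartz" shows "kernel (rank_one u v) = (\<lambda>p. v (fst p) * cnj (u (snd p)))"
  unfolding rank_one_def by (intro kernel_symbol schwartz_tensor schwartz_cnj assms)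

lemma Op_rank_one:
  assumes "u \<in> schwartz" "v \<in> schwartz"
  shows "Op m (rank_one u v) a = (\<lambda>X. l2_inner lborel a u * v X)"
proof
  fix X
  have "Op m (rank_one u v) a X = (LINT Y|lborel. (a Y * cnj (u Y)) * v X)"
    by (simp add: Op_eq_kernel rank_one_schwartz kernel_rank_one assms mult_ac)
  then show "Op m (rank_one u v) a X = l2_inner lborel a u * v X"
    by (simp add: l2_inner_def)
qed

lemma Op_mult_const:
  assumes "f \<in> schwartz" shows "Op m f (\<lambda>x. c * u x) = (\<lambda>X. c * Op m f u X)"
  by (simp add: Op_eq_kernel[OF assms] fun_eq_iff mult.left_commute)

lemma Op_add:
  assumes f: "f \<in> schwartz" and u: "u \<in> schwartz" and v: "v \<in> schwartz"
  shows "Op m f (\<lambda>x. u x + v x) = (\<lambda>X. Op m f u X + Op m f v X)"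
proof
  fix X
  have "integrable lborel (\<lambda>Y. kernel f (X, Y) * u Y)" "integrable lborel (\<lambda>Y. kernel f (X, Y) * v Y)"
    by (intro schwartz_integrable schwartz_mult schwartz_slice kernel_schwartz f u v)+
  then show "Op m f (\<lambda>x. u x + v x) X = Op m f u X + Op m f v X"
    by (simp add: Op_eq_kernel[OF f] distrib_left)
qed

text \<open>For fixed X, applying the operators to the conjugate of w pairs the kernel row at X with
  w, and Schwartz rows are determined by these pairings.\<close>

lemma Op_inject:
  assumes f: "f \<in> schwartz" and g: "g \<in> schwartz"
    and eq: "\<And>u. u \<in> schwartz \<Longrightarrow> Op m f u = Op m g u"
  shows "f = g"
proof (rule kernel_inject[OF f g])
  have "(\<lambda>Y. kernel f (X, Y)) = (\<lambda>Y. kernel g (X, Y))" for X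
  proof (rule schwartz_eqI)
    fix w :: "'a \<Rightarrow> complex" assume "w \<in> schwartz"
    from fun_cong[OF eq[OF schwartz_cnj[OF this]], of X]
    show "l2_inner lborel (\<lambda>Y. kernel f (X, Y)) w = l2_inner lborel (\<lambda>Y. kernel g (X, Y)) w"
      by (simp add: Op_eq_kernel f g l2_inner_def)
  qed (intro schwartz_slice kernel_schwartz f g)+
  from fun_cong[OF this] show "kernel f = kernel g" by auto
qed

text \<open>Every Schwartz kernel is the kernel of a Schwartz symbol, so testing symbols amounts to
  testing kernels.\<close>

lemma Xi_eqI:
  fixes f g :: "'a \<times> 'a \<Rightarrow> complex"
  assumes f: "f \<in> schwartz" and g: "g \<in> schwartz"
    and eq: "\<And>h. h \<in> schwartz \<Longrightarrow> l2_inner Xi_lebesgue f h = l2_inner Xi_lebesgue g h"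
  shows "f = g"
proof (rule kernel_inject[OF f g], rule schwartz_eqI)
  fix w :: "'a \<times> 'a \<Rightarrow> complex" assume w: "w \<in> schwartz"
  show "l2_inner lborel (kernel f) w = l2_inner lborel (kernel g) w"
    using eq[OF symbol_schwartz[OF w]] by (simp add: kernel_isometry kernel_symbol symbol_schwartz f g w)
qed (intro kernel_schwartz f g)+

lemma Op_inner_rank_one:
  assumes "f \<in> schwartz" "u \<in> schwartz" "v \<in> schwartz"
  shows "l2_inner lborel (Op m f u) v = l2_inner Xi_lebesgue f (rank_one u v)"
  using assms by (simp add: Op_inner_kernel(1) kernel_isometry kernel_rank_one rank_one_schwartz)

text \<open>A matrix coefficient of \<open>Op m f\<close> pairs the kernel of f with a rank one
  kernel, and \<open>kernel_isometry\<close> carries this pairing over to symbols.\<close>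

lemma wigner_eq_rank_one:
  assumes u: "u \<in> schwartz" and v: "v \<in> schwartz" shows "wigner m u v = rank_one u v"
  unfolding wigner_def
proof (rule the_equality)
  show "rank_one u v \<in> schwartz \<and>
    (\<forall>f\<in>schwartz. l2_inner lborel (Op m f u) v = l2_inner Xi_lebesgue f (rank_one u v))"
    using Op_inner_rank_one rank_one_schwartz u v by blast
  fix W assume W: "W \<in> schwartz \<and> (\<forall>f\<in>schwartz. l2_inner lborel (Op m f u) v = l2_inner Xi_lebesgue f W)"
  show "W = rank_one u v"
  proof (rule Xi_eqI)
    fix h :: "'a \<times> 'a \<Rightarrow> complex" assume "h \<in> schwartz"
    then have "l2_inner Xi_lebesgue h W = l2_inner Xi_lebesgue h (rank_one u v)"
      using W Op_inner_rank_one u v by metis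
    then show "l2_inner Xi_lebesgue W h = l2_inner Xi_lebesgue (rank_one u v) h"
      by (metis l2_inner_commute)
  qed (use W rank_one_schwartz u v in auto)
qed

text \<open>An operator determines its symbol, so the definite description is resolved by checking a
  candidate.\<close>

lemma sharp_eqI:
  assumes "k \<in> schwartz" "\<And>u. u \<in> schwartz \<Longrightarrow> Op m k u = Op m f (Op m g u)"
  shows "sharp m f g = k"
  unfolding sharp_def
proof (rule the_equality)
  show "l = k" if "l \<in> schwartz \<and> (\<forall>u\<in>schwartz. Op m l u = Op m f (Op m g u))" for l
    using that assms by (intro Op_inject) auto
qed (use assms in auto)

text \<open>The scalar product of \<open>Op m g a\<close> with u is that of a with
  \<open>adj_op g u\<close>; the range stays spanned by v and only the functional changes.\<close>

lemma sharp_rank_one_left: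
  assumes g: "g \<in> schwartz" and u: "u \<in> schwartz" and v: "v \<in> schwartz"
  shows "sharp m (rank_one u v) g = rank_one (adj_op g u) v"
  by (rule sharp_eqI)
     (simp_all add: rank_one_schwartz adj_op_schwartz Op_rank_one Op_inner_kernel(2) g u v)

lemma sharp_rank_one_right:
  assumes g: "g \<in> schwartz" and u: "u \<in> schwartz" and v: "v \<in> schwartz"
  shows "sharp m g (rank_one u v) = rank_one u (Op m g v)"
  by (rule sharp_eqI) (simp_all add: rank_one_schwartz Op_schwartz Op_rank_one Op_mult_const g u v)

lemma sharp_adj_rank_one:
  assumes u: "u \<in> schwartz" and v: "v \<in> schwartz" shows "sharp_adj m (rank_one u v) = rank_one v u"
  unfolding sharp_adj_def
proof (rule the_equality)
  have *: "l2_inner lborel (Op m (rank_one v u) a) b = l2_inner lborel a (Op m (rank_one u v) b)" for a b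
    by (simp only: Op_rank_one[OF u v] Op_rank_one[OF v u] l2_inner_mult_left l2_inner_mult_right)
       (metis l2_inner_commute mult.commute)
  then show "rank_one v u \<in> schwartz \<and> (\<forall>a\<in>schwartz. \<forall>b\<in>schwartz.
      l2_inner lborel (Op m (rank_one v u) a) b = l2_inner lborel a (Op m (rank_one u v) b))"
    by (simp add: rank_one_schwartz u v)
  fix k assume k: "k \<in> schwartz \<and> (\<forall>a\<in>schwartz. \<forall>b\<in>schwartz.
      l2_inner lborel (Op m k a) b = l2_inner lborel a (Op m (rank_one u v) b))"
  show "k = rank_one v u"
  proof (rule Op_inject)
    fix a :: "'a \<Rightarrow> complex" assume a: "a \<in> schwartz"
    show "Op m k a = Op m (rank_one v u) a"
      by (rule schwartz_eqI) (use k a * in \<open>auto simp: Op_schwartz rank_one_schwartz u v\<close>)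
  qed (use k rank_one_schwartz u v in auto)
qed

section \<open>The Weyl system\<close>

lemma translate_schwartz: "u \<in> schwartz \<Longrightarrow> (\<lambda>X. u (m Z X)) \<in> schwartz"
  by (rule schwartz_comp[of _ _ "m (- Z)"]) (auto intro!: poly_intros)

definition weyl_adj :: "'a \<times> 'a \<Rightarrow> ('a \<Rightarrow> complex) \<Rightarrow> 'a \<Rightarrow> complex" where
  "weyl_adj z w X = cis (- (m (fst z) X \<bullet> snd z)) * w (m (fst z) X)"

lemma weyl_schwartz:
  assumes "u \<in> schwartz" shows "weyl m z u \<in> schwartz"
proof (cases z)
  case (Pair Z \<zeta>)
  have "(\<lambda>X. cis (X \<bullet> \<zeta>) * u (m (- Z) X)) \<in> schwartz"
    by (rule schwartz_cis_mult[OF translate_schwartz[OF assms]])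
  then show ?thesis by (simp add: weyl_def Pair)
qed

lemma weyl_adj_schwartz:
  assumes "w \<in> schwartz" shows "weyl_adj z w \<in> schwartz"
  using translate_schwartz[OF schwartz_cis_mult[OF assms, of "- snd z"], of "fst z"]
  by (simp add: weyl_adj_def[abs_def])

text \<open>Substituting \<open>m Z X\<close> for X preserves Lebesgue measure and moves the
  translation to v; the phase is then taken at the translated point, as in
  \<open>weyl_adj\<close>.\<close>

lemma weyl_inner:
  assumes u: "u \<in> schwartz" and v: "v \<in> schwartz"
  shows "l2_inner lborel (weyl m z u) v = l2_inner lborel u (weyl_adj z v)"
proof -
  have "(\<lambda>X. weyl m z u X * cnj (v X)) \<in> schwartz"
    by (intro schwartz_mult schwartz_cnj weyl_schwartz u v)
  from integral_left_mult[OF schwartz_measurable[OF this], of "fst z"]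
  show ?thesis
    by (simp add: l2_inner_def weyl_def weyl_adj_def split_def cis_cnj mult_ac)
qed

text \<open>In weak form, \<open>eps z\<close> is the symbol of \<open>weyl m z\<close>. It is
  bounded but not Schwartz, so rank one symbols serve as test functions: integrating the phase in
  \<xi> evaluates their kernel at \<open>(X, m (- Z) X)\<close>.\<close>

lemma dist_of_eps_rank_one:
  assumes a: "a \<in> schwartz" and b: "b \<in> schwartz"
  shows "dist_of (eps z) (rank_one a b) = l2_inner lborel (weyl m z a) b"
proof -
  obtain Z \<zeta> where z: "z = (Z, \<zeta>)" by (cases z)
  let ?h = "rank_one a b"
  let ?F = "\<lambda>p. cis (fst p \<bullet> \<zeta>) * cis (- (Z \<bullet> snd p)) * cnj (?h p)"
  have h: "?h \<in> schwartz" by (rule rank_one_schwartz[OF a b])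
  have [measurable]: "?h \<in> borel_measurable borel" by (rule schwartz_measurable[OF h])
  have F [measurable]: "?F \<in> borel_measurable borel" by measurable
  have i: "integrable lborel ?F"
    by (rule Bochner_Integration.integrable_bound[OF schwartz_integrable[OF h]]) (use F in \<open>auto simp: norm_mult\<close>)
  have inner: "dual_factor TYPE('a) * (LINT \<xi>|lborel. ?F (X, \<xi>)) = weyl m z a X * cnj (b X)" for X
  proof -
    have "(LINT \<xi>|lborel. ?F (X, \<xi>)) = cis (X \<bullet> \<zeta>) * cnj (partial_fourier ?h (X, Z))"
      unfolding partial_fourier_def Bochner_Integration.integral_cnj[symmetric] integral_mult_right_zero[symmetric]
      by (simp add: cis_cnj mult.assoc)
    then have "dual_factor TYPE('a) * (LINT \<xi>|lborel. ?F (X, \<xi>)) = cis (X \<bullet> \<zeta>) * cnj (kernel ?h (X, m (- Z) X))"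
      by (simp add: kernel_def inverse_mult)
    then show ?thesis
      by (simp add: kernel_rank_one[OF a b] weyl_def z)
  qed
  have "dist_of (eps z) ?h = (LINT p|Xi_lebesgue. ?F p)"
    by (simp add: dist_of_def l2_inner_def eps_def z split_def)
  also have "\<dots> = dual_factor TYPE('a) * (LINT X|lborel. LINT \<xi>|lborel. ?F (X, \<xi>))"
    by (simp only: integral_Xi_lebesgue[OF F] lborel_integral_fst[OF i])
  also have "\<dots> = (LINT X|lborel. dual_factor TYPE('a) * (LINT \<xi>|lborel. ?F (X, \<xi>)))"
    by (rule integral_mult_right_zero[symmetric])
  finally show ?thesis
    unfolding inner l2_inner_def .
qed

lemma schwartz_of_eqI:
  fixes k :: "'a \<times> 'a \<Rightarrow> complex"
  assumes k: "k \<in> schwartz" and F: "\<And>h. h \<in> schwartz \<Longrightarrow> F h = dist_of k h"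
  shows "schwartz_of F = k"
  unfolding schwartz_of_def
proof (rule the_equality)
  show "l = k" if "l \<in> schwartz \<and> (\<forall>h\<in>schwartz. F h = dist_of l h)" for l
    using that assms by (intro Xi_eqI) (auto simp: dist_of_def)
qed (use assms in auto)

text \<open>The nested dualities move both Weyl symbols onto the window, until f is paired with a
  single rank one symbol.\<close>

lemma frak_E_rank_one:
  assumes f: "f \<in> schwartz" and a: "a \<in> schwartz" and b: "b \<in> schwartz"
  shows "frak_E m (rank_one a b) (dist_of f) (y, z) = l2_inner lborel (Op m f (weyl_adj z a)) (weyl_adj y b)"
proof -
  have a': "weyl_adj z a \<in> schwartz" and b': "weyl_adj y b \<in> schwartz"
    by (intro weyl_adj_schwartz a b)+
  \<comment> \<open>The adjoint of \<open>eps z\<close> is taken twice, once in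
    \<open>frak_E\<close> and once by the duality that moves the right factor, and the two cancel.
    Only the functional of the rank one window changes, from a to
    \<open>weyl_adj z a\<close>.\<close>
  have 1: "schwartz_of (fun_sharp_dist m (rank_one a b) (dist_adj m (dist_adj m (dist_of (eps z))))) =
      rank_one (weyl_adj z a) b"
  proof (rule schwartz_of_eqI[OF rank_one_schwartz[OF a' b]])
    fix k :: "'a \<times> 'a \<Rightarrow> complex" assume k: "k \<in> schwartz"
    have k': "adj_op k b \<in> schwartz" by (rule adj_op_schwartz[OF k b])
    have "fun_sharp_dist m (rank_one a b) (dist_adj m (dist_adj m (dist_of (eps z)))) k =
        l2_inner lborel (weyl m z (adj_op k b)) a"
      by (simp add: fun_sharp_dist_def dist_adj_def sharp_adj_rank_one sharp_rank_one_left
          dist_of_eps_rank_one k k' a b)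
    also have "\<dots> = cnj (l2_inner lborel (weyl_adj z a) (adj_op k b))"
      unfolding weyl_inner[OF k' a] by (rule l2_inner_commute)
    also have "\<dots> = cnj (l2_inner Xi_lebesgue k (rank_one (weyl_adj z a) b))"
      by (simp only: Op_inner_kernel(2)[OF k a' b, symmetric] Op_inner_rank_one[OF k a' b])
    also have "\<dots> = dist_of (rank_one (weyl_adj z a) b) k"
      unfolding dist_of_def by (rule l2_inner_commute[symmetric])
    finally show "fun_sharp_dist m (rank_one a b) (dist_adj m (dist_adj m (dist_of (eps z)))) k =
        dist_of (rank_one (weyl_adj z a) b) k" .
  qed
  \<comment> \<open>The left factor is moved with a single adjoint and acts on the range of the
    operator, so b becomes \<open>weyl_adj y b\<close>.\<close>
  have 2: "schwartz_of (dist_sharp_fun m (dist_adj m (dist_of (eps y))) (rank_one (weyl_adj z a) b)) =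
      rank_one (weyl_adj z a) (weyl_adj y b)"
  proof (rule schwartz_of_eqI[OF rank_one_schwartz[OF a' b']])
    fix k :: "'a \<times> 'a \<Rightarrow> complex" assume k: "k \<in> schwartz"
    have k': "Op m k (weyl_adj z a) \<in> schwartz" by (rule Op_schwartz[OF k a'])
    have "dist_sharp_fun m (dist_adj m (dist_of (eps y))) (rank_one (weyl_adj z a) b) k =
        cnj (l2_inner lborel (weyl m y (Op m k (weyl_adj z a))) b)"
      by (simp add: dist_sharp_fun_def dist_adj_def sharp_adj_rank_one sharp_rank_one_right
          dist_of_eps_rank_one k k' a' b)
    also have "\<dots> = cnj (l2_inner Xi_lebesgue k (rank_one (weyl_adj z a) (weyl_adj y b)))"
      by (simp only: weyl_inner[OF k' b] Op_inner_rank_one[OF k a' b'])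
    also have "\<dots> = dist_of (rank_one (weyl_adj z a) (weyl_adj y b)) k"
      unfolding dist_of_def by (rule l2_inner_commute[symmetric])
    finally show "dist_sharp_fun m (dist_adj m (dist_of (eps y))) (rank_one (weyl_adj z a) b) k =
        dist_of (rank_one (weyl_adj z a) (weyl_adj y b)) k" .
  qed
  show ?thesis
    by (simp add: frak_E_def dist_sharp_moyal_def moyal_sharp_dist_def 1 2)
       (simp add: dist_of_def Op_inner_rank_one[OF f a' b'])
qed

section \<open>The Fourier-Wigner transform\<close>

text \<open>This form yields the Schwartz property and, through Parseval in \<zeta>, the
  orthogonality relations.\<close>

lemma fourier_wigner_eq:
  "fourier_wigner m u w (Z, \<zeta>) = partial_fourier (\<lambda>q. u (m (- fst q) (snd q)) * cnj (w (snd q))) (Z, \<zeta>)"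
  by (simp add: fourier_wigner_def l2_inner_def weyl_def partial_fourier_def inner_commute mult.assoc)

lemma translate_mult_schwartz:
  assumes "u \<in> schwartz" "w \<in> schwartz"
  shows "(\<lambda>q. u (m (- fst q) (snd q)) * w (snd q)) \<in> schwartz"
proof -
  have "(\<lambda>q. (\<lambda>p. u (fst p) * w (snd p)) (m (- fst q) (snd q), snd q)) \<in> schwartz"
    by (rule schwartz_comp[OF schwartz_tensor[OF assms], of _ "\<lambda>p. (m (snd p) (- fst p), snd p)"])
       (auto intro!: poly_intros simp: inverse_mult)
  then show ?thesis by simp
qed

lemma fourier_wigner_schwartz:
  assumes "u \<in> schwartz" "w \<in> schwartz" shows "fourier_wigner m u w \<in> schwartz"
proof -
  have "fourier_wigner m u w = partial_fourier (\<lambda>q. u (m (- fst q) (snd q)) * cnj (w (snd q)))"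
    by (rule ext) (auto simp: fourier_wigner_eq)
  then show ?thesis
    using partial_fourier_schwartz[OF translate_mult_schwartz[OF assms(1) schwartz_cnj[OF assms(2)]]] by simp
qed

text \<open>After Parseval in \<zeta>, u and v occur only at \<open>m (- Z) X\<close>. Integrating
  over Z first removes X from their arguments and so decouples them from the window.\<close>

lemma fourier_wigner_orthogonality:
  assumes u: "u \<in> schwartz" and v: "v \<in> schwartz" and w: "w \<in> schwartz"
  shows "l2_inner Xi_lebesgue (fourier_wigner m u w) (fourier_wigner m v w) =
    l2_inner lborel u v * l2_inner lborel w w"
proof -
  let ?c = "dual_factor TYPE('a)"
  let ?G = "\<lambda>u q. u (m (- fst q) (snd q)) * cnj (w (snd q))"
  have G: "?G u \<in> schwartz" if "u \<in> schwartz" for u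
    by (rule translate_mult_schwartz[OF that schwartz_cnj[OF w]])
  have GG: "(\<lambda>q. ?G u q * cnj (?G v q)) \<in> schwartz"
    by (intro schwartz_mult schwartz_cnj G u v)
  have EE: "(\<lambda>z. fourier_wigner m u w z * cnj (fourier_wigner m v w z)) \<in> schwartz"
    by (intro schwartz_mult schwartz_cnj fourier_wigner_schwartz u v w)
  have inner: "?c * (LINT \<zeta>|lborel. fourier_wigner m u w (Z, \<zeta>) * cnj (fourier_wigner m v w (Z, \<zeta>))) =
      (LINT X|lborel. ?G u (Z, X) * cnj (?G v (Z, X)))" for Z
    unfolding fourier_wigner_eq partial_fourier_slice parseval[OF schwartz_slice[OF G[OF u]] schwartz_slice[OF G[OF v]]]
    by (simp only: mult.assoc[symmetric] dual_factor_inverse mult_1)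
  have "l2_inner Xi_lebesgue (fourier_wigner m u w) (fourier_wigner m v w) =
      ?c * (LINT Z|lborel. LINT \<zeta>|lborel. fourier_wigner m u w (Z, \<zeta>) * cnj (fourier_wigner m v w (Z, \<zeta>)))"
    unfolding l2_inner_def integral_Xi_lebesgue[OF schwartz_measurable[OF EE]]
      lborel_integral_fst[OF schwartz_integrable[OF EE]] ..
  also have "\<dots> = (LINT Z|lborel. LINT X|lborel. ?G u (Z, X) * cnj (?G v (Z, X)))"
    unfolding inner[symmetric] by (rule integral_mult_right_zero[symmetric])
  also have "\<dots> = (LINT X|lborel. LINT Z|lborel. ?G u (Z, X) * cnj (?G v (Z, X)))"
    unfolding lborel_integral_fst[OF schwartz_integrable[OF GG]] lborel_integral_snd[OF schwartz_integrable[OF GG]] ..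
  also have "\<dots> = (LINT X|lborel. l2_inner lborel u v * (w X * cnj (w X)))"
  proof (rule Bochner_Integration.integral_cong[OF refl])
    fix X
    have [measurable]: "u \<in> borel_measurable borel" "v \<in> borel_measurable borel"
      by (intro schwartz_measurable u v)+
    have "(LINT Z|lborel. ?G u (Z, X) * cnj (?G v (Z, X))) =
        (LINT Z|lborel. (u (m (- Z) X) * cnj (v (m (- Z) X))) * (w X * cnj (w X)))"
      by (simp add: mult_ac)
    also have "\<dots> = (LINT Z|lborel. u (m (- Z) X) * cnj (v (m (- Z) X))) * (w X * cnj (w X))"
      by (rule integral_mult_left_zero)
    also have "(LINT Z|lborel. u (m (- Z) X) * cnj (v (m (- Z) X))) = l2_inner lborel u v"
      unfolding l2_inner_def by (rule integral_uminus_mult) measurable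
    finally show "(LINT Z|lborel. ?G u (Z, X) * cnj (?G v (Z, X))) = l2_inner lborel u v * (w X * cnj (w X))" .
  qed
  finally show ?thesis
    by (simp add: l2_inner_def)
qed

text \<open>Both slots of the matrix coefficient are translated, so after two left translations it becomes
  a partial Fourier transform in the variables that the translations do not touch.\<close>

lemma frak_E_rank_one_schwartz:
  assumes f: "f \<in> schwartz" and a: "a \<in> schwartz" and b: "b \<in> schwartz"
  shows "frak_E m (rank_one a b) (dist_of f) \<in> schwartz"
proof -
  let ?K = "\<lambda>q. kernel f (m (- fst (fst q)) (fst (snd q)), m (- snd (fst q)) (snd (snd q))) *
    (cnj (b (fst (snd q))) * a (snd (snd q)))"
  have K: "?K \<in> schwartz"
  proof -
    have t: "(\<lambda>p. (\<lambda>x. cnj (b x)) (fst p) * a (snd p)) \<in> schwartz"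
      by (intro schwartz_tensor schwartz_cnj a b)
    have "(\<lambda>q. (\<lambda>r. kernel f (fst r) * ((\<lambda>x. cnj (b x)) (fst (snd r)) * a (snd (snd r))))
        ((m (- fst (fst q)) (fst (snd q)), m (- snd (fst q)) (snd (snd q))), snd q)) \<in> schwartz"
      by (rule schwartz_comp[OF schwartz_tensor[OF kernel_schwartz[OF f] t],
            of _ "\<lambda>r. ((m (fst (snd r)) (- fst (fst r)), m (snd (snd r)) (- snd (fst r))), snd r)"])
         (auto intro!: poly_intros simp: inverse_mult)
    then show ?thesis by simp
  qed
  \<comment> \<open>The two frequencies carry opposite signs because only the second argument of the
    scalar product is conjugated.\<close>
  have eq: "frak_E m (rank_one a b) (dist_of f) ((Z, \<zeta>), (Z', \<zeta>')) = partial_fourier ?K ((Z, Z'), (\<zeta>, - \<zeta>'))"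
    for Z \<zeta> Z' \<zeta>'
  proof -
    let ?a = "weyl_adj (Z', \<zeta>') a" and ?b = "weyl_adj (Z, \<zeta>) b"
    have a': "?a \<in> schwartz" and b': "?b \<in> schwartz"
      by (intro weyl_adj_schwartz a b)+
    let ?I = "\<lambda>p. cis ((\<zeta>, - \<zeta>') \<bullet> p) * ?K ((Z, Z'), p)"
    have i: "integrable lborel ?I"
      by (intro schwartz_integrable schwartz_slice_cis K)
    have 1: "(LINT Y|lborel. kernel f (m (- Z) X, Y) * ?a Y) =
        (LINT Y|lborel. kernel f (m (- Z) X, m (- Z') Y) * (cis (- (Y \<bullet> \<zeta>')) * a Y))" for X
    proof -
      have "(\<lambda>Y. kernel f (m (- Z) X, Y) * ?a Y) \<in> schwartz"
        by (intro schwartz_mult schwartz_slice kernel_schwartz f a')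
      from integral_left_mult[OF schwartz_measurable[OF this], of "- Z'"]
      show ?thesis by (simp add: weyl_adj_def)
    qed
    have "l2_inner lborel (Op m f ?a) ?b = (LINT X|lborel. Op m f ?a X * cnj (?b X))"
      by (simp add: l2_inner_def)
    also have "\<dots> = (LINT X|lborel. Op m f ?a (m (- Z) X) * cnj (?b (m (- Z) X)))"
      by (rule integral_left_mult[symmetric])
         (intro schwartz_measurable schwartz_mult schwartz_cnj Op_schwartz f a' b')
    also have "\<dots> = (LINT X|lborel. LINT Y|lborel. ?I (X, Y))"
      unfolding Op_eq_kernel[OF f] 1 integral_mult_left_zero[symmetric]
      by (simp add: weyl_adj_def cis_cnj inner_commute[of \<zeta>] inner_commute[of \<zeta>'] mult_ac
          cis_mult[of "_ \<bullet> \<zeta>", symmetric] diff_conv_add_uminus del: add_uminus_conv_diff)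
    also have "\<dots> = partial_fourier ?K ((Z, Z'), (\<zeta>, - \<zeta>'))"
      using lborel_integral_fst[OF i] by (simp add: partial_fourier_def)
    finally show ?thesis
      by (simp only: frak_E_rank_one[OF f a b])
  qed
  have "frak_E m (rank_one a b) (dist_of f) =
      (\<lambda>p. partial_fourier ?K ((fst (fst p), fst (snd p)), (snd (fst p), - snd (snd p))))"
    by (rule ext) (auto simp only: split_paired_all fst_conv snd_conv eq)
  also have "\<dots> \<in> schwartz"
    by (rule schwartz_comp[OF partial_fourier_schwartz[OF K],
          of _ "\<lambda>q. ((fst (fst q), fst (snd q)), (snd (fst q), - snd (snd q)))"])
       (auto intro!: poly_intros)
  finally show ?thesis .
qed

text \<open>The resolution of the identity enters in weak form, which avoids function-valued
  integrals: the orthogonality relations are applied to u and the adjoint image of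
  \<open>weyl_adj y b\<close>, and the row of \<open>frak_E\<close> at y is the conjugate of the
  transform of that image.\<close>

lemma fourier_wigner_Op:
  assumes f: "f \<in> schwartz" and u: "u \<in> schwartz" and a: "a \<in> schwartz" and b: "b \<in> schwartz"
    and norm: "l2_inner lborel a a = 1"
  shows "fourier_wigner m (Op m f u) b = Int_op (frak_E m (rank_one a b) (dist_of f)) (fourier_wigner m u a)"
proof
  fix y
  let ?v = "adj_op f (weyl_adj y b)"
  have v: "?v \<in> schwartz" by (intro adj_op_schwartz weyl_adj_schwartz f b)
  have 1: "frak_E m (rank_one a b) (dist_of f) (y, z) = cnj (fourier_wigner m ?v a z)" for z
  proof -
    have "frak_E m (rank_one a b) (dist_of f) (y, z) = l2_inner lborel (weyl_adj z a) ?v"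
      by (simp only: frak_E_rank_one[OF f a b] Op_inner_kernel(2)[OF f weyl_adj_schwartz[OF a] weyl_adj_schwartz[OF b]])
    also have "\<dots> = cnj (l2_inner lborel ?v (weyl_adj z a))"
      by (rule l2_inner_commute)
    finally show ?thesis by (simp only: fourier_wigner_def weyl_inner[OF v a])
  qed
  have "fourier_wigner m (Op m f u) b y = l2_inner lborel u ?v"
    by (simp only: fourier_wigner_def weyl_inner[OF Op_schwartz[OF f u] b]
        Op_inner_kernel(2)[OF f u weyl_adj_schwartz[OF b]])
  also have "\<dots> = l2_inner Xi_lebesgue (fourier_wigner m u a) (fourier_wigner m ?v a)"
    by (simp add: fourier_wigner_orthogonality[OF u v a] norm)
  also have "\<dots> = Int_op (frak_E m (rank_one a b) (dist_of f)) (fourier_wigner m u a) y"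
    unfolding Int_op_def l2_inner_def 1 by (simp only: mult.commute)
  finally show "fourier_wigner m (Op m f u) b y = \<dots>" .
qed

end

section \<open>Transfer of the operator norm bound\<close>

theorem theorem6p9:
  fixes G :: "('g, 'm) monoid_scheme"
    and lie :: "'a::euclidean_space \<Rightarrow> 'a \<Rightarrow> 'a"
    and Exp :: "'a \<Rightarrow> 'g"
    and m :: "'a \<Rightarrow> 'a \<Rightarrow> 'a"
    and w\<^sub>1 w\<^sub>2 :: "'a \<Rightarrow> complex"
    and \<B>\<^sub>1 \<B>\<^sub>2 :: "('a \<times> 'a \<Rightarrow> complex) \<Rightarrow> real"
    and \<BB> :: "(('a \<times> 'a) \<times> ('a \<times> 'a) \<Rightarrow> complex) \<Rightarrow> real"
    and C :: real
  assumes "nilpotent_lie_group G lie Exp"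
    and "m = log_mult G Exp"
    and "w\<^sub>1 \<in> schwartz" and "w\<^sub>2 \<in> schwartz"
    and "l2_norm lborel w\<^sub>1 = 1" and "l2_norm lborel w\<^sub>2 = 1"
    and "norm_on schwartz \<B>\<^sub>1" and "norm_on schwartz \<B>\<^sub>2" and "norm_on schwartz \<BB>"
    and "C > 0"
    and "\<And>\<Psi>. \<Psi> \<in> schwartz \<Longrightarrow>
           bounded_operator schwartz \<B>\<^sub>1 schwartz \<B>\<^sub>2 (Int_op \<Psi>) \<and>
           operator_norm schwartz \<B>\<^sub>1 \<B>\<^sub>2 (Int_op \<Psi>) \<le> C * \<BB> \<Psi>"
  shows "\<forall>f \<in> schwartz.
           bounded_operator schwartz (co_norm m w\<^sub>1 \<B>\<^sub>1) schwartz (co_norm m w\<^sub>2 \<B>\<^sub>2) (Op m f) \<and>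
           operator_norm schwartz (co_norm m w\<^sub>1 \<B>\<^sub>1) (co_norm m w\<^sub>2 \<B>\<^sub>2) (Op m f)
             \<le> C * Co_norm m (wigner m w\<^sub>1 w\<^sub>2) \<BB> f"
proof
  fix f :: "'a \<times> 'a \<Rightarrow> complex" assume f: "f \<in> schwartz"
  interpret polynomial_group m
    using nilpotent_lie_group.polynomial_group_log_mult[OF assms(1)] assms(2) by simp
  have w: "w\<^sub>1 \<in> schwartz" "w\<^sub>2 \<in> schwartz" by fact+
  let ?\<Psi> = "frak_E m (wigner m w\<^sub>1 w\<^sub>2) (dist_of f)"
  have \<Psi>: "?\<Psi> \<in> schwartz"
    unfolding wigner_eq_rank_one[OF w] by (rule frak_E_rank_one_schwartz[OF f w])
  have "(LINT x|lborel. (norm (w\<^sub>1 x))\<^sup>2) = 1"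
    using assms(5) by (simp add: l2_norm_def)
  moreover have "l2_inner lborel w\<^sub>1 w\<^sub>1 = of_real (LINT x|lborel. (norm (w\<^sub>1 x))\<^sup>2)"
    unfolding l2_inner_def complex_norm_square[symmetric] by (rule integral_complex_of_real)
  ultimately have norm: "l2_inner lborel w\<^sub>1 w\<^sub>1 = 1" by simp
  have intertwine: "co_norm m w\<^sub>2 \<B>\<^sub>2 (Op m f u) = \<B>\<^sub>2 (Int_op ?\<Psi> (fourier_wigner m u w\<^sub>1))"
    if "u \<in> schwartz" for u
    unfolding co_norm_def wigner_eq_rank_one[OF w] fourier_wigner_Op[OF f that w norm] ..
  let ?bounds = "\<lambda>V p q T. {B. 0 \<le> B \<and> (\<forall>u\<in>V. q (T u) \<le> B * p u)}"
  \<comment> \<open>Transforms of Schwartz functions are Schwartz, so every bound for the integral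
    operator applies to them and becomes a bound for \<open>Op m f\<close>.\<close>
  have sub: "?bounds schwartz \<B>\<^sub>1 \<B>\<^sub>2 (Int_op ?\<Psi>)
      \<subseteq> ?bounds schwartz (co_norm m w\<^sub>1 \<B>\<^sub>1) (co_norm m w\<^sub>2 \<B>\<^sub>2) (Op m f)"
    using fourier_wigner_schwartz[OF _ w(1)] by (auto simp: intertwine co_norm_def[of _ "w\<^sub>1" "\<B>\<^sub>1"])
  obtain B where B: "\<And>g. g \<in> schwartz \<Longrightarrow> \<B>\<^sub>2 (Int_op ?\<Psi> g) \<le> B * \<B>\<^sub>1 g"
    using assms(11)[OF \<Psi>] unfolding bounded_operator_def by blast
  have "\<B>\<^sub>2 (Int_op ?\<Psi> g) \<le> max B 0 * \<B>\<^sub>1 g" if "g \<in> schwartz" for g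
  proof -
    have "0 \<le> \<B>\<^sub>1 g" using assms(7) that unfolding norm_on_def by blast
    then have "B * \<B>\<^sub>1 g \<le> max B 0 * \<B>\<^sub>1 g" by (intro mult_right_mono) auto
    then show ?thesis using B[OF that] by simp
  qed
  \<comment> \<open>The infimum in \<open>operator_norm\<close> runs over nonnegative bounds,
    whereas the constant from \<open>bounded_operator\<close> carries no sign; the maximum with 0
    certifies that the set is nonempty.\<close>
  then have mem: "max B 0 \<in> ?bounds schwartz \<B>\<^sub>1 \<B>\<^sub>2 (Int_op ?\<Psi>)" by simp
  have "bounded_operator schwartz (co_norm m w\<^sub>1 \<B>\<^sub>1) schwartz (co_norm m w\<^sub>2 \<B>\<^sub>2) (Op m f)"
    unfolding bounded_operator_def linear_map_on_def
    using Op_schwartz[OF f] Op_add[OF f] Op_mult_const[OF f] subsetD[OF sub mem] by blast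
  \<comment> \<open>The larger set of bounds has the smaller infimum, both sets being bounded below
    by 0.\<close>
  moreover have "operator_norm schwartz (co_norm m w\<^sub>1 \<B>\<^sub>1) (co_norm m w\<^sub>2 \<B>\<^sub>2) (Op m f)
      \<le> operator_norm schwartz \<B>\<^sub>1 \<B>\<^sub>2 (Int_op ?\<Psi>)"
    unfolding operator_norm_def
    by (rule cInf_superset_mono[OF _ _ sub]) (use mem in \<open>blast, auto intro: bdd_belowI[of _ 0]\<close>)
  ultimately show "bounded_operator schwartz (co_norm m w\<^sub>1 \<B>\<^sub>1) schwartz (co_norm m w\<^sub>2 \<B>\<^sub>2) (Op m f) \<and>
      operator_norm schwartz (co_norm m w\<^sub>1 \<B>\<^sub>1) (co_norm m w\<^sub>2 \<B>\<^sub>2) (Op m f)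
        \<le> C * Co_norm m (wigner m w\<^sub>1 w\<^sub>2) \<BB> f"
    using assms(11)[OF \<Psi>] unfolding Co_norm_def by auto
qed

end
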